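(* Consider the one-epoch coalescence process (OCP) with parameters $0<d_{\min}<d_{\max}$ and rates $\lambda_\ell,\lambda_r$ as defined in the context. Let $\nu,\mu$ be probability measures on $\mathbb R$ and $[d_{\min},\infty)$, respectively, and for $t\in[0,\infty]$ let $\nu_t,\mu_t$ be the probability measures on $\mathbb R$ and $[d_{\min},\infty)$ such that, when $\xi(0)$ has law $\mathrm{Ren}(\nu,\mu)$, $\xi(t)$ has law $\mathrm{Ren}(\nu_t,\mu_t)$. (i) For $s\in\mathbb R_+\cup i\mathbb R$ put $$G_t(s)=\int_{[d_{\min},\infty)}e^{-sx}\mu_t(dx),\qquad H_t(s)=\int_{[d_{\min},d_{\max})}e^{-sx}\mu_t(dx).$$ Then, for any $s\in\mathbb R_+\cup i\mathbb R$, $$1-G_\infty(s)=[1-G_0(s)]\,e^{H_0(s)} .$$ (ii) For $s\in\mathbb R_+\cup i\mathbb R$ put $L_t(s)=\int e^{-sx}\nu_t(dx)$. (a) If $\lambda_r\equiv0$, then $\nu_t=\nu_0$ for all $t\ge0$; hence $L_t(s)=L_0(s)$ for all $t\ge0$. (b) If $\lambda_\ell=\gamma\lambda_r$ for some $\gamma\in[0,\infty)$, then for any $s\in\mathbb R_+\cup i\mathbb R$, $$L_\infty(s)=L_0(s)\exp\Big\{\frac{H_0(s)-H_0(0)}{1+\gamma}\Big\}.$$ Moreover, if $\xi(0)$ has law $\mathcal Q=\mathrm{Ren}(\nu,\mu)$, $$\mathbb P_{\mathcal Q}\big(x_0(0)\in\xi(\infty)\big)=e^{-H_0(0)/(1+\gamma)},$$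 where $x_0(0)$ denotes the first (leftmost) point of the initial configuration $\xi(0)$.
   Context: $\mathbb R_+=[0,\infty)$. For real $s\geq 0$ the Laplace transform $L_t(s)$ may be $+\infty$; the identities in (ii) are then understood in $[0,\infty]$. **Point processes.** $\mathcal N$ is the set of locally finite subsets $\xi\subset\mathbb R$ with the $\sigma$-algebra generated by the maps $\xi\mapsto|\xi\cap A|$, $A\subset\mathbb R$ bounded Borel. A domain of $\xi$ is an interval between two consecutive points of $\xi\cup\{-\infty,+\infty\}$; its length may be $\infty$. $\mathcal N(d_{\min})$ is the set of $\xi\in\mathcal N$ all of whose domains having an endpoint in $\xi$ have length at least $d_{\min}$. $\mathrm{Ren}(\nu,\mu)$ is the law of $\{x_0<x_1<x_2<\cdots\}$ where $x_0$ has law $\nu$, the gaps $x_k-x_{k-1}$ ($k\ge1$) have law $\mu$, and $x_0$ and all gaps are independent. **One-epoch coalescence process (OCP).** Let $0<d_{\min}<d_{\max}$ and let $\lambda_\ell,\lambda_r:[d_{\min},\infty]\to[0,\infty)$ be bounded (Borel) functions, $\lambda=\lambda_\ell+\lambda_r$, such that: (A1) $\lambda(d)>0$ if and only if $d\in[d_{\min},d_{\max})$; (A2) if $d,d'\ge d_{\min}$ then $d+d'\ge d_{\max}$. The OCP is the Markov jump process $(\xi(t))_{t\ge0}$ on $\mathcal N(d_{\min})$ in which each existing domain $[x,x']$ of length $d$ incorporates its left neighbour (the point $x$ is deleted) at rate $\lambda_r(d)$ and its right neighbour (the point $x'$ is deleted) at rate $\lambda_\ell(d)$. Concretely: given $\xi(0)$,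 attach independently to each domain $\Delta=[x,x']$ of $\xi(0)$ of length $d$ an exponential time $T_\Delta$ of parameter $\lambda(d)$ ($T_\Delta=\infty$ if $\lambda(d)=0$) and a coin; at time $T_\Delta$, if $\Delta$ is still a domain, delete $x$ with probability $\lambda_r(d)/\lambda(d)$ and $x'$ with probability $\lambda_\ell(d)/\lambda(d)$. Domains of length $\ge d_{\max}$ (in particular all merged or infinite domains) never act. Points are only deleted, and $\xi(\infty):=\bigcap_{t\ge0}\xi(t)$. $\mathbb P_{\mathcal Q}$ is the law of the process with initial law $\mathcal Q$. It is known that, started from $\mathrm{Ren}(\nu,\mu)$, the law of $\xi(t)$ is $\mathrm{Ren}(\nu_t,\mu_t)$ for some $\nu_t,\mu_t$, for every $t\in[0,\infty]$. *)

theory Defs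
  imports "HOL-Probability.Probability"
begin

section \<open>Point configurations and renewal point processes\<close>

definition configurations :: "real set set" where
  "configurations = {\<xi>. \<forall>A. bounded A \<longrightarrow> finite (\<xi> \<inter> A)}"

definition config_algebra :: "real set measure" where
  "config_algebra = sigma configurations
     {(\<lambda>\<xi>. card (\<xi> \<inter> A)) -` B \<inter> configurations | A B. A \<in> sets borel \<and> bounded A}"

text \<open>A domain is the pair of its endpoints, two consecutive points of
  \<open>\<xi> \<union> {-\<infinity>, \<infinity>}\<close>; its length is the extended real \<open>b - a\<close>.\<close>

definition domains :: "real set \<Rightarrow> (ereal \<times> ereal) set" where
  "domains \<xi> = (let E = ereal ` \<xi> \<union> {-\<infinity>, \<infinity>} in
     {(a, b). a \<in> E \<and> b \<in> E \<and> a < b \<and> (\<forall>c\<in>E. \<not> (a < c \<and> c < b))})"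

definition dlength :: "ereal \<times> ereal \<Rightarrow> ereal" where
  "dlength \<Delta> = snd \<Delta> - fst \<Delta>"

definition separated_configurations :: "real \<Rightarrow> real set set" where
  "separated_configurations dmin =
     {\<xi> \<in> configurations. \<forall>\<Delta>\<in>domains \<xi>.
        fst \<Delta> \<in> ereal ` \<xi> \<or> snd \<Delta> \<in> ereal ` \<xi> \<longrightarrow> ereal dmin \<le> dlength \<Delta>}"

text \<open>Law of \<open>{x0 < x1 < ...}\<close> with \<open>x0\<close> of law \<open>\<nu>\<close> and independent gaps of law \<open>\<mu>\<close>.
  In \<open>Ren \<nu> \<mu>\<close> the gap law \<open>\<mu>\<close> is a measure on the subspace \<open>[dmin, \<infinity>)\<close> of the reals
  (not on all of \<open>borel\<close>), so that every sample of the product space below is locally finite.\<close>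

definition Ren :: "real measure \<Rightarrow> real measure \<Rightarrow> real set measure" where
  "Ren \<nu> \<mu> = distr (\<nu> \<Otimes>\<^sub>M (\<Pi>\<^sub>M k\<in>(UNIV::nat set). \<mu>)) config_algebra
     (\<lambda>(x0, gap). range (\<lambda>n. x0 + (\<Sum>k<n. gap k)))"


section \<open>The one-epoch coalescence process\<close>

text \<open>\<open>lamL d\<close> (\<open>lamR d\<close>) is the rate at which a domain of length \<open>d\<close> incorporates its right
  (left) neighbour, deleting its right (left) endpoint.\<close>

definition ocp_rates :: "real \<Rightarrow> real \<Rightarrow> (ereal \<Rightarrow> real) \<Rightarrow> (ereal \<Rightarrow> real) \<Rightarrow> bool" where
  "ocp_rates dmin dmax lamL lamR \<longleftrightarrow>
     0 < dmin \<and> dmin < dmax \<and>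
     (\<forall>f\<in>{lamL, lamR}. f \<in> borel_measurable (restrict_space borel {ereal dmin..}) \<and>
        bounded (f ` {ereal dmin..}) \<and> (\<forall>d\<ge>ereal dmin. 0 \<le> f d)) \<and>
     (\<forall>d\<ge>ereal dmin. 0 < lamL d + lamR d \<longleftrightarrow> d < ereal dmax) \<and>
     (\<forall>d\<ge>ereal dmin. \<forall>d'\<ge>ereal dmin. ereal dmax \<le> d + d')"

text \<open>A bijection between the points of a locally finite set and a set of consecutive
  integers: the largest point in \<open>(-\<infinity>, 0]\<close> has index \<open>0\<close>. It serves only to attach i.i.d. marks
  to the domains of the initial configuration: a domain with finite left endpoint \<open>x\<close> gets
  the mark with the index of \<open>x\<close>. (Domains with left endpoint \<open>-\<infinity>\<close> have infinite length and,
  by the assumptions on the rates, never act, so the mark read off for them is irrelevant.)\<close>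

definition point_index :: "real set \<Rightarrow> real \<Rightarrow> int" where
  "point_index \<xi> x =
     (if 0 < x then int (card (\<xi> \<inter> {0<..x})) else - int (card (\<xi> \<inter> {x<..0})))"

definition mark_of :: "real set \<Rightarrow> (int \<Rightarrow> real \<times> real) \<Rightarrow> ereal \<times> ereal \<Rightarrow> real \<times> real" where
  "mark_of \<xi> z \<Delta> = z (point_index \<xi> (real_of_ereal (fst \<Delta>)))"

text \<open>The first mark is a standard exponential variable; divided by \<open>lamL d + lamR d > 0\<close> it is
  exponential of parameter \<open>lamL d + lamR d\<close>. The second mark is uniform on \<open>[0, 1]\<close> and realises the
  coin: the left endpoint is chosen with probability \<open>lamR d / (lamL d + lamR d)\<close>.\<close>

definition mark_law :: "(int \<Rightarrow> real \<times> real) measure" where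
  "mark_law = (\<Pi>\<^sub>M k\<in>(UNIV::int set).
     density lborel (\<lambda>x. ennreal (exponential_density 1 x)) \<Otimes>\<^sub>M uniform_measure lborel {0..1})"

definition ring_time ::
  "(ereal \<Rightarrow> real) \<Rightarrow> (ereal \<Rightarrow> real) \<Rightarrow> real set \<Rightarrow> (int \<Rightarrow> real \<times> real) \<Rightarrow> ereal \<times> ereal \<Rightarrow> ereal"
where
  "ring_time lamL lamR \<xi> z \<Delta> = (let rate = lamL (dlength \<Delta>) + lamR (dlength \<Delta>) in
     if 0 < rate then ereal (fst (mark_of \<xi> z \<Delta>) / rate) else \<infinity>)"

definition deleted_endpoint ::
  "(ereal \<Rightarrow> real) \<Rightarrow> (ereal \<Rightarrow> real) \<Rightarrow> real set \<Rightarrow> (int \<Rightarrow> real \<times> real) \<Rightarrow> ereal \<times> ereal \<Rightarrow> ereal"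
where
  "deleted_endpoint lamL lamR \<xi> z \<Delta> =
     (if snd (mark_of \<xi> z \<Delta>) < lamR (dlength \<Delta>) / (lamL (dlength \<Delta>) + lamR (dlength \<Delta>))
      then fst \<Delta> else snd \<Delta>)"

text \<open>A path \<open>Y\<close> follows the dynamics driven by the marks \<open>z\<close> if the points missing at time \<open>t\<close>
  are exactly those deleted by an initial domain which rang by time \<open>t\<close> and was still a domain
  immediately before ringing. For almost all marks there is exactly one such path.\<close>

definition coalescence_path ::
  "(ereal \<Rightarrow> real) \<Rightarrow> (ereal \<Rightarrow> real) \<Rightarrow> (int \<Rightarrow> real \<times> real) \<Rightarrow> (real \<Rightarrow> real set) \<Rightarrow> bool"
where
  "coalescence_path lamL lamR z Y \<longleftrightarrow>
     (\<forall>t\<ge>0. Y t = {x \<in> Y 0. \<not> (\<exists>\<Delta>\<in>domains (Y 0).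
        ring_time lamL lamR (Y 0) z \<Delta> \<le> ereal t \<and>
        (\<forall>u\<ge>0. ereal u < ring_time lamL lamR (Y 0) z \<Delta> \<longrightarrow> \<Delta> \<in> domains (Y u)) \<and>
        deleted_endpoint lamL lamR (Y 0) z \<Delta> = ereal x)})"

definition config_at :: "(real \<Rightarrow> 'w \<Rightarrow> real set) \<Rightarrow> ennreal \<Rightarrow> 'w \<Rightarrow> real set" where
  "config_at X t \<omega> = (if t = \<infinity> then (\<Inter>u\<in>{0..}. X u \<omega>) else X (enn2real t) \<omega>)"

text \<open>\<open>X\<close> is a one-epoch coalescence process on the probability space \<open>M\<close> with initial law \<open>Q\<close>.
  The joint law in the last clause says that the initial configuration has law \<open>Q\<close> and that the
  marks are i.i.d. and independent of it.\<close>

definition ocp ::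
  "real \<Rightarrow> (ereal \<Rightarrow> real) \<Rightarrow> (ereal \<Rightarrow> real) \<Rightarrow> real set measure \<Rightarrow>
   'w measure \<Rightarrow> (real \<Rightarrow> 'w \<Rightarrow> real set) \<Rightarrow> bool"
where
  "ocp dmin lamL lamR Q M X \<longleftrightarrow>
     prob_space M \<and>
     (\<forall>t\<ge>0. \<forall>\<omega>\<in>space M. X t \<omega> \<in> separated_configurations dmin) \<and>
     (\<forall>t. config_at X t \<in> M \<rightarrow>\<^sub>M config_algebra) \<and>
     (\<exists>Z \<in> M \<rightarrow>\<^sub>M mark_law.
        distr M (config_algebra \<Otimes>\<^sub>M mark_law) (\<lambda>\<omega>. (X 0 \<omega>, Z \<omega>)) = Q \<Otimes>\<^sub>M mark_law \<and>
        (AE \<omega> in M. coalescence_path lamL lamR (Z \<omega>) (\<lambda>t. X t \<omega>)))"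


section \<open>Laplace transforms\<close>

definition laplace_args :: "complex set" where
  "laplace_args = complex_of_real ` {0..} \<union> range (\<lambda>y. \<i> * complex_of_real y)"

definition laplace_on :: "real set \<Rightarrow> real measure \<Rightarrow> complex \<Rightarrow> complex" where
  "laplace_on A m s = (LINT x:A|m. exp (- s * complex_of_real x))"

text \<open>For real arguments the transform of a measure on the whole line may be infinite.\<close>

definition laplace_ext :: "real measure \<Rightarrow> real \<Rightarrow> ennreal" where
  "laplace_ext m s = (\<integral>\<^sup>+x. ennreal (exp (- s * x)) \<partial>m)"

end

theory Submission
  imports Defs "HOL-Computational_Algebra.Formal_Power_Series"
begin

text \<open>
  Number the domains of the initial configuration by \<open>0, 1, 2, \<dots>\<close>. A merged domain never acts, so site
  \<open>k\<close> acts at its ring time unless one of its two neighbours removed a common endpoint before. While the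
  point \<open>x k\<close> is present, the sites to its left and to its right evolve independently; hence survival of
  \<open>x k\<close> is the intersection of two independent events, determined by the isolated half-chains.

  For a weight \<open>w\<close> of the sites let \<open>K t\<close> be the mean of \<open>w\<close> on the event that the ring time is below
  \<open>t\<close>, \<open>H = K \<infinity>\<close>, and let \<open>G\<close> be the mean of \<open>w\<close>. Ring times have no atoms, so
  \<open>E (w (K T) ^ n; T < t) = K t ^ (n + 1) / (n + 1)\<close>. Deciding by the first end which is deleted, the weight of
  the isolated chains of \<open>m\<close> sites whose two ends survive is the coefficient of \<open>z ^ m\<close> in \<open>exp (- H z) / (1 - G z)\<close>;
  splitting such a chain at its surviving points shows that the chains which become one single domain have
  the generating function \<open>1 - (1 - G z) exp (H z)\<close>. At \<open>z = 1\<close> this is the law of a gap of \<open>\<xi>(\<infinity>)\<close>.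
  The leftmost point of \<open>\<xi>(\<infinity>)\<close> is \<open>x k\<close> iff the sites \<open>0, \<dots>, k - 1\<close> ring in increasing order, each
  deleting its left endpoint, and \<open>x k\<close> survives; the weight of the first event is \<open>K' ^ k / fact k\<close>, where
  \<open>K'\<close> is the mean of \<open>w\<close> on ringing sites which choose the left endpoint.
\<close>

section \<open>Deletions in a chain of sites\<close>

text \<open>No evolution equation in time is solved. Which points survive depends only on the order
  of the ring times and on the coins, and the function \<open>K\<close> serves as the clock:
  integrating over an atomless ring time merely raises the power of \<open>K\<close>, so that the
  rates disappear and only the final value \<open>H\<close> is left. The obstacle is that infinitely
  many sites interact, so there is no first event from which to start. But a site heeds a neighbour
  only if that neighbour rings earlier; influence travels along strictly descending runs of ring
  times, and \<open>n + 1\<close> given sites form such a run with probability at most 1 / (n + 1)!.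
  Almost surely no run is infinite, and finite chains decide everything. The gap law does not see
  the coins: the end that goes first is removed by the first site with a left coin or by the last
  site with a right coin, and either case leaves one site less, so the two coin values add up to the
  full mass. The probability that a half-infinite chain spares its end is not computed directly; it
  is the constant that makes the law of the leftmost survivor a probability.\<close>

definition shift :: "nat \<Rightarrow> (nat \<Rightarrow> 'a) \<Rightarrow> nat \<Rightarrow> 'a" where
  "shift k \<omega> = (\<lambda>i. \<omega> (k + i))"

lemma shift_apply: "shift k \<omega> i = \<omega> (k + i)"
  by (simp add: shift_def)

lemma shift_simps [simp]: "shift 0 \<omega> = \<omega>" "shift j (shift k \<omega>) = shift (k + j) \<omega>"
  by (auto simp: shift_def add.assoc)

locale chain =
  fixes T :: "'a \<Rightarrow> ereal" and c :: "'a \<Rightarrow> bool"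
begin

text \<open>\<open>T\<close> is the ring time of a site (a domain) and \<open>c\<close> says that its coin selects the left
  endpoint. \<open>dl n \<omega>\<close>: in the isolated chain of the sites \<open>\<omega> 0, \<dots>, \<omega> (n - 1)\<close>, site \<open>0\<close> would
  delete the left end if nothing outside interferes; \<open>dr n \<omega>\<close> is the mirror image,
  and \<open>dinf\<close> the version for the half-infinite chain.\<close>

primrec dl :: "nat \<Rightarrow> (nat \<Rightarrow> 'a) \<Rightarrow> bool" where
  "dl 0 \<omega> \<longleftrightarrow> False"
| "dl (Suc n) \<omega> \<longleftrightarrow> c (\<omega> 0) \<and> T (\<omega> 0) < \<infinity> \<and> \<not> (dl n (shift 1 \<omega>) \<and> T (\<omega> 1) < T (\<omega> 0))"

primrec dr :: "nat \<Rightarrow> (nat \<Rightarrow> 'a) \<Rightarrow> bool" where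
  "dr 0 \<omega> \<longleftrightarrow> False"
| "dr (Suc n) \<omega> \<longleftrightarrow> \<not> c (\<omega> n) \<and> T (\<omega> n) < \<infinity> \<and> \<not> (dr n \<omega> \<and> T (\<omega> (n - 1)) < T (\<omega> n))"

definition dinf :: "(nat \<Rightarrow> 'a) \<Rightarrow> bool" where
  "dinf \<omega> \<longleftrightarrow> (\<exists>N. \<forall>n\<ge>N. dl n \<omega>)"

text \<open>Point \<open>k\<close> separates the sites below \<open>k\<close> from the others. The
  left block is a finite chain because the unbounded domain before the first point never acts. That
  this is survival in the full process is the content of \<open>survives_iff_alive\<close>.\<close>

definition alive :: "nat \<Rightarrow> (nat \<Rightarrow> 'a) \<Rightarrow> bool" where
  "alive k \<omega> \<longleftrightarrow> \<not> dr k \<omega> \<and> \<not> dinf (shift k \<omega>)"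

text \<open>Beyond every site there is a step at which the ring times do not descend; there the left
  site does not depend on its right neighbour, and the recursion for \<open>dl\<close>
  stops.\<close>

definition nodesc :: "(nat \<Rightarrow> 'a) \<Rightarrow> bool" where
  "nodesc \<omega> \<longleftrightarrow> (\<forall>k. \<exists>n. \<not> T (\<omega> (Suc (k + n))) < T (\<omega> (k + n)))"

definition noties :: "(nat \<Rightarrow> 'a) \<Rightarrow> bool" where
  "noties \<omega> \<longleftrightarrow> (\<forall>i j. i < j \<longrightarrow> T (\<omega> i) = T (\<omega> j) \<longrightarrow> T (\<omega> i) = \<infinity>)"

definition incr :: "nat \<Rightarrow> (nat \<Rightarrow> 'a) \<Rightarrow> bool" where
  "incr k \<omega> \<longleftrightarrow> (\<forall>j<k. c (\<omega> j) \<and> T (\<omega> j) < \<infinity> \<and> (0 < j \<longrightarrow> T (\<omega> (j - 1)) < T (\<omega> j)))"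

text \<open>The isolated chain ends up as one single domain: every interior point falls to one of
  the two subchains that meet there.\<close>

definition seg :: "nat \<Rightarrow> (nat \<Rightarrow> 'a) \<Rightarrow> bool" where
  "seg m \<omega> \<longleftrightarrow> \<not> dl m \<omega> \<and> \<not> dr m \<omega> \<and> (\<forall>j. 0 < j \<longrightarrow> j < m \<longrightarrow> dl (m - j) (shift j \<omega>) \<or> dr j \<omega>)"

text \<open>A point which the sites to its right would spare is a wall: the site just before it sees
  the same recursion as at the end of a chain.\<close>

lemma dl_split: "\<not> dl r (shift q \<omega>) \<Longrightarrow> dl (q + r) \<omega> = dl q \<omega>"
  by (induction q arbitrary: \<omega>) auto

lemma dr_split: "\<not> dr q \<omega> \<Longrightarrow> dr (q + r) \<omega> = dr r (shift q \<omega>)"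
proof (induction r)
  case (Suc r)
  then show ?case by (cases r) (auto simp: shift_apply)
qed auto

section \<open>Passage from finite chains to the half-infinite chain\<close>

lemma nodesc_shift: "nodesc \<omega> \<Longrightarrow> nodesc (shift k \<omega>)"
  unfolding nodesc_def shift_apply by (metis add.assoc add_Suc_right)

text \<open>Site \<open>n\<close> consults site \<open>n + 1\<close> only if that one rings earlier,
  so a non-descending step cuts off everything to its right.\<close>

lemma dl_stable:
  assumes "\<not> T (\<omega> (Suc n)) < T (\<omega> n)" "Suc n \<le> m"
  shows "dl m \<omega> = dl (Suc n) \<omega>"
  using assms
proof (induction n arbitrary: m \<omega>)
  case 0
  then show ?case by (cases m) auto
next
  case (Suc n)
  then obtain m' where m': "m = Suc m'" "Suc n \<le> m'" by (cases m) auto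
  have "dl m' (shift 1 \<omega>) = dl (Suc n) (shift 1 \<omega>)"
    by (rule Suc.IH) (use Suc.prems m' in \<open>auto simp: shift_apply\<close>)
  then show ?case unfolding m' by (simp del: One_nat_def)
qed

lemma dinf_stable:
  assumes "nodesc \<omega>"
  obtains N where "\<And>n. N \<le> n \<Longrightarrow> dl n \<omega> = dinf \<omega>"
proof -
  obtain n where n: "\<not> T (\<omega> (Suc n)) < T (\<omega> n)"
    using assms unfolding nodesc_def by (metis add_0)
  have *: "dl m \<omega> = dl (Suc n) \<omega>" if "Suc n \<le> m" for m
    by (rule dl_stable[OF n that])
  have "dinf \<omega> = dl (Suc n) \<omega>"
    unfolding dinf_def using * by (metis nle_le)
  then show ?thesis using * that[of "Suc n"] by auto
qed

lemma dinf_rec: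
  assumes "nodesc \<omega>"
  shows "dinf \<omega> \<longleftrightarrow> c (\<omega> 0) \<and> T (\<omega> 0) < \<infinity> \<and> \<not> (dinf (shift 1 \<omega>) \<and> T (\<omega> 1) < T (\<omega> 0))"
proof -
  obtain N where N: "\<And>n. N \<le> n \<Longrightarrow> dl n \<omega> = dinf \<omega>" using dinf_stable[OF assms] by blast
  obtain N' where N': "\<And>n. N' \<le> n \<Longrightarrow> dl n (shift 1 \<omega>) = dinf (shift 1 \<omega>)"
    using dinf_stable nodesc_shift[OF assms] by blast
  show ?thesis
    using N[of "Suc (max N N')"] N'[of "max N N'"] by (simp del: One_nat_def)
qed

lemma dinf_shift_rec:
  assumes "nodesc \<omega>"
  shows "dinf (shift k \<omega>) \<longleftrightarrow> c (\<omega> k) \<and> T (\<omega> k) < \<infinity> \<and>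
    \<not> (dinf (shift (Suc k) \<omega>) \<and> T (\<omega> (Suc k)) < T (\<omega> k))"
  using dinf_rec[OF nodesc_shift[OF assms], of k] by (simp add: shift_apply)

lemma dinf_split:
  assumes "nodesc \<omega>" "\<not> dinf (shift q \<omega>)"
  shows "dinf \<omega> = dl q \<omega>"
proof -
  obtain N where N: "\<And>n. N \<le> n \<Longrightarrow> dl n \<omega> = dinf \<omega>" using dinf_stable[OF assms(1)] by blast
  obtain N' where N': "\<And>n. N' \<le> n \<Longrightarrow> dl n (shift q \<omega>) = dinf (shift q \<omega>)"
    using dinf_stable nodesc_shift[OF assms(1)] by blast
  show ?thesis
    using N[of "q + max N N'"] N'[of "max N N'"] dl_split[of "max N N'" q \<omega>] assms(2) by simp
qed

text \<open>Here \<open>a k\<close> and \<open>b k\<close> say that site \<open>k\<close> deletes its left, respectively right, endpoint in the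
  full process. The comparison with the half-infinite chain is an induction along a descending run of
  ring times, which is finite.\<close>

abbreviation undisturbed :: "(nat \<Rightarrow> bool) \<Rightarrow> (nat \<Rightarrow> bool) \<Rightarrow> (nat \<Rightarrow> 'a) \<Rightarrow> nat \<Rightarrow> bool" where
  "undisturbed a b \<omega> k \<equiv> T (\<omega> k) < \<infinity> \<and> \<not> (0 < k \<and> b (k - 1) \<and> T (\<omega> (k - 1)) < T (\<omega> k)) \<and>
     \<not> (a (Suc k) \<and> T (\<omega> (Suc k)) < T (\<omega> k))"

lemma left_deletion_iff:
  assumes a: "\<And>k. a k \<longleftrightarrow> c (\<omega> k) \<and> undisturbed a b \<omega> k"
    and "nodesc \<omega>"
  shows "a k \<longleftrightarrow> dinf (shift k \<omega>) \<and> \<not> (0 < k \<and> b (k - 1) \<and> T (\<omega> (k - 1)) < T (\<omega> k))"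
proof -
  obtain n where n: "\<not> T (\<omega> (Suc (k + n))) < T (\<omega> (k + n))"
    using \<open>nodesc \<omega>\<close> unfolding nodesc_def by blast
  note rec = dinf_shift_rec[OF \<open>nodesc \<omega>\<close>]
  show ?thesis using n
  proof (induction n arbitrary: k)
    case 0
    then have "\<not> T (\<omega> (Suc k)) < T (\<omega> k)" by simp
    then show ?case using a[of k] rec[of k] by blast
  next
    case (Suc n)
    have IH: "a (Suc k) \<longleftrightarrow> dinf (shift (Suc k) \<omega>) \<and> \<not> (b k \<and> T (\<omega> k) < T (\<omega> (Suc k)))"
      using Suc.IH[of "Suc k"] Suc.prems by simp
    \<comment> \<open>\<open>a (Suc k)\<close> and \<open>dinf (shift (Suc k) \<omega>)\<close> can
      differ only when site \<open>k\<close> rings first, but the recursion at \<open>k\<close>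
      consults them only when site \<open>k + 1\<close> rings first; so the difference is
      invisible.\<close>
    have "\<not> (T (\<omega> k) < T (\<omega> (Suc k)) \<and> T (\<omega> (Suc k)) < T (\<omega> k))" by auto
    then show ?case using a[of k] rec[of k] IH by blast
  qed
qed

text \<open>The mirror image of the previous lemma. Sites to the left are finite in number, so plain
  induction from site 0 replaces the descending run.\<close>

lemma right_deletion_iff:
  assumes b: "\<And>k. b k \<longleftrightarrow> \<not> c (\<omega> k) \<and> undisturbed a b \<omega> k"
  shows "b k \<longleftrightarrow> dr (Suc k) \<omega> \<and> \<not> (a (Suc k) \<and> T (\<omega> (Suc k)) < T (\<omega> k))"
proof (induction k)
  case 0
  show ?case using b[of 0] by simp
next
  case (Suc k)
  have "\<not> (T (\<omega> (Suc k)) < T (\<omega> k) \<and> T (\<omega> k) < T (\<omega> (Suc k)))" by auto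
  then show ?case using b[of "Suc k"] Suc unfolding dr.simps(2)[of "Suc k"] diff_Suc_1 by blast
qed

text \<open>If only one of the two adjacent sites would delete the point in its isolated half,
  nothing stops it. If both would, the earlier one does, and in a tie both do. Hence the interaction
  across a point never saves it.\<close>

lemma survives_iff_alive:
  assumes a: "\<And>k. a k \<longleftrightarrow> c (\<omega> k) \<and> undisturbed a b \<omega> k"
    and b: "\<And>k. b k \<longleftrightarrow> \<not> c (\<omega> k) \<and> undisturbed a b \<omega> k"
    and "nodesc \<omega>"
  shows "\<not> a k \<and> \<not> (0 < k \<and> b (k - 1)) \<longleftrightarrow> alive k \<omega>"
proof (cases k)
  case 0
  then show ?thesis
    using left_deletion_iff[OF a \<open>nodesc \<omega>\<close>, of 0] unfolding alive_def by simp
next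
  case (Suc j)
  have "\<not> (T (\<omega> (Suc j)) < T (\<omega> j) \<and> T (\<omega> j) < T (\<omega> (Suc j)))" by auto
  then show ?thesis
    using left_deletion_iff[OF a \<open>nodesc \<omega>\<close>, of "Suc j"] right_deletion_iff[OF b, of j]
    unfolding alive_def Suc diff_Suc_1 by blast
qed

section \<open>Position of the first two survivors\<close>

lemma incr_not_dr: "incr k \<omega> \<Longrightarrow> j \<le> k \<Longrightarrow> \<not> dr j \<omega>"
  by (cases j) (auto simp: incr_def)

lemma incr_Suc:
  "incr (Suc k) \<omega> \<longleftrightarrow> incr k \<omega> \<and> c (\<omega> k) \<and> T (\<omega> k) < \<infinity> \<and> (0 < k \<longrightarrow> T (\<omega> (k - 1)) < T (\<omega> k))"
  by (auto simp: incr_def less_Suc_eq)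

text \<open>The first point can only be deleted by the site on its right, which then has a left
  coin; this site cannot delete the second point, and so on. Neighbouring sites that both delete
  their left ends must ring in increasing order, strictly since there are no ties.\<close>

lemma first_alive_iff:
  assumes "nodesc \<omega>" "noties \<omega>"
  shows "alive k \<omega> \<and> (\<forall>j<k. \<not> alive j \<omega>) \<longleftrightarrow> incr k \<omega> \<and> \<not> dinf (shift k \<omega>)"
proof
  assume asm: "alive k \<omega> \<and> (\<forall>j<k. \<not> alive j \<omega>)"
  note rec = dinf_shift_rec[OF \<open>nodesc \<omega>\<close>]
  have "incr j \<omega>" if "j \<le> k" for j
    using that
  proof (induction j)
    case 0
    then show ?case by (simp add: incr_def)
  next
    case (Suc j)
    then have "incr j \<omega>" by simp
    have D: "dinf (shift i \<omega>)" if "i \<le> j" for i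
    proof -
      have "\<not> alive i \<omega>" using asm Suc.prems that by auto
      then show ?thesis using incr_not_dr[OF \<open>incr j \<omega>\<close> that] by (auto simp: alive_def)
    qed
    have "T (\<omega> (j - 1)) < T (\<omega> j)" if "0 < j"
    proof -
      have "\<not> T (\<omega> j) < T (\<omega> (j - 1))"
        using rec[of "j - 1"] D[of "j - 1"] D[of j] that by (simp del: One_nat_def)
      moreover have "T (\<omega> (j - 1)) \<noteq> T (\<omega> j)"
      proof
        assume eq: "T (\<omega> (j - 1)) = T (\<omega> j)"
        have "j - 1 < j" using that by simp
        then have "T (\<omega> (j - 1)) = \<infinity>" using \<open>noties \<omega>\<close> eq unfolding noties_def by blast
        then show False using eq rec[of j] D[of j] by simp
      qed
      ultimately show ?thesis by auto
    qed
    then show ?case using \<open>incr j \<omega>\<close> rec[of j] D[of j] by (simp add: incr_Suc)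
  qed
  then show "incr k \<omega> \<and> \<not> dinf (shift k \<omega>)" using asm unfolding alive_def by blast
next
  assume asm: "incr k \<omega> \<and> \<not> dinf (shift k \<omega>)"
  note rec = dinf_shift_rec[OF \<open>nodesc \<omega>\<close>]
  have "dinf (shift j \<omega>)" if "j < k" for j
  proof (cases "Suc j = k")
    case True
    moreover have "c (\<omega> j)" "T (\<omega> j) < \<infinity>" using asm that unfolding incr_def by blast+
    ultimately show ?thesis using asm rec[of j] by simp
  next
    case False
    then have "Suc j < k" using that by simp
    then have "T (\<omega> (Suc j - 1)) < T (\<omega> (Suc j))"
      using asm unfolding incr_def by blast
    then have "\<not> T (\<omega> (Suc j)) < T (\<omega> j)" by simp
    moreover have "c (\<omega> j)" "T (\<omega> j) < \<infinity>" using asm that unfolding incr_def by blast+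
    ultimately show ?thesis using rec[of j] by blast
  qed
  then show "alive k \<omega> \<and> (\<forall>j<k. \<not> alive j \<omega>)"
    using asm incr_not_dr[of k \<omega> k] unfolding alive_def by blast
qed

text \<open>\<open>incr k\<close> leaves no deletion of point \<open>k\<close> from its left, and a
  point \<open>k + m\<close> spared from its right is a wall. Between these two walls the
  half-infinite chains reduce to isolated finite ones.\<close>

lemma second_alive_iff:
  assumes "nodesc \<omega>" "incr k \<omega>" "0 < m"
  shows "\<not> dinf (shift k \<omega>) \<and> alive (k + m) \<omega> \<and> (\<forall>j. k < j \<longrightarrow> j < k + m \<longrightarrow> \<not> alive j \<omega>)
    \<longleftrightarrow> seg m (shift k \<omega>) \<and> \<not> dinf (shift (k + m) \<omega>)"
proof -
  have ndr: "\<not> dr k \<omega>" using incr_not_dr[OF \<open>incr k \<omega>\<close>] by simp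
  have dr: "dr (k + j) \<omega> = dr j (shift k \<omega>)" for j
    by (rule dr_split[OF ndr])
  have D: "dinf (shift (k + j) \<omega>) = dl (m - j) (shift (k + j) \<omega>)"
    if "j \<le> m" "\<not> dinf (shift (k + m) \<omega>)" for j
    using dinf_split[OF nodesc_shift[OF \<open>nodesc \<omega>\<close>, of "k + j"], where q = "m - j"] that by simp
  have all: "(\<forall>j. k < j \<longrightarrow> j < k + m \<longrightarrow> P j) \<longleftrightarrow> (\<forall>j. 0 < j \<longrightarrow> j < m \<longrightarrow> P (k + j))" for P
    by (metis add_less_cancel_left less_add_same_cancel1 less_imp_add_positive)
  show ?thesis
  proof (cases "dinf (shift (k + m) \<omega>)")
    case False
    have "\<not> alive (k + j) \<omega> \<longleftrightarrow> dl (m - j) (shift (k + j) \<omega>) \<or> dr j (shift k \<omega>)" if "j < m" for j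
      unfolding alive_def dr using D[of j] that False by auto
    moreover have "alive (k + m) \<omega> \<longleftrightarrow> \<not> dr m (shift k \<omega>)"
      unfolding alive_def dr using False by simp
    moreover have "dinf (shift k \<omega>) = dl m (shift k \<omega>)"
      using D[of 0] False by simp
    ultimately show ?thesis unfolding all seg_def shift_simps using False by blast
  qed (simp add: alive_def)
qed

end

section \<open>Independent sites\<close>

lemmas LINT_cong = Bochner_Integration.integral_cong

text \<open>Only finite values are required to be no atoms: domains of length at least
  \<open>dmax\<close> never ring, so infinity may have positive probability.\<close>

locale iid_chain = sequence_space P + chain T c
  for P :: "'a measure" and T :: "'a \<Rightarrow> ereal" and c :: "'a \<Rightarrow> bool" +
  assumes T_measurable [measurable]: "T \<in> borel_measurable P"
    and c_measurable [measurable]: "Measurable.pred P c"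
    and no_atom: "a < \<infinity> \<Longrightarrow> AE x in P. T x \<noteq> a"
begin

section \<open>Measurability of the chain events\<close>

lemma shift_measurable [measurable (raw)]:
  assumes [measurable]: "f \<in> N \<rightarrow>\<^sub>M S"
  shows "(\<lambda>x. shift k (f x)) \<in> N \<rightarrow>\<^sub>M S"
  unfolding shift_def by (rule measurable_abs_UNIV) measurable

lemma dl_measurable [measurable (raw)]: "f \<in> N \<rightarrow>\<^sub>M S \<Longrightarrow> Measurable.pred N (\<lambda>x. dl n (f x))"
  by (induction n arbitrary: f) simp_all

lemma dr_measurable [measurable (raw)]: "f \<in> N \<rightarrow>\<^sub>M S \<Longrightarrow> Measurable.pred N (\<lambda>x. dr n (f x))"
  by (induction n arbitrary: f) simp_all

lemma dinf_measurable [measurable (raw)]: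
  assumes [measurable]: "f \<in> N \<rightarrow>\<^sub>M S"
  shows "Measurable.pred N (\<lambda>x. dinf (f x))"
  unfolding dinf_def by measurable

lemma alive_measurable [measurable (raw)]:
  assumes [measurable]: "f \<in> N \<rightarrow>\<^sub>M S"
  shows "Measurable.pred N (\<lambda>x. alive k (f x))"
  unfolding alive_def by measurable

lemma incr_measurable [measurable (raw)]:
  assumes [measurable]: "f \<in> N \<rightarrow>\<^sub>M S"
  shows "Measurable.pred N (\<lambda>x. incr k (f x))"
  unfolding incr_def by measurable

lemma seg_measurable [measurable (raw)]:
  assumes [measurable]: "f \<in> N \<rightarrow>\<^sub>M S"
  shows "Measurable.pred N (\<lambda>x. seg k (f x))"
  unfolding seg_def by measurable

lemma shift_in_space: "\<omega> \<in> space S \<Longrightarrow> shift k \<omega> \<in> space S"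
  by (auto simp: space_PiM shift_def)

lemma shift_comb_seq: "shift k (comb_seq k \<omega> \<omega>') = \<omega>'"
  by (auto simp: shift_def comb_seq_def)

lemma distr_shift: "distr S S (shift k) = S"
proof -
  have "shift k = (\<lambda>\<omega>::nat \<Rightarrow> 'a. \<lambda>n\<in>UNIV. \<omega> (k + n))"
    by (simp add: fun_eq_iff shift_apply)
  then show ?thesis
    using distr_PiM_reindex[of UNIV "\<lambda>_. P" "\<lambda>i. k + i" UNIV] M.prob_space_axioms
    by (simp add: inj_on_def)
qed

lemma AE_shift:
  assumes [measurable]: "Measurable.pred S Q" and "AE \<omega> in S. Q \<omega>"
  shows "AE \<omega> in S. Q (shift k \<omega>)"
proof (rule AE_distrD[of "shift k" S S])
  show "AE \<omega> in distr S S (shift k). Q \<omega>" unfolding distr_shift by fact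
qed measurable

lemma integral_component:
  fixes f :: "'a \<Rightarrow> 'b::{banach, second_countable_topology}"
  assumes [measurable]: "f \<in> borel_measurable P"
  shows "(\<integral>\<omega>. f (\<omega> i) \<partial>S) = (\<integral>x. f x \<partial>P)"
  using integral_distr[of "\<lambda>\<omega>. \<omega> i" S P f] PiM_component[of i] by simp

text \<open>Both orders of integration are needed: some arguments condition on the first site of a
  block, others on the site that follows it.\<close>

lemma integral_comb_seq:
  fixes f :: "(nat \<Rightarrow> 'a) \<Rightarrow> complex"
  assumes [measurable]: "f \<in> borel_measurable S" and bound: "\<And>\<omega>. \<omega> \<in> space S \<Longrightarrow> norm (f \<omega>) \<le> B"
  shows "(\<integral>\<omega>. f \<omega> \<partial>S) = (\<integral>\<omega>. (\<integral>\<omega>'. f (comb_seq k \<omega> \<omega>') \<partial>S) \<partial>S)" (is ?fst)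
    and "(\<integral>\<omega>. f \<omega> \<partial>S) = (\<integral>\<omega>'. (\<integral>\<omega>. f (comb_seq k \<omega> \<omega>') \<partial>S) \<partial>S)" (is ?snd)
proof -
  interpret SS: pair_prob_space S S ..
  have "(\<integral>\<omega>. f \<omega> \<partial>S) = (\<integral>p. f (case p of (\<omega>, \<omega>') \<Rightarrow> comb_seq k \<omega> \<omega>') \<partial>(S \<Otimes>\<^sub>M S))"
    using integral_distr[of "\<lambda>(\<omega>, \<omega>'). comb_seq k \<omega> \<omega>'" "S \<Otimes>\<^sub>M S" S f] PiM_comb_seq[of k]
    by (simp add: measurable_comb_seq)
  also have "\<dots> = (\<integral>(\<omega>, \<omega>'). f (comb_seq k \<omega> \<omega>') \<partial>(S \<Otimes>\<^sub>M S))"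
    by (simp add: split_beta')
  finally have eq: "(\<integral>\<omega>. f \<omega> \<partial>S) = (\<integral>(\<omega>, \<omega>'). f (comb_seq k \<omega> \<omega>') \<partial>(S \<Otimes>\<^sub>M S))" .
  have int: "integrable (S \<Otimes>\<^sub>M S) (\<lambda>(\<omega>, \<omega>'). f (comb_seq k \<omega> \<omega>'))"
  proof (rule SS.P.integrable_const_bound[where B = B])
    show "AE p in S \<Otimes>\<^sub>M S. norm (case p of (\<omega>, \<omega>') \<Rightarrow> f (comb_seq k \<omega> \<omega>')) \<le> B"
    proof (rule AE_I2)
      fix p assume "p \<in> space (S \<Otimes>\<^sub>M S)"
      then have "comb_seq k (fst p) (snd p) \<in> space S"
        using measurable_space[OF measurable_comb_seq[of k P]] by (fastforce simp: split_beta')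
      then show "norm (case p of (\<omega>, \<omega>') \<Rightarrow> f (comb_seq k \<omega> \<omega>')) \<le> B"
        using bound by (simp add: split_beta')
    qed
  qed measurable
  show ?fst unfolding eq SS.integral_fst[OF int] ..
  show ?snd unfolding eq SS.integral_snd[OF int] ..
qed

lemma measure_eq_integral:
  assumes [measurable]: "Measurable.pred S Q"
  shows "complex_of_real (measure S {\<omega> \<in> space S. Q \<omega>}) = (\<integral>\<omega>. (if Q \<omega> then 1 else 0) \<partial>S)"
proof -
  have "(\<integral>\<omega>. (if Q \<omega> then 1 else 0::complex) \<partial>S) = (\<integral>\<omega>. complex_of_real (indicator {\<omega> \<in> space S. Q \<omega>} \<omega>) \<partial>S)"
    by (rule LINT_cong) (auto simp: indicator_def)
  then show ?thesis by simp
qed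

definition mass :: "('a \<Rightarrow> complex) \<Rightarrow> ereal \<Rightarrow> complex" where
  "mass w t = (\<integral>x. (if T x < t then w x else 0) \<partial>P)"

text \<open>The bound by one makes all products of weights integrable at once, and the class is
  closed under restriction to events and contains the constant one.\<close>

definition weight :: "('a \<Rightarrow> complex) \<Rightarrow> bool" where
  "weight w \<longleftrightarrow> w \<in> borel_measurable P \<and> (\<forall>x\<in>space P. norm (w x) \<le> 1)"

lemma weight_measurable: "weight w \<Longrightarrow> w \<in> borel_measurable P"
  and weight_bound: "weight w \<Longrightarrow> x \<in> space P \<Longrightarrow> norm (w x) \<le> 1"
  by (auto simp: weight_def)

lemma weight_one: "weight (\<lambda>x. 1)"
  by (simp add: weight_def)

lemma weight_if: "weight w \<Longrightarrow> Measurable.pred P b \<Longrightarrow> weight (\<lambda>x. if b x then w x else 0)"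
  by (auto simp: weight_def)

lemma mass_measurable [measurable (raw)]:
  assumes w: "weight w" and [measurable]: "f \<in> borel_measurable N"
  shows "(\<lambda>x. mass w (f x)) \<in> borel_measurable N"
proof -
  note [measurable] = weight_measurable[OF w]
  show ?thesis unfolding mass_def by measurable
qed

lemma norm_integral_le_1:
  fixes f :: "'b \<Rightarrow> complex"
  assumes "prob_space N" "\<And>x. x \<in> space N \<Longrightarrow> norm (f x) \<le> 1"
  shows "norm (\<integral>x. f x \<partial>N) \<le> 1"
proof (cases "integrable N f")
  case True
  interpret N: prob_space N by fact
  have "norm (\<integral>x. f x \<partial>N) \<le> (\<integral>x. norm (f x) \<partial>N)" by simp
  also have "\<dots> \<le> (\<integral>x. 1 \<partial>N)" using True assms by (intro integral_mono) auto
  finally show ?thesis by (simp add: N.prob_space)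
qed (simp add: not_integrable_integral_eq)

lemma mass_bound: "weight w \<Longrightarrow> norm (mass w t) \<le> 1"
  unfolding mass_def
  by (rule norm_integral_le_1[OF M.prob_space_axioms]) (auto simp: weight_bound)

text \<open>Ring times have no atoms, so the mass below an independent ring time is uniformly distributed:
  symmetrise the product \<open>mass w t ^ (n + 1)\<close> according to which ring time is the largest.\<close>

lemma integral_mass_power:
  assumes w: "weight w"
  shows "(\<integral>x. (if T x < t then w x * mass w (T x) ^ n else 0) \<partial>P) = mass w t ^ Suc n / of_nat (Suc n)"
proof (induction n arbitrary: t)
  case 0
  show ?case by (simp add: mass_def cong: if_cong)
next
  case (Suc n)
  interpret PP: pair_prob_space P P ..
  note [measurable] = weight_measurable[OF w] mass_measurable[OF w]
  define I where "I = (\<integral>x. (if T x < t then w x * mass w (T x) ^ Suc n else 0) \<partial>P)"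
  \<comment> \<open>Two independent sites: in \<open>h\<close> site \<open>y\<close> rings last, and
    integrating out \<open>x\<close> produces one more factor \<open>mass w (T y)\<close>; in
    \<open>h'\<close> site \<open>x\<close> rings last, and the induction hypothesis evaluates the
    integral over \<open>y\<close>.\<close>
  define h where "h x y = (if T x < t \<and> T y < t \<and> T x < T y then w x * (w y * mass w (T y) ^ n) else 0)" for x y
  define h' where "h' x y = (if T x < t \<and> T y < t \<and> T y < T x then w x * (w y * mass w (T y) ^ n) else 0)" for x y
  have bound: "norm (w x * (w y * mass w (T y) ^ n)) \<le> 1" if "x \<in> space P" "y \<in> space P" for x y
    using that weight_bound[OF w] mass_bound[OF w]
    by (auto simp: norm_mult norm_power intro!: mult_le_one power_le_one)
  have int: "integrable (P \<Otimes>\<^sub>M P) (\<lambda>(x, y). h x y)" "integrable (P \<Otimes>\<^sub>M P) (\<lambda>(x, y). h' x y)"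
    unfolding h_def h'_def atomize_conj
    by (intro conjI PP.P.integrable_const_bound[where B = 1] AE_I2)
      (use bound in \<open>auto simp: space_pair_measure\<close>)
  have inner: "(\<integral>x. h x y \<partial>P) = (if T y < t then w y * mass w (T y) ^ Suc n else 0)" for y
  proof -
    have "(\<integral>x. h x y \<partial>P) = (\<integral>x. (if T y < t then w y * mass w (T y) ^ n else 0) * (if T x < T y then w x else 0) \<partial>P)"
      unfolding h_def by (rule LINT_cong) auto
    then show ?thesis by (simp add: mass_def)
  qed
  have inner': "(\<integral>y. h' x y \<partial>P) = (if T x < t then w x * mass w (T x) ^ Suc n else 0) / of_nat (Suc n)" for x
  proof -
    have "(\<integral>y. h' x y \<partial>P) = (\<integral>y. (if T x < t then w x else 0) * (if T y < T x then w y * mass w (T y) ^ n else 0) \<partial>P)"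
      unfolding h'_def by (rule LINT_cong) auto
    then show ?thesis by (simp add: Suc.IH)
  qed
  \<comment> \<open>Ties are null only below \<open>t\<close>: two infinite ring times may well
    coincide.\<close>
  have "AE x in P. AE y in P. T x < t \<longrightarrow> T y \<noteq> T x"
  proof (rule AE_I2)
    fix x show "AE y in P. T x < t \<longrightarrow> T y \<noteq> T x"
      using no_atom[of "T x"] by (cases "T x = \<infinity>") auto
  qed
  then have split: "AE x in P. (\<integral>y. (if T x < t then w x else 0) * (if T y < t then w y * mass w (T y) ^ n else 0) \<partial>P)
     = (\<integral>y. h x y + h' x y \<partial>P)"
  proof eventually_elim
    case (elim x)
    then have "AE y in P. (if T x < t then w x else 0) * (if T y < t then w y * mass w (T y) ^ n else 0) = h x y + h' x y"
      unfolding h_def h'_def by eventually_elim (auto simp: not_less)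
    then show ?case
      by (intro integral_cong_AE) (auto simp: h_def h'_def)
  qed
  have "mass w t * (mass w t ^ Suc n / of_nat (Suc n)) =
      (\<integral>x. (\<integral>y. (if T x < t then w x else 0) * (if T y < t then w y * mass w (T y) ^ n else 0) \<partial>P) \<partial>P)"
    by (simp add: Suc.IH mass_def[of w t, symmetric])
  also have "\<dots> = (\<integral>x. (\<integral>y. h x y + h' x y \<partial>P) \<partial>P)"
    using split by (intro integral_cong_AE) (auto simp: h_def h'_def)
  also have "\<dots> = (\<integral>p. (case p of (x, y) \<Rightarrow> h x y) + (case p of (x, y) \<Rightarrow> h' x y) \<partial>(P \<Otimes>\<^sub>M P))"
    using PP.integral_fst'[of "\<lambda>p. (case p of (x, y) \<Rightarrow> h x y) + (case p of (x, y) \<Rightarrow> h' x y)"] int by simp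
  also have "\<dots> = (\<integral>(x, y). h x y \<partial>(P \<Otimes>\<^sub>M P)) + (\<integral>(x, y). h' x y \<partial>(P \<Otimes>\<^sub>M P))"
    using int by (rule Bochner_Integration.integral_add)
  also have "(\<integral>(x, y). h x y \<partial>(P \<Otimes>\<^sub>M P)) = I"
    unfolding I_def using PP.integral_snd[of h] int(1) inner by simp
  also have "(\<integral>(x, y). h' x y \<partial>(P \<Otimes>\<^sub>M P)) = I / of_nat (Suc n)"
    unfolding I_def using PP.integral_fst'[of "\<lambda>(x, y). h' x y"] int(2) inner' by simp
  finally have eq: "mass w t * (mass w t ^ Suc n / of_nat (Suc n)) = I + I / of_nat (Suc n)" .
  \<comment> \<open>The two parts add up to \<open>I\<close> times (n + 2) / (n + 1); it remains to
    solve for \<open>I\<close>.\<close>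
  have ne: "1 + complex_of_nat n \<noteq> 0" "2 + complex_of_nat n \<noteq> 0"
    using of_nat_neq_0[of n, where 'a = complex] of_nat_neq_0[of "Suc n", where 'a = complex] by simp_all
  show ?case unfolding I_def[symmetric]
    using eq ne by (simp add: field_simps)
qed

section \<open>Almost sure absence of ties and of infinite descending runs\<close>

lemma AE_noties: "AE \<omega> in S. noties \<omega>"
proof -
  have "AE \<omega> in S. T (\<omega> i) = T (\<omega> j) \<longrightarrow> T (\<omega> i) = \<infinity>" if "i < j" for i j
  proof -
    let ?Q = "\<lambda>\<omega>. \<not> T (\<omega> i) < T (\<omega> j) \<and> \<not> T (\<omega> j) < T (\<omega> i) \<and> T (\<omega> i) < \<infinity>"
    have "complex_of_real (measure S {\<omega> \<in> space S. ?Q \<omega>}) = (\<integral>\<omega>. (if ?Q \<omega> then 1 else 0) \<partial>S)"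
      by (rule measure_eq_integral) measurable
    also have "\<dots> = (\<integral>\<omega>'. (\<integral>\<omega>. (if ?Q (comb_seq j \<omega> \<omega>') then 1 else 0::complex) \<partial>S) \<partial>S)"
      by (rule integral_comb_seq(2)[where B = 1]) auto
    \<comment> \<open>With the sites from \<open>j\<close> on frozen, \<open>T (\<omega> j)\<close>
      is a constant, while site \<open>i\<close> is still free and has no atom there.\<close>
    also have "\<dots> = (\<integral>\<omega>'. 0 \<partial>S)"
    proof (rule LINT_cong[OF refl])
      fix \<omega>' assume "\<omega>' \<in> space S"
      have "AE \<omega> in S. \<not> ?Q (comb_seq j \<omega> \<omega>')"
      proof (cases "T (\<omega>' 0) = \<infinity>")
        case False
        then have "AE \<omega> in S. T (\<omega> i) \<noteq> T (\<omega>' 0)"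
          using AE_component[OF UNIV_I no_atom] by simp
        then show ?thesis by eventually_elim (use that in \<open>auto simp: comb_seq_def\<close>)
      qed (use that in \<open>auto simp: comb_seq_def\<close>)
      then show "(\<integral>\<omega>. (if ?Q (comb_seq j \<omega> \<omega>') then 1 else 0) \<partial>S) = (0::complex)"
        by (intro integral_eq_zero_AE) (auto elim: eventually_mono)
    qed
    finally have "measure S {\<omega> \<in> space S. ?Q \<omega>} = 0" by simp
    then have "AE \<omega> in S. \<not> ?Q \<omega>"
      by (subst AE_iff_measurable[OF _ refl]) (auto simp: P.emeasure_eq_measure)
    then show ?thesis by eventually_elim auto
  qed
  then show ?thesis unfolding noties_def AE_all_countable by auto
qed

text \<open>Descending is one of (n + 1)! equally likely orders of \<open>n + 1\<close> ring times
  below \<open>t\<close>, whence the factorial. An infinite run has a probability below all these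
  values, that is, zero.\<close>

lemma AE_nodesc: "AE \<omega> in S. nodesc \<omega>"
proof -
  define run where "run n t \<omega> \<longleftrightarrow> T (\<omega> 0) < t \<and> (\<forall>j<n. T (\<omega> (Suc j)) < T (\<omega> j))" for n t \<omega>
  have [measurable]: "Measurable.pred S (run n t)" for n t
    unfolding run_def by measurable
  have run_comb: "run (Suc n) t (comb_seq 1 \<omega> \<omega>') \<longleftrightarrow> T (\<omega> 0) < t \<and> run n (T (\<omega> 0)) \<omega>'" for n t \<omega> \<omega>'
    by (auto simp: run_def comb_seq_def All_less_Suc2 simp del: comb_seq_Suc_0)
  have run: "(\<integral>\<omega>. (if run n t \<omega> then 1 else 0) \<partial>S) = mass (\<lambda>x. 1) t ^ Suc n / fact (Suc n)" for n t
  proof (induction n arbitrary: t)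
    case 0
    have "(\<integral>\<omega>. (if T (\<omega> 0) < t then 1 else 0) \<partial>S) = mass (\<lambda>x. 1) t"
      unfolding mass_def by (rule integral_component) measurable
    then show ?case by (simp add: run_def)
  next
    case (Suc n)
    have "(\<integral>\<omega>. (if run (Suc n) t \<omega> then 1 else 0::complex) \<partial>S) =
        (\<integral>\<omega>. (\<integral>\<omega>'. (if run (Suc n) t (comb_seq 1 \<omega> \<omega>') then 1 else 0) \<partial>S) \<partial>S)"
      by (rule integral_comb_seq(1)[where B = 1]) auto
    also have "\<dots> = (\<integral>\<omega>. (if T (\<omega> 0) < t then 1 * mass (\<lambda>x. 1) (T (\<omega> 0)) ^ Suc n else 0) / fact (Suc n) \<partial>S)"
    proof (rule LINT_cong[OF refl])
      fix \<omega>
      have "(\<integral>\<omega>'. (if run (Suc n) t (comb_seq 1 \<omega> \<omega>') then 1 else 0::complex) \<partial>S) =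
          (if T (\<omega> 0) < t then (\<integral>\<omega>'. (if run n (T (\<omega> 0)) \<omega>' then 1 else 0) \<partial>S) else 0)"
        unfolding run_comb by simp
      then show "(\<integral>\<omega>'. (if run (Suc n) t (comb_seq 1 \<omega> \<omega>') then 1 else 0) \<partial>S) =
          (if T (\<omega> 0) < t then 1 * mass (\<lambda>x. 1) (T (\<omega> 0)) ^ Suc n else 0) / fact (Suc n)"
        unfolding Suc.IH by (simp only: if_distrib[of "\<lambda>x. x / _"] mult_1 div_0)
    qed
    also have "\<dots> = (\<integral>x. (if T x < t then 1 * mass (\<lambda>x. 1) (T x) ^ Suc n else 0) / fact (Suc n) \<partial>P)"
      using weight_one by (intro integral_component) measurable
    also have "\<dots> = mass (\<lambda>x. 1) t ^ Suc (Suc n) / of_nat (Suc (Suc n)) / fact (Suc n)"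
      unfolding integral_mass_power[OF weight_one, symmetric] by simp
    finally show ?case by (simp add: mult.commute)
  qed
  let ?A = "{\<omega> \<in> space S. \<forall>n. run n \<infinity> \<omega>}"
  have "measure S ?A \<le> 1 ^ Suc n / fact (Suc n)" for n
  proof -
    have "measure S ?A \<le> measure S {\<omega> \<in> space S. run n \<infinity> \<omega>}"
      by (intro P.finite_measure_mono) auto
    also have "\<dots> = norm (complex_of_real (measure S {\<omega> \<in> space S. run n \<infinity> \<omega>}))" by simp
    also have "complex_of_real (measure S {\<omega> \<in> space S. run n \<infinity> \<omega>}) = mass (\<lambda>x. 1) \<infinity> ^ Suc n / fact (Suc n)"
      unfolding run[symmetric] by (rule measure_eq_integral) measurable
    also have "norm \<dots> \<le> 1 ^ Suc n / fact (Suc n)"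
      unfolding norm_divide norm_power norm_fact
      by (intro divide_right_mono power_mono mass_bound[OF weight_one]) auto
    finally show ?thesis .
  qed
  moreover have "(\<lambda>n. 1 ^ Suc n / fact (Suc n) :: real) \<longlonglongrightarrow> 0"
    using LIMSEQ_Suc[OF summable_LIMSEQ_zero[OF summable_exp[of "1::real"]]]
    by (simp add: divide_inverse del: fact_Suc)
  ultimately have "measure S ?A \<le> 0"
    by (meson LIMSEQ_le_const)
  then have "measure S ?A = 0" using measure_nonneg[of S ?A] by linarith
  then have "AE \<omega> in S. \<not> (\<forall>n. run n \<infinity> \<omega>)"
    by (subst AE_iff_measurable[OF _ refl]) (auto simp: P.emeasure_eq_measure)
  \<comment> \<open>The shift is by \<open>Suc k\<close> because \<open>run\<close> asks for a
    finite first ring time; the second site of a descending run always has one.\<close>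
  then have "AE \<omega> in S. \<forall>k. \<not> (\<forall>n. run n \<infinity> (shift (Suc k) \<omega>))"
    unfolding AE_all_countable by (intro allI AE_shift) auto
  then show ?thesis
  proof eventually_elim
    case (elim \<omega>)
    show ?case unfolding nodesc_def
    proof (rule allI, rule ccontr)
      fix k assume desc: "\<not> (\<exists>n. \<not> T (\<omega> (Suc (k + n))) < T (\<omega> (k + n)))"
      have "T (\<omega> (Suc k)) < T (\<omega> k)" using desc by (metis add_0_right)
      then have "T (\<omega> (Suc k)) < \<infinity>" by (metis less_ereal.simps(2) less_le_trans ereal_less_eq(1))
      moreover have "T (\<omega> (Suc (Suc k + j))) < T (\<omega> (Suc k + j))" for j
        using desc by (metis add_Suc add_Suc_right)
      ultimately show False using elim by (auto simp: run_def shift_apply)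
    qed
  qed
qed

section \<open>Multiplicative weights and independence of disjoint blocks\<close>

definition pw :: "('a \<Rightarrow> complex) \<Rightarrow> nat \<Rightarrow> (nat \<Rightarrow> 'a) \<Rightarrow> complex" where
  "pw w k \<omega> = (\<Prod>j<k. w (\<omega> j))"

lemma pw_measurable: "weight w \<Longrightarrow> pw w k \<in> borel_measurable S"
  unfolding pw_def using weight_measurable by measurable

lemma pw_bound: "weight w \<Longrightarrow> \<omega> \<in> space S \<Longrightarrow> norm (pw w k \<omega>) \<le> 1"
  unfolding pw_def prod_norm[symmetric]
  by (intro prod_le_1) (auto intro!: weight_bound simp: space_PiM)

lemma pw_add: "pw w (k + m) \<omega> = pw w k \<omega> * pw w m (shift k \<omega>)"
  by (induction m) (auto simp: pw_def shift_apply mult.assoc)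

lemma pw_cong: "(\<And>i. i < k \<Longrightarrow> \<omega> i = \<omega>' i) \<Longrightarrow> pw w k \<omega> = pw w k \<omega>'"
  by (auto simp: pw_def)

lemma dl_cong: "(\<And>i. i < k \<Longrightarrow> \<omega> i = \<omega>' i) \<Longrightarrow> dl k \<omega> = dl k \<omega>'"
proof (induction k arbitrary: \<omega> \<omega>')
  case (Suc k)
  have "dl k (shift 1 \<omega>) = dl k (shift 1 \<omega>')"
    by (rule Suc.IH) (auto simp: shift_apply intro: Suc.prems)
  moreover have "\<omega> 0 = \<omega>' 0" by (rule Suc.prems) simp
  moreover have "k = 0 \<or> \<omega> 1 = \<omega>' 1" using Suc.prems[of 1] by auto
  ultimately show ?case by auto
qed simp

lemma dr_cong: "(\<And>i. i < k \<Longrightarrow> \<omega> i = \<omega>' i) \<Longrightarrow> dr k \<omega> = dr k \<omega>'"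
proof (induction k)
  case (Suc k)
  have "dr k \<omega> = dr k \<omega>'" by (rule Suc.IH) (auto intro: Suc.prems)
  moreover have "\<omega> k = \<omega>' k" "\<omega> (k - 1) = \<omega>' (k - 1)" by (auto intro: Suc.prems)
  ultimately show ?case by simp
qed simp

lemma seg_cong: "(\<And>i. i < k \<Longrightarrow> \<omega> i = \<omega>' i) \<Longrightarrow> seg k \<omega> = seg k \<omega>'"
proof -
  assume eq: "\<And>i. i < k \<Longrightarrow> \<omega> i = \<omega>' i"
  have "dl (k - j) (shift j \<omega>) = dl (k - j) (shift j \<omega>')" "dr j \<omega> = dr j \<omega>'" if "j \<le> k" for j
    using that eq by (auto simp: shift_apply intro!: dl_cong dr_cong)
  from this(1)[of 0] this[of k] this show ?thesis
    unfolding seg_def by auto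
qed

lemma incr_cong: "(\<And>i. i < k \<Longrightarrow> \<omega> i = \<omega>' i) \<Longrightarrow> incr k \<omega> = incr k \<omega>'"
  unfolding incr_def by (metis diff_less less_trans zero_less_one)

lemma integral_split:
  fixes f g :: "(nat \<Rightarrow> 'a) \<Rightarrow> complex"
  assumes f [measurable]: "f \<in> borel_measurable S" and g [measurable]: "g \<in> borel_measurable S"
    and bound: "\<And>\<omega>. \<omega> \<in> space S \<Longrightarrow> norm (f \<omega>) \<le> 1" "\<And>\<omega>. \<omega> \<in> space S \<Longrightarrow> norm (g \<omega>) \<le> 1"
    and cong: "\<And>\<omega> \<omega>'. (\<And>i. i < k \<Longrightarrow> \<omega> i = \<omega>' i) \<Longrightarrow> f \<omega> = f \<omega>'"
  shows "(\<integral>\<omega>. f \<omega> * g (shift k \<omega>) \<partial>S) = (\<integral>\<omega>. f \<omega> \<partial>S) * (\<integral>\<omega>. g \<omega> \<partial>S)"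
proof -
  have "f (comb_seq k \<omega> \<omega>') = f \<omega>" for \<omega> \<omega>'
    by (rule cong) (simp add: comb_seq_def)
  moreover have "(\<integral>\<omega>. f \<omega> * g (shift k \<omega>) \<partial>S) =
      (\<integral>\<omega>. (\<integral>\<omega>'. f (comb_seq k \<omega> \<omega>') * g (shift k (comb_seq k \<omega> \<omega>')) \<partial>S) \<partial>S)"
    using bound shift_in_space
    by (intro integral_comb_seq(1)[where B = 1]) (auto simp: norm_mult intro!: mult_le_one)
  ultimately show ?thesis by (simp add: shift_comb_seq)
qed

text \<open>The bound \<open>t\<close> on the last ring time is what the induction needs: a new last
  site replaces it by its own ring time, and \<open>integral_mass_power\<close> integrates the
  resulting power.\<close>

lemma integral_incr:
  assumes w: "weight w"
  shows "(\<integral>\<omega>. (if incr k \<omega> \<and> (0 < k \<longrightarrow> T (\<omega> (k - 1)) < t) then pw w k \<omega> else 0) \<partial>S) =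
    mass (\<lambda>x. if c x then w x else 0) t ^ k / fact k"
proof (induction k arbitrary: t)
  case 0
  show ?case by (simp add: incr_def pw_def P.prob_space)
next
  case (Suc k)
  note [measurable] = weight_measurable[OF w] pw_measurable[OF w]
  let ?w = "\<lambda>x. if c x then w x else 0"
  have w': "weight ?w" using weight_if[OF w] by simp
  note [measurable] = mass_measurable[OF w']
  let ?f = "\<lambda>k t \<omega>. if incr k \<omega> \<and> (0 < k \<longrightarrow> T (\<omega> (k - 1)) < t) then pw w k \<omega> else 0"
  have split: "?f (Suc k) t (comb_seq k \<omega> \<omega>') = (if T (\<omega>' 0) < t then ?w (\<omega>' 0) else 0) * ?f k (T (\<omega>' 0)) \<omega>" for \<omega> \<omega>'
  proof -
    have "incr k (comb_seq k \<omega> \<omega>') = incr k \<omega>" "pw w k (comb_seq k \<omega> \<omega>') = pw w k \<omega>"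
      by (rule incr_cong pw_cong; simp add: comb_seq_def)+
    moreover have "T (\<omega>' 0) < t \<Longrightarrow> T (\<omega>' 0) < \<infinity>" by (cases t) auto
    moreover have "pw w (Suc k) (comb_seq k \<omega> \<omega>') = pw w k (comb_seq k \<omega> \<omega>') * w (\<omega>' 0)"
      by (simp add: pw_def comb_seq_def)
    ultimately show ?thesis
      unfolding incr_Suc by (auto simp: comb_seq_def)
  qed
  have "(\<integral>\<omega>. ?f (Suc k) t \<omega> \<partial>S) = (\<integral>\<omega>'. (\<integral>\<omega>. ?f (Suc k) t (comb_seq k \<omega> \<omega>') \<partial>S) \<partial>S)"
    using pw_bound[OF w] by (intro integral_comb_seq(2)[where B = 1]) auto
  also have "\<dots> = (\<integral>\<omega>'. (if T (\<omega>' 0) < t then ?w (\<omega>' 0) else 0) * (mass ?w (T (\<omega>' 0)) ^ k / fact k) \<partial>S)"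
    unfolding split by (simp only: integral_mult_right_zero Suc.IH)
  also have "\<dots> = (\<integral>x. (if T x < t then ?w x else 0) * (mass ?w (T x) ^ k / fact k) \<partial>P)"
    by (rule integral_component) measurable
  also have "\<dots> = (\<integral>x. (if T x < t then ?w x * mass ?w (T x) ^ k else 0) / fact k \<partial>P)"
    by (rule LINT_cong) auto
  also have "\<dots> = mass ?w t ^ Suc k / of_nat (Suc k) / fact k"
    unfolding integral_mass_power[OF w', symmetric] by simp
  finally show ?case by simp
qed

text \<open>Both ends of the isolated chain of \<open>m\<close> sites are still there immediately before time \<open>t\<close>.\<close>

definition ends :: "nat \<Rightarrow> ereal \<Rightarrow> (nat \<Rightarrow> 'a) \<Rightarrow> bool" where
  "ends m t \<omega> \<longleftrightarrow> \<not> (dl m \<omega> \<and> T (\<omega> 0) < t) \<and> \<not> (dr m \<omega> \<and> T (\<omega> (m - 1)) < t)"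

lemma ends_measurable [measurable (raw)]:
  assumes f [measurable]: "f \<in> N \<rightarrow>\<^sub>M S" and [measurable]: "t \<in> borel_measurable N"
  shows "Measurable.pred N (\<lambda>x. ends m (t x) (f x))"
proof -
  have [measurable]: "(\<lambda>x. f x i) \<in> N \<rightarrow>\<^sub>M P" for i
    using measurable_compose[OF f measurable_component_singleton[OF UNIV_I]] .
  show ?thesis unfolding ends_def by measurable
qed

lemma ends_cong:
  assumes "\<And>i. i < m \<Longrightarrow> \<omega> i = \<omega>' i"
  shows "ends m t \<omega> = ends m t \<omega>'"
proof (cases m)
  case (Suc n)
  have "dl m \<omega> = dl m \<omega>'" "dr m \<omega> = dr m \<omega>'" by (rule dl_cong dr_cong; use assms in blast)+
  moreover have "\<omega> 0 = \<omega>' 0" "\<omega> (m - 1) = \<omega>' (m - 1)" by (auto intro!: assms simp: Suc)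
  ultimately show ?thesis unfolding ends_def by simp
qed (simp add: ends_def)

lemma ends_infinity: "ends m \<infinity> \<omega> \<longleftrightarrow> \<not> dl m \<omega> \<and> \<not> dr m \<omega>"
  by (cases m) (auto simp: ends_def)

text \<open>The first end to go is deleted by the site next to it, and until then both ends of the remaining
  chain are there.\<close>

lemma ends_Suc:
  assumes "noties \<omega>"
  shows "(if ends (Suc m) t \<omega> then z else 0) = z
    - (if c (\<omega> 0) \<and> T (\<omega> 0) < t \<and> ends m (T (\<omega> 0)) (shift 1 \<omega>) then z else 0)
    - (if \<not> c (\<omega> m) \<and> T (\<omega> m) < t \<and> ends m (T (\<omega> m)) \<omega> then z else (0::complex))"
proof -
  let ?U = "c (\<omega> 0) \<and> T (\<omega> 0) < t \<and> ends m (T (\<omega> 0)) (shift 1 \<omega>)"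
  let ?V = "\<not> c (\<omega> m) \<and> T (\<omega> m) < t \<and> ends m (T (\<omega> m)) \<omega>"
  have fin: "T x < t \<Longrightarrow> T x < \<infinity>" for x by (cases t) auto
  \<comment> \<open>Site 0 deletes the left end when its own right endpoint and the right end of the
    chain have not gone earlier. So \<open>?U\<close> says that the left end goes first, and
    \<open>?V\<close> that the right end does.\<close>
  have U: "?U \<longleftrightarrow> dl (Suc m) \<omega> \<and> T (\<omega> 0) < t \<and> \<not> (dr (Suc m) \<omega> \<and> T (\<omega> m) < T (\<omega> 0))"
  proof (cases "c (\<omega> 0)")
    case True
    then have "dr (Suc m) \<omega> = dr m (shift 1 \<omega>)" using dr_split[of 1 \<omega> m] by simp
    moreover have "m = 0 \<or> shift 1 \<omega> (m - 1) = \<omega> m" by (cases m) (auto simp: shift_apply)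
    moreover have "shift 1 \<omega> 0 = \<omega> 1" by (simp add: shift_apply)
    ultimately show ?thesis
      unfolding ends_def dl.simps(2) using True fin[of "\<omega> 0"] by (metis dr.simps(1))
  qed simp
  have V: "?V \<longleftrightarrow> dr (Suc m) \<omega> \<and> T (\<omega> m) < t \<and> \<not> (dl (Suc m) \<omega> \<and> T (\<omega> 0) < T (\<omega> m))"
  proof (cases "c (\<omega> m)")
    case False
    then have "dl (Suc m) \<omega> = dl m \<omega>" using dl_split[of 1 m \<omega>] by (simp add: shift_apply)
    then show ?thesis
      unfolding ends_def dr.simps(2) using False fin[of "\<omega> m"] by blast
  qed simp
  \<comment> \<open>Both at once would mean a finite tie between the first and the last site; if
    these are the same site, its coin decides.\<close>
  have "\<not> (?U \<and> ?V)"
  proof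
    assume UV: "?U \<and> ?V"
    then have "\<not> T (\<omega> 0) < T (\<omega> m)" "\<not> T (\<omega> m) < T (\<omega> 0)" using U V by blast+
    then have "T (\<omega> 0) = T (\<omega> m)" by simp
    moreover have "0 < m" using UV by (cases m) auto
    ultimately have "T (\<omega> 0) = \<infinity>" using assms unfolding noties_def by blast
    then show False using UV fin[of "\<omega> 0"] by simp
  qed
  moreover have "T (\<omega> 0) < t \<Longrightarrow> \<not> T (\<omega> m) < t \<Longrightarrow> \<not> T (\<omega> m) < T (\<omega> 0)"
    "T (\<omega> m) < t \<Longrightarrow> \<not> T (\<omega> 0) < t \<Longrightarrow> \<not> T (\<omega> 0) < T (\<omega> m)" by auto
  moreover have "\<not> (T (\<omega> 0) < T (\<omega> m) \<and> T (\<omega> m) < T (\<omega> 0))" by auto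
  ultimately have "\<not> ends (Suc m) t \<omega> \<longleftrightarrow> ?U \<or> ?V"
    unfolding U V ends_def[of "Suc m"] diff_Suc_1 by blast
  then show ?thesis using \<open>\<not> (?U \<and> ?V)\<close> by auto
qed

lemma integral_pw:
  assumes w: "weight w"
  shows "(\<integral>\<omega>. pw w m \<omega> \<partial>S) = (\<integral>x. w x \<partial>P) ^ m"
proof (induction m)
  case 0
  show ?case by (simp add: pw_def P.prob_space)
next
  case (Suc m)
  note [measurable] = weight_measurable[OF w]
  have "(\<integral>\<omega>. pw w (Suc m) \<omega> \<partial>S) = (\<integral>\<omega>. pw w m \<omega> * pw w 1 (shift m \<omega>) \<partial>S)"
    using pw_add[of w m 1] by simp
  also have "\<dots> = (\<integral>\<omega>. pw w m \<omega> \<partial>S) * (\<integral>\<omega>. pw w 1 \<omega> \<partial>S)"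
    using w by (intro integral_split pw_measurable pw_bound pw_cong)
  also have "(\<integral>\<omega>. pw w 1 \<omega> \<partial>S) = (\<integral>x. w x \<partial>P)"
    unfolding pw_def using integral_component[of w 0] by simp
  finally show ?case by (simp add: Suc.IH)
qed

text \<open>Induction through \<open>ends_Suc\<close>, for all \<open>t\<close> at once, since the
  remaining chain is observed at the ring time of the deleting site.\<close>

lemma integral_ends:
  assumes w: "weight w"
  shows "(\<integral>\<omega>. (if ends m t \<omega> then pw w m \<omega> else 0) \<partial>S) =
    (\<Sum>j\<le>m. (- mass w t) ^ j / fact j * (\<integral>x. w x \<partial>P) ^ (m - j))"
proof (induction m arbitrary: t)
  case 0
  show ?case by (simp add: ends_def pw_def P.prob_space)
next
  case (Suc m)
  note [measurable] = weight_measurable[OF w] pw_measurable[OF w] mass_measurable[OF w]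
  define G where "G = (\<integral>x. w x \<partial>P)"
  define \<Phi> where "\<Phi> t = (\<Sum>j\<le>m. (- mass w t) ^ j / fact j * G ^ (m - j))" for t
  have IH: "(\<integral>\<omega>. (if ends m t \<omega> then pw w m \<omega> else 0) \<partial>S) = \<Phi> t" for t
    unfolding \<Phi>_def G_def by (rule Suc.IH)
  let ?u = "\<lambda>\<omega>. if c (\<omega> 0) \<and> T (\<omega> 0) < t \<and> ends m (T (\<omega> 0)) (shift 1 \<omega>) then pw w (Suc m) \<omega> else 0"
  let ?v = "\<lambda>\<omega>. if \<not> c (\<omega> m) \<and> T (\<omega> m) < t \<and> ends m (T (\<omega> m)) \<omega> then pw w (Suc m) \<omega> else 0"
  have uv_measurable [measurable]: "?u \<in> borel_measurable S" "?v \<in> borel_measurable S"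
    by measurable
  have int: "integrable S (pw w (Suc m))" "integrable S ?u" "integrable S ?v"
    by (rule P.integrable_const_bound[where B = 1]; use pw_bound[OF w] in auto)+
  have u: "?u (comb_seq 1 \<omega> \<omega>') = (if c (\<omega> 0) \<and> T (\<omega> 0) < t then w (\<omega> 0) else 0) *
      (if ends m (T (\<omega> 0)) \<omega>' then pw w m \<omega>' else 0)" for \<omega> \<omega>'
  proof -
    have "pw w (Suc m) (comb_seq 1 \<omega> \<omega>') = w (\<omega> 0) * pw w m \<omega>'"
      using pw_add[of w 1 m "comb_seq 1 \<omega> \<omega>'"] shift_comb_seq[of 1 \<omega> \<omega>']
      by (simp add: pw_def del: comb_seq_Suc_0) (simp add: comb_seq_def)
    moreover have "comb_seq 1 \<omega> \<omega>' 0 = \<omega> 0" by (simp add: comb_seq_def)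
    ultimately show ?thesis using shift_comb_seq[of 1 \<omega> \<omega>'] by simp
  qed
  have v: "?v (comb_seq m \<omega> \<omega>') = (if \<not> c (\<omega>' 0) \<and> T (\<omega>' 0) < t then w (\<omega>' 0) else 0) *
      (if ends m (T (\<omega>' 0)) \<omega> then pw w m \<omega> else 0)" for \<omega> \<omega>'
  proof -
    have m: "comb_seq m \<omega> \<omega>' m = \<omega>' 0" by (simp add: comb_seq_def)
    have "pw w m (comb_seq m \<omega> \<omega>') = pw w m \<omega>"
      "ends m t' (comb_seq m \<omega> \<omega>') = ends m t' \<omega>" for t'
      by (rule pw_cong ends_cong; simp add: comb_seq_def)+
    moreover from this have "pw w (Suc m) (comb_seq m \<omega> \<omega>') = pw w m \<omega> * w (\<omega>' 0)"
      by (simp add: pw_def m)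
    ultimately show ?thesis unfolding m by simp
  qed
  have "(\<integral>\<omega>. ?u \<omega> \<partial>S) = (\<integral>\<omega>. (\<integral>\<omega>'. ?u (comb_seq 1 \<omega> \<omega>') \<partial>S) \<partial>S)"
    by (rule integral_comb_seq(1)[where B = 1]) (use pw_bound[OF w] in auto)
  also have "\<dots> = (\<integral>\<omega>. (if c (\<omega> 0) \<and> T (\<omega> 0) < t then w (\<omega> 0) else 0) * \<Phi> (T (\<omega> 0)) \<partial>S)"
    unfolding u by (simp only: integral_mult_right_zero IH)
  also have "\<dots> = (\<integral>x. (if c x \<and> T x < t then w x else 0) * \<Phi> (T x) \<partial>P)"
    unfolding \<Phi>_def by (rule integral_component) measurable
  finally have u_eq: "(\<integral>\<omega>. ?u \<omega> \<partial>S) = (\<integral>x. (if c x \<and> T x < t then w x else 0) * \<Phi> (T x) \<partial>P)" .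
  have "(\<integral>\<omega>. ?v \<omega> \<partial>S) = (\<integral>\<omega>'. (\<integral>\<omega>. ?v (comb_seq m \<omega> \<omega>') \<partial>S) \<partial>S)"
    by (rule integral_comb_seq(2)[where B = 1]) (use pw_bound[OF w] in auto)
  also have "\<dots> = (\<integral>\<omega>'. (if \<not> c (\<omega>' 0) \<and> T (\<omega>' 0) < t then w (\<omega>' 0) else 0) * \<Phi> (T (\<omega>' 0)) \<partial>S)"
    unfolding v by (simp only: integral_mult_right_zero IH)
  also have "\<dots> = (\<integral>x. (if \<not> c x \<and> T x < t then w x else 0) * \<Phi> (T x) \<partial>P)"
    unfolding \<Phi>_def by (rule integral_component) measurable
  finally have v_eq: "(\<integral>\<omega>. ?v \<omega> \<partial>S) = (\<integral>x. (if \<not> c x \<and> T x < t then w x else 0) * \<Phi> (T x) \<partial>P)" .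
  have bound: "norm (w x * mass w (T x) ^ j) \<le> 1" if "x \<in> space P" for x j
    using that weight_bound[OF w] mass_bound[OF w]
    by (auto simp: norm_mult norm_power intro!: mult_le_one power_le_one)
  have intj: "integrable P (\<lambda>x. if b x then w x * mass w (T x) ^ j else 0)"
    if [measurable]: "Measurable.pred P b" for b j
    by (rule M.integrable_const_bound[where B = 1]) (use bound in auto)
  have expand: "(if b x then w x else 0) * \<Phi> (T x) =
      (\<Sum>j\<le>m. ((-1) ^ j / fact j * G ^ (m - j)) * (if b x then w x * mass w (T x) ^ j else 0))" for b x
    unfolding \<Phi>_def sum_distrib_left by (rule sum.cong) (auto simp: power_minus[of "mass _ _"])
  have int\<Phi>: "integrable P (\<lambda>x. (if b x then w x else 0) * \<Phi> (T x))"
    if "Measurable.pred P b" for b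
    unfolding expand by (intro Bochner_Integration.integrable_sum integrable_mult_right intj that)
  \<comment> \<open>Here the coins drop out: both cases leave the same factor \<open>\<Phi>\<close>
    at the ring time of the deleting site, and the left and right coins together restore the whole
    weight.\<close>
  have "(\<integral>\<omega>. ?u \<omega> \<partial>S) + (\<integral>\<omega>. ?v \<omega> \<partial>S) = (\<integral>x. (if T x < t then w x else 0) * \<Phi> (T x) \<partial>P)"
    unfolding u_eq v_eq
    by (subst Bochner_Integration.integral_add[symmetric])
      (auto intro!: int\<Phi> LINT_cong)
  also have "\<dots> = (\<Sum>j\<le>m. ((-1) ^ j / fact j * G ^ (m - j)) * (mass w t ^ Suc j / of_nat (Suc j)))"
    unfolding expand[of "\<lambda>x. T x < t"] integral_mass_power[OF w, symmetric]
    by (subst Bochner_Integration.integral_sum) (auto intro!: intj integrable_mult_right)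
  \<comment> \<open>Integration has raised each power by one, so these are the terms of index at
    least 1 for the chain of \<open>m + 1\<close> sites; the term of index 0 is the weight without
    any condition.\<close>
  also have "\<dots> = (\<Sum>j\<le>m. - ((- mass w t) ^ Suc j / fact (Suc j) * G ^ (m - j)))"
    by (rule sum.cong) (auto simp: power_minus[of "mass _ _"] divide_simps)
  finally have uv: "(\<integral>\<omega>. ?u \<omega> \<partial>S) + (\<integral>\<omega>. ?v \<omega> \<partial>S) = (\<Sum>j\<le>m. - ((- mass w t) ^ Suc j / fact (Suc j) * G ^ (m - j)))" .
  have "(\<integral>\<omega>. (if ends (Suc m) t \<omega> then pw w (Suc m) \<omega> else 0) \<partial>S) = (\<integral>\<omega>. pw w (Suc m) \<omega> - ?u \<omega> - ?v \<omega> \<partial>S)"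
  proof (rule integral_cong_AE)
    show "(\<lambda>\<omega>. pw w (Suc m) \<omega> - ?u \<omega> - ?v \<omega>) \<in> borel_measurable S"
      by (intro borel_measurable_diff uv_measurable pw_measurable[OF w])
    show "AE \<omega> in S. (if ends (Suc m) t \<omega> then pw w (Suc m) \<omega> else 0) = pw w (Suc m) \<omega> - ?u \<omega> - ?v \<omega>"
      using AE_noties by eventually_elim (rule ends_Suc)
  qed measurable
  also have "\<dots> = (\<integral>\<omega>. pw w (Suc m) \<omega> \<partial>S) - (\<integral>\<omega>. ?u \<omega> \<partial>S) - (\<integral>\<omega>. ?v \<omega> \<partial>S)"
    using int by simp
  also have "\<dots> = G ^ Suc m - ((\<integral>\<omega>. ?u \<omega> \<partial>S) + (\<integral>\<omega>. ?v \<omega> \<partial>S))"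
    unfolding integral_pw[OF w] G_def by simp
  also have "\<dots> = (\<Sum>j\<le>Suc m. (- mass w t) ^ j / fact j * G ^ (Suc m - j))"
    unfolding uv sum.atMost_Suc_shift by (simp add: sum_negf)
  finally show ?case unfolding G_def .
qed

text \<open>Renewal decomposition: exactly one summand is active, the one of the first surviving
  point after the left end. The right end counts as such a point, so one exists. Being a wall, it
  separates the chain into two isolated ones.\<close>

lemma ends_first_survivor:
  assumes "0 < m"
  shows "(if ends m \<infinity> \<omega> then pw w m \<omega> else 0) = (\<Sum>l = 1..m. (if seg l \<omega> then pw w l \<omega> else 0) *
    (if ends (m - l) \<infinity> (shift l \<omega>) then pw w (m - l) (shift l \<omega>) else 0))"
proof -
  define s where "s j \<longleftrightarrow> \<not> dl (m - j) (shift j \<omega>) \<and> \<not> dr j \<omega>" for j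
  have *: "seg l \<omega> \<and> ends (m - l) \<infinity> (shift l \<omega>) \<longleftrightarrow> ends m \<infinity> \<omega> \<and> s l \<and> (\<forall>j. 0 < j \<longrightarrow> j < l \<longrightarrow> \<not> s j)"
    if "0 < l" "l \<le> m" for l
  proof (cases "s l")
    case True
    then have "dl m \<omega> = dl l \<omega>" "dr m \<omega> = dr (m - l) (shift l \<omega>)"
      using dl_split[of "m - l" l \<omega>] dr_split[of l \<omega> "m - l"] that by (auto simp: s_def)
    moreover have "dl (m - j) (shift j \<omega>) = dl (l - j) (shift j \<omega>)" if "j < l" for j
      using dl_split[of "m - l" "l - j" "shift j \<omega>"] that \<open>l \<le> m\<close> True by (auto simp: s_def)
    ultimately show ?thesis
      using True unfolding seg_def ends_infinity s_def by blast
  qed (auto simp: seg_def ends_infinity s_def)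
  have pw: "pw w m \<omega> = pw w l \<omega> * pw w (m - l) (shift l \<omega>)" if "l \<le> m" for l
    using pw_add[of w l "m - l" \<omega>] that by simp
  have "(\<Sum>l = 1..m. (if seg l \<omega> then pw w l \<omega> else 0) *
      (if ends (m - l) \<infinity> (shift l \<omega>) then pw w (m - l) (shift l \<omega>) else 0)) =
    (\<Sum>l = 1..m. if ends m \<infinity> \<omega> \<and> s l \<and> (\<forall>j. 0 < j \<longrightarrow> j < l \<longrightarrow> \<not> s j) then pw w m \<omega> else 0)"
  proof (rule sum.cong[OF refl])
    fix l assume "l \<in> {1..m}"
    then have "0 < l" "l \<le> m" by auto
    then show "(if seg l \<omega> then pw w l \<omega> else 0) *
        (if ends (m - l) \<infinity> (shift l \<omega>) then pw w (m - l) (shift l \<omega>) else 0) =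
      (if ends m \<infinity> \<omega> \<and> s l \<and> (\<forall>j. 0 < j \<longrightarrow> j < l \<longrightarrow> \<not> s j) then pw w m \<omega> else 0)"
      unfolding *[OF \<open>0 < l\<close> \<open>l \<le> m\<close>, symmetric] pw[OF \<open>l \<le> m\<close>] by simp
  qed
  also have "\<dots> = (if ends m \<infinity> \<omega> then pw w m \<omega> else 0)"
  proof (cases "ends m \<infinity> \<omega>")
    case True
    define L where "L = (LEAST l. 0 < l \<and> s l)"
    have "s m" using True by (simp add: s_def ends_infinity)
    then have L: "0 < L \<and> s L" "L \<le> m"
      unfolding L_def using \<open>0 < m\<close> by (rule_tac LeastI[of _ m], simp, intro Least_le, simp)
    have least: "0 < j \<Longrightarrow> s j \<Longrightarrow> L \<le> j" for j
      unfolding L_def by (simp add: Least_le)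
    have "s l \<and> (\<forall>j. 0 < j \<longrightarrow> j < l \<longrightarrow> \<not> s j) \<longleftrightarrow> l = L" if "l \<in> {1..m}" for l
      using L least that by (metis atLeastAtMost_iff le_neq_implies_less less_eq_Suc_le linorder_not_less One_nat_def)
    then have "(\<Sum>l = 1..m. if ends m \<infinity> \<omega> \<and> s l \<and> (\<forall>j. 0 < j \<longrightarrow> j < l \<longrightarrow> \<not> s j) then pw w m \<omega> else 0) =
      (\<Sum>l = 1..m. if l = L then pw w m \<omega> else 0)"
      using True by (intro sum.cong) auto
    also have "\<dots> = pw w m \<omega>" using L by simp
    finally show ?thesis using True by simp
  qed simp
  finally show ?thesis ..
qed

lemma integral_seg:
  assumes w: "weight w"
  defines "G \<equiv> \<integral>x. w x \<partial>P" and "H \<equiv> mass w \<infinity>"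
  shows "(\<integral>\<omega>. (if seg (Suc m) \<omega> then pw w (Suc m) \<omega> else 0) \<partial>S) =
    G * H ^ m / fact m - H ^ Suc m / fact (Suc m)"
proof -
  note [measurable] = pw_measurable[OF w]
  define F where "F m = (\<integral>\<omega>. (if ends m \<infinity> \<omega> then pw w m \<omega> else 0) \<partial>S)" for m
  define g where "g m = (\<integral>\<omega>. (if seg m \<omega> then pw w m \<omega> else 0) \<partial>S)" for m
  have split: "(\<integral>\<omega>. (if seg l \<omega> then pw w l \<omega> else 0) *
      (if ends k \<infinity> (shift l \<omega>) then pw w k (shift l \<omega>) else 0) \<partial>S) = g l * F k" for l k
    unfolding F_def g_def
  proof (rule integral_split)
    show "(if seg l \<omega> then pw w l \<omega> else 0) = (if seg l \<omega>' then pw w l \<omega>' else 0)"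
      if "\<And>i. i < l \<Longrightarrow> \<omega> i = \<omega>' i" for \<omega> \<omega>'
      using seg_cong[of l \<omega> \<omega>'] pw_cong[of l \<omega> \<omega>'] that by simp
  qed (use pw_bound[OF w] in auto)
  have F: "F m = (\<Sum>l = 1..m. g l * F (m - l))" if "0 < m" for m
  proof -
    have "F m = (\<integral>\<omega>. (\<Sum>l = 1..m. (if seg l \<omega> then pw w l \<omega> else 0) *
      (if ends (m - l) \<infinity> (shift l \<omega>) then pw w (m - l) (shift l \<omega>) else 0)) \<partial>S)"
      unfolding F_def ends_first_survivor[OF that] ..
    also have "\<dots> = (\<Sum>l = 1..m. (\<integral>\<omega>. (if seg l \<omega> then pw w l \<omega> else 0) *
      (if ends (m - l) \<infinity> (shift l \<omega>) then pw w (m - l) (shift l \<omega>) else 0) \<partial>S))"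
      by (rule Bochner_Integration.integral_sum, rule P.integrable_const_bound[where B = 1])
        (use pw_bound[OF w] shift_in_space in \<open>auto simp: norm_mult intro!: mult_le_one\<close>)
    finally show ?thesis unfolding split .
  qed
  have F0: "F 0 = 1" by (simp add: F_def ends_def pw_def P.prob_space)
  \<comment> \<open>Formal series avoid questions of convergence, as \<open>G\<close> may have
    modulus one. In \<open>gg\<close> the coefficient 0 is set to zero, because \<open>seg 0\<close>
    holds trivially while an empty chain is no gap.\<close>
  define FF where "FF = Abs_fps F"
  define gg where "gg = Abs_fps (\<lambda>m. if m = 0 then 0 else g m)"
  define geo where "geo = Abs_fps (\<lambda>n. G ^ n)"
  have "FF = 1 + gg * FF"
  proof (rule fps_ext)
    fix m
    show "fps_nth FF m = fps_nth (1 + gg * FF) m"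
    proof (cases "m = 0")
      case False
      have "fps_nth (gg * FF) m = (\<Sum>l = 0..m. (if l = 0 then 0 else g l) * F (m - l))"
        by (simp add: fps_mult_nth FF_def gg_def)
      also have "\<dots> = (\<Sum>l = 1..m. g l * F (m - l))"
        by (simp add: sum.atLeast_Suc_atMost)
      finally show ?thesis using False F[of m] by (simp add: FF_def)
    qed (simp add: FF_def gg_def F0)
  qed
  then have 1: "(1 - gg) * FF = 1" by (simp add: algebra_simps)
  have 2: "FF = fps_exp (- H) * geo"
  proof (rule fps_ext)
    fix m
    show "fps_nth FF m = fps_nth (fps_exp (- H) * geo) m"
      unfolding FF_def F_def integral_ends[OF w]
      by (simp add: fps_mult_nth geo_def G_def H_def atLeast0AtMost)
  qed
  have 3: "geo * (1 - fps_const G * fps_X) = 1"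
  proof (rule fps_ext)
    fix m show "fps_nth (geo * (1 - fps_const G * fps_X)) m = fps_nth 1 m"
    proof (cases m)
      case (Suc n)
      have "geo * (1 - fps_const G * fps_X) = geo - fps_const G * (geo * fps_X)"
        by (simp add: algebra_simps)
      then show ?thesis by (simp add: geo_def Suc)
    qed (simp add: geo_def)
  qed
  have 4: "fps_exp (- H) * fps_exp H = 1"
    by (simp add: fps_exp_add_mult[symmetric])
  \<comment> \<open>The renewal equation makes \<open>1 - gg\<close> the inverse of
    \<open>FF\<close>, and both factors of \<open>FF\<close> have explicit inverses.\<close>
  have "1 - gg = (1 - gg) * ((fps_exp (- H) * fps_exp H) * (geo * (1 - fps_const G * fps_X)))"
    unfolding 3 4 by simp
  also have "\<dots> = ((1 - gg) * FF) * (fps_exp H * (1 - fps_const G * fps_X))"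
    unfolding 2 by (simp only: mult_ac)
  also have "\<dots> = fps_exp H - fps_const G * (fps_exp H * fps_X)"
    unfolding 1 by (simp add: algebra_simps)
  finally have "fps_nth (1 - gg) (Suc m) = fps_nth (fps_exp H - fps_const G * (fps_exp H * fps_X)) (Suc m)"
    by simp
  then have "- g (Suc m) = H ^ Suc m / fact (Suc m) - G * (H ^ m / fact m)"
    by (simp add: gg_def del: fact_Suc power_Suc)
  then have "g (Suc m) = G * (H ^ m / fact m) - H ^ Suc m / fact (Suc m)"
    by (metis minus_diff_eq minus_minus)
  then show ?thesis unfolding g_def by (simp only: times_divide_eq_right)
qed

section \<open>Laws of the leftmost survivor and of the gap that follows it\<close>

definition first_alive :: "(nat \<Rightarrow> 'a) \<Rightarrow> nat" where
  "first_alive \<omega> = (LEAST k. alive k \<omega>)"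

definition gap_length :: "(nat \<Rightarrow> 'a) \<Rightarrow> nat" where
  "gap_length \<omega> = (LEAST m. 0 < m \<and> alive (first_alive \<omega> + m) \<omega>)"

lemma first_alive_measurable [measurable]: "first_alive \<in> S \<rightarrow>\<^sub>M count_space UNIV"
  unfolding first_alive_def by measurable

lemma gap_length_measurable [measurable]: "gap_length \<in> S \<rightarrow>\<^sub>M count_space UNIV"
proof -
  have "Measurable.pred S (\<lambda>\<omega>. 0 < m \<and> alive (first_alive \<omega> + m) \<omega>)" for m
    by (rule measurable_compose_countable'[where I = UNIV and g = first_alive and
      f = "\<lambda>k \<omega>. 0 < m \<and> alive (k + m) \<omega>"]) auto
  then show ?thesis unfolding gap_length_def by measurable
qed

lemma first_alive_eq_iff:
  assumes "\<exists>k. alive k \<omega>"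
  shows "first_alive \<omega> = k \<longleftrightarrow> alive k \<omega> \<and> (\<forall>j<k. \<not> alive j \<omega>)"
proof
  assume "first_alive \<omega> = k"
  then show "alive k \<omega> \<and> (\<forall>j<k. \<not> alive j \<omega>)"
    using LeastI_ex[OF assms] not_less_Least unfolding first_alive_def by blast
next
  assume "alive k \<omega> \<and> (\<forall>j<k. \<not> alive j \<omega>)"
  then show "first_alive \<omega> = k"
    unfolding first_alive_def by (intro Least_equality) (auto simp: linorder_not_less[symmetric])
qed

lemma gap_length_eq_iff:
  assumes "\<forall>n. \<exists>k\<ge>n. alive k \<omega>"
  shows "gap_length \<omega> = m \<longleftrightarrow> 0 < m \<and> alive (first_alive \<omega> + m) \<omega> \<and>
    (\<forall>j. first_alive \<omega> < j \<longrightarrow> j < first_alive \<omega> + m \<longrightarrow> \<not> alive j \<omega>)"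
proof -
  let ?k = "first_alive \<omega>"
  obtain l where "alive l \<omega>" "Suc ?k \<le> l" using assms by blast
  then have ex: "0 < l - ?k \<and> alive (?k + (l - ?k)) \<omega>" by simp
  show ?thesis
  proof
    assume m: "gap_length \<omega> = m"
    have "\<not> alive j \<omega>" if "?k < j" "j < ?k + m" for j
      using not_less_Least[of "j - ?k" "\<lambda>m. 0 < m \<and> alive (?k + m) \<omega>"] that m
      unfolding gap_length_def[symmetric] by auto
    then show "0 < m \<and> alive (?k + m) \<omega> \<and> (\<forall>j. ?k < j \<longrightarrow> j < ?k + m \<longrightarrow> \<not> alive j \<omega>)"
      using LeastI[of "\<lambda>m. 0 < m \<and> alive (?k + m) \<omega>", OF ex] m
      unfolding gap_length_def[symmetric] by auto
  next
    assume *: "0 < m \<and> alive (?k + m) \<omega> \<and> (\<forall>j. ?k < j \<longrightarrow> j < ?k + m \<longrightarrow> \<not> alive j \<omega>)"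
    show "gap_length \<omega> = m"
      unfolding gap_length_def
    proof (rule Least_equality)
      fix y assume "0 < y \<and> alive (?k + y) \<omega>"
      then show "m \<le> y" using *
        by (metis add_less_cancel_left less_add_same_cancel1 linorder_not_less)
    qed (use * in blast)
  qed
qed

lemma integral_partition:
  fixes f :: "(nat \<Rightarrow> 'a) \<Rightarrow> complex"
  assumes [measurable]: "N \<in> S \<rightarrow>\<^sub>M count_space UNIV" "f \<in> borel_measurable S"
    and bound: "\<And>\<omega>. \<omega> \<in> space S \<Longrightarrow> norm (f \<omega>) \<le> 1"
  shows "(\<integral>\<omega>. f \<omega> \<partial>S) = (\<Sum>k::nat. (\<integral>\<omega>. (if N \<omega> = k then f \<omega> else 0) \<partial>S))"
proof -
  define A where "A k = {\<omega> \<in> space S. N \<omega> = k}" for k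
  have [measurable]: "A k \<in> sets S" for k unfolding A_def by measurable
  have U: "(\<Union>k. A k) = space S" by (auto simp: A_def)
  have int: "integrable S f"
    by (rule P.integrable_const_bound[where B = 1]) (use bound in auto)
  have "(LINT \<omega>:(\<Union>k. A k)|S. f \<omega>) = (\<Sum>k. (LINT \<omega>:A k|S. f \<omega>))"
  proof (rule lebesgue_integral_countable_add)
    show "set_integrable S (\<Union>k. A k) f"
      unfolding U by (rule set_integrable_subset[of S UNIV]) (use int in \<open>auto simp: set_integrable_def\<close>)
  qed (auto simp: A_def)
  also have "(LINT \<omega>:(\<Union>k. A k)|S. f \<omega>) = (\<integral>\<omega>. f \<omega> \<partial>S)"
    unfolding U set_lebesgue_integral_def by (rule LINT_cong) auto
  finally have "(\<integral>\<omega>. f \<omega> \<partial>S) = (\<Sum>k. (LINT \<omega>:A k|S. f \<omega>))" .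
  moreover have "(LINT \<omega>:A k|S. f \<omega>) = (\<integral>\<omega>. (if N \<omega> = k then f \<omega> else 0) \<partial>S)" for k
    unfolding set_lebesgue_integral_def by (rule LINT_cong) (auto simp: A_def)
  ultimately show ?thesis by simp
qed

abbreviation left_mass :: "('a \<Rightarrow> complex) \<Rightarrow> complex" where
  "left_mass w \<equiv> mass (\<lambda>x. if c x then w x else 0) \<infinity>"

lemma integral_incr_infinity:
  assumes w: "weight w"
  shows "(\<integral>\<omega>. (if incr k \<omega> then pw w k \<omega> else 0) \<partial>S) = left_mass w ^ k / fact k"
proof -
  have "(0 < k \<longrightarrow> T (\<omega> (k - 1)) < \<infinity>)" if "incr k \<omega>" for \<omega>
    using that unfolding incr_def by auto
  then have "(\<lambda>\<omega>. if incr k \<omega> then pw w k \<omega> else 0) =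
      (\<lambda>\<omega>. if incr k \<omega> \<and> (0 < k \<longrightarrow> T (\<omega> (k - 1)) < \<infinity>) then pw w k \<omega> else 0)"
    by (intro ext) auto
  then show ?thesis using integral_incr[OF w, of k \<infinity>] by simp
qed

lemma exp_sums: "(\<lambda>n. z ^ n / fact n) sums exp (z :: complex)"
  using exp_converges[of z] by (simp add: scaleR_conv_of_real divide_inverse mult.commute)

context
  assumes infinitely_many: "AE \<omega> in S. \<forall>n. \<exists>k\<ge>n. alive k \<omega>"
begin

abbreviation surv_prob :: complex where
  "surv_prob \<equiv> \<integral>\<omega>. (if dinf \<omega> then 0 else 1) \<partial>S"

lemma AE_first_alive: "AE \<omega> in S. first_alive \<omega> = k \<longleftrightarrow> incr k \<omega> \<and> \<not> dinf (shift k \<omega>)"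
  using infinitely_many AE_nodesc AE_noties
proof eventually_elim
  case (elim \<omega>)
  then show ?case using first_alive_eq_iff first_alive_iff by blast
qed

text \<open>On \<open>first_alive \<omega> = k\<close> the weight and the increasing order involve
  only the sites below \<open>k\<close>, and survival only the others. The factorised summands form
  an exponential series.\<close>

lemma integral_pw_first_alive:
  assumes w: "weight w"
  shows "(\<integral>\<omega>. pw w (first_alive \<omega>) \<omega> \<partial>S) = exp (left_mass w) * surv_prob"
proof -
  note [measurable] = pw_measurable[OF w]
  have [measurable]: "(\<lambda>\<omega>. pw w (first_alive \<omega>) \<omega>) \<in> borel_measurable S"
    by (rule measurable_compose_countable'[where I = UNIV and g = first_alive and f = "\<lambda>k \<omega>. pw w k \<omega>"]) auto
  have summand: "(\<integral>\<omega>. (if first_alive \<omega> = k then pw w (first_alive \<omega>) \<omega> else 0) \<partial>S) =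
      left_mass w ^ k / fact k * surv_prob" for k
  proof -
    have "(\<integral>\<omega>. (if first_alive \<omega> = k then pw w (first_alive \<omega>) \<omega> else 0) \<partial>S) =
      (\<integral>\<omega>. (if incr k \<omega> then pw w k \<omega> else 0) * (if dinf (shift k \<omega>) then 0 else 1) \<partial>S)"
      by (rule integral_cong_AE, measurable) (use AE_first_alive[of k] in \<open>eventually_elim, auto\<close>)
    also have "\<dots> = (\<integral>\<omega>. (if incr k \<omega> then pw w k \<omega> else 0) \<partial>S) * surv_prob"
    proof (rule integral_split)
      show "(if incr k \<omega> then pw w k \<omega> else 0) = (if incr k \<omega>' then pw w k \<omega>' else 0)"
        if "\<And>i. i < k \<Longrightarrow> \<omega> i = \<omega>' i" for \<omega> \<omega>'
        using incr_cong[of k \<omega> \<omega>'] pw_cong[of k \<omega> \<omega>'] that by simp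
    qed (use pw_bound[OF w] in auto)
    finally show ?thesis unfolding integral_incr_infinity[OF w] .
  qed
  have "(\<integral>\<omega>. pw w (first_alive \<omega>) \<omega> \<partial>S) = (\<Sum>k. left_mass w ^ k / fact k * surv_prob)"
    unfolding summand[symmetric] by (rule integral_partition) (use pw_bound[OF w] in auto)
  also have "\<dots> = exp (left_mass w) * surv_prob"
    by (rule sums_unique[symmetric]) (intro sums_mult2 exp_sums)
  finally show ?thesis .
qed

text \<open>Pure normalisation: for the weight one the left side of
  \<open>integral_pw_first_alive\<close> is a total probability.\<close>

lemma surv_prob: "surv_prob = exp (- left_mass (\<lambda>x. 1))"
proof -
  have "exp (left_mass (\<lambda>x. 1)) * surv_prob = 1"
    using integral_pw_first_alive[OF weight_one] by (simp add: pw_def P.prob_space)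
  then show ?thesis by (simp add: exp_minus field_simps)
qed

text \<open>No site lies to the left of point 0, so only \<open>dinf\<close> can delete it.\<close>

lemma measure_alive_0: "measure S {\<omega> \<in> space S. alive 0 \<omega>} = exp (- Re (left_mass (\<lambda>x. 1)))"
proof -
  have "complex_of_real (measure S {\<omega> \<in> space S. alive 0 \<omega>}) = surv_prob"
    by (subst measure_eq_integral) (auto simp: alive_def intro!: LINT_cong)
  then have eq: "complex_of_real (measure S {\<omega> \<in> space S. alive 0 \<omega>}) = exp (- left_mass (\<lambda>x. 1))"
    by (simp only: surv_prob)
  define r where "r = (\<integral>x. (if T x < \<infinity> \<and> c x then 1 else 0 :: real) \<partial>P)"
  have r: "left_mass (\<lambda>x. 1) = complex_of_real r"
    unfolding mass_def r_def integral_complex_of_real[symmetric]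
    by (rule LINT_cong) auto
  show ?thesis
    using eq unfolding r of_real_minus[symmetric] exp_of_real Re_complex_of_real of_real_eq_iff .
qed

theorem integral_pw_first_alive_exp:
  assumes w: "weight w"
  shows "(\<integral>\<omega>. pw w (first_alive \<omega>) \<omega> \<partial>S) = exp (left_mass w - left_mass (\<lambda>x. 1))"
  unfolding integral_pw_first_alive[OF w] surv_prob by (simp add: exp_add[symmetric])

text \<open>Three independent blocks: the sites before the first survivor, those of the gap, those
  after it. The first block sums to \<open>exp (left_mass (\<lambda>x. 1))\<close> and the last
  contributes \<open>surv_prob\<close>; they cancel, so the coins leave no trace. The middle block
  sums to the series of \<open>integral_seg\<close>.\<close>

theorem integral_pw_gap:
  assumes w: "weight w"
  shows "(\<integral>\<omega>. pw w (gap_length \<omega>) (shift (first_alive \<omega>) \<omega>) \<partial>S) =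
    1 - (1 - (\<integral>x. w x \<partial>P)) * exp (mass w \<infinity>)"
proof -
  note [measurable] = pw_measurable[OF w]
  define G where "G = (\<integral>x. w x \<partial>P)"
  define H where "H = mass w \<infinity>"
  define V where "V = 1 - (1 - G) * exp H"
  define g where "g m = (\<integral>\<omega>. (if seg m \<omega> then pw w m \<omega> else 0) \<partial>S)" for m
  have "(\<lambda>m. g (Suc m)) sums (G * exp H - (exp H - 1))"
  proof -
    have "(\<lambda>m. H ^ Suc m / fact (Suc m)) sums (exp H - 1)"
      using sums_Suc_iff[of "\<lambda>m. H ^ m / fact m" "exp H - 1"] exp_sums[of H] by simp
    then have "(\<lambda>m. G * (H ^ m / fact m) - H ^ Suc m / fact (Suc m)) sums (G * exp H - (exp H - 1))"
      by (intro sums_diff sums_mult exp_sums)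
    then show ?thesis unfolding g_def integral_seg[OF w] G_def H_def by simp
  qed
  then have "(\<lambda>m. g (Suc m)) sums (V - (if 0 = (0::nat) then 0 else g 0))"
    by (simp add: V_def algebra_simps)
  then have g_sums: "(\<lambda>m. if m = 0 then 0 else g m) sums V"
    using sums_Suc_iff[of "\<lambda>m. if m = 0 then 0 else g m" V] by simp
  let ?f = "\<lambda>\<omega>. pw w (gap_length \<omega>) (shift (first_alive \<omega>) \<omega>)"
  have [measurable]: "(\<lambda>\<omega>. pw w (gap_length \<omega>) (shift k \<omega>)) \<in> borel_measurable S" for k
    by (rule measurable_compose_countable'[where I = UNIV and g = gap_length and f = "\<lambda>m \<omega>. pw w m (shift k \<omega>)"]) auto
  have [measurable]: "?f \<in> borel_measurable S"
    by (rule measurable_compose_countable'[where I = UNIV and g = first_alive and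
      f = "\<lambda>k \<omega>. pw w (gap_length \<omega>) (shift k \<omega>)"]) auto
  have f_bound: "norm (?f \<omega>) \<le> 1" if "\<omega> \<in> space S" for \<omega>
    using pw_bound[OF w shift_in_space[OF that]] .
  have summand: "(\<integral>\<omega>. (if gap_length \<omega> = m then (if first_alive \<omega> = k then ?f \<omega> else 0) else 0) \<partial>S) =
      left_mass (\<lambda>x. 1) ^ k / fact k * ((if m = 0 then 0 else g m) * surv_prob)" for k m
  proof (cases "m = 0")
    case True
    have "AE \<omega> in S. gap_length \<omega> \<noteq> 0"
      using infinitely_many
    proof eventually_elim
      case (elim \<omega>)
      then show ?case using gap_length_eq_iff[of \<omega> 0] by blast
    qed
    then have "(\<integral>\<omega>. (if gap_length \<omega> = m then (if first_alive \<omega> = k then ?f \<omega> else 0) else 0) \<partial>S) = 0"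
      using True by (intro integral_eq_zero_AE) (auto elim: eventually_mono)
    then show ?thesis using True by simp
  next
    case False
    let ?h = "\<lambda>\<omega>. (if seg m \<omega> then pw w m \<omega> else 0) * (if dinf (shift m \<omega>) then 0 else 1)"
    have ae: "AE \<omega> in S. gap_length \<omega> = m \<and> first_alive \<omega> = k \<longleftrightarrow>
        incr k \<omega> \<and> seg m (shift k \<omega>) \<and> \<not> dinf (shift (k + m) \<omega>)"
      using infinitely_many AE_nodesc AE_first_alive[of k]
    proof eventually_elim
      case (elim \<omega>)
      then show ?case
        using gap_length_eq_iff[of \<omega> m] second_alive_iff[of \<omega> k m] False by blast
    qed
    have "(\<integral>\<omega>. (if gap_length \<omega> = m then (if first_alive \<omega> = k then ?f \<omega> else 0) else 0) \<partial>S) =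
        (\<integral>\<omega>. (if incr k \<omega> then 1 else 0) * ?h (shift k \<omega>) \<partial>S)"
    proof (intro integral_cong_AE)
      show "(\<lambda>\<omega>. if gap_length \<omega> = m then if first_alive \<omega> = k then ?f \<omega> else 0 else 0) \<in> borel_measurable S"
        by measurable
      show "(\<lambda>\<omega>. (if incr k \<omega> then 1 else 0) * ?h (shift k \<omega>)) \<in> borel_measurable S"
        by measurable
      show "AE \<omega> in S. (if gap_length \<omega> = m then if first_alive \<omega> = k then ?f \<omega> else 0 else 0) =
          (if incr k \<omega> then 1 else 0) * ?h (shift k \<omega>)"
        using ae by eventually_elim auto
    qed
    also have "\<dots> = (\<integral>\<omega>. (if incr k \<omega> then 1 else 0) \<partial>S) * (\<integral>\<omega>. ?h \<omega> \<partial>S)"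
    proof (rule integral_split)
      show "(if incr k \<omega> then 1 else 0 :: complex) = (if incr k \<omega>' then 1 else 0)"
        if "\<And>i. i < k \<Longrightarrow> \<omega> i = \<omega>' i" for \<omega> \<omega>'
        using incr_cong[of k \<omega> \<omega>'] that by simp
    qed (use pw_bound[OF w] in auto)
    also have "(\<integral>\<omega>. ?h \<omega> \<partial>S) = g m * surv_prob"
      unfolding g_def
    proof (rule integral_split)
      show "(if seg m \<omega> then pw w m \<omega> else 0) = (if seg m \<omega>' then pw w m \<omega>' else 0)"
        if "\<And>i. i < m \<Longrightarrow> \<omega> i = \<omega>' i" for \<omega> \<omega>'
        using seg_cong[of m \<omega> \<omega>'] pw_cong[of m \<omega> \<omega>'] that by simp
    qed (use pw_bound[OF w] in auto)
    also have "(\<integral>\<omega>. (if incr k \<omega> then 1 else 0) \<partial>S) = left_mass (\<lambda>x. 1) ^ k / fact k"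
      using integral_incr_infinity[OF weight_one, of k] by (simp add: pw_def cong: if_cong)
    finally show ?thesis using False by simp
  qed
  have inner: "(\<integral>\<omega>. (if first_alive \<omega> = k then ?f \<omega> else 0) \<partial>S) =
      left_mass (\<lambda>x. 1) ^ k / fact k * (V * surv_prob)" for k
  proof -
    have "(\<integral>\<omega>. (if first_alive \<omega> = k then ?f \<omega> else 0) \<partial>S) =
      (\<Sum>m. left_mass (\<lambda>x. 1) ^ k / fact k * ((if m = 0 then 0 else g m) * surv_prob))"
      unfolding summand[symmetric] by (rule integral_partition) (use f_bound in auto)
    also have "\<dots> = left_mass (\<lambda>x. 1) ^ k / fact k * (V * surv_prob)"
      by (rule sums_unique[symmetric]) (intro sums_mult sums_mult2 g_sums)
    finally show ?thesis .
  qed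
  have "(\<integral>\<omega>. ?f \<omega> \<partial>S) = (\<Sum>k. left_mass (\<lambda>x. 1) ^ k / fact k * (V * surv_prob))"
    unfolding inner[symmetric] by (rule integral_partition) (use f_bound in auto)
  also have "\<dots> = exp (left_mass (\<lambda>x. 1)) * (V * surv_prob)"
    by (rule sums_unique[symmetric]) (intro sums_mult2 exp_sums)
  also have "\<dots> = V" unfolding surv_prob by (simp add: exp_minus)
  finally show ?thesis unfolding V_def G_def H_def .
qed

end

end

section \<open>Points of a configuration\<close>

lemma space_config_algebra: "space config_algebra = configurations"
  unfolding config_algebra_def by (rule space_measure_of) auto

lemma measurable_card_Int [measurable]:
  assumes "A \<in> sets borel" "bounded A"
  shows "(\<lambda>\<xi>. card (\<xi> \<inter> A)) \<in> config_algebra \<rightarrow>\<^sub>M count_space UNIV"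
proof (rule measurableI)
  fix B :: "nat set"
  have "(\<lambda>\<xi>. card (\<xi> \<inter> A)) -` B \<inter> configurations \<in>
      sigma_sets configurations {(\<lambda>\<xi>. card (\<xi> \<inter> A)) -` B \<inter> configurations | A B. A \<in> sets borel \<and> bounded A}"
    using assms by blast
  then show "(\<lambda>\<xi>. card (\<xi> \<inter> A)) -` B \<inter> space config_algebra \<in> sets config_algebra"
    unfolding space_config_algebra unfolding config_algebra_def by (subst sets_measure_of) auto
qed simp

text \<open>The \<open>i\<close>-th point of a configuration that is bounded below, counted from \<open>0\<close>. The cut-off
  \<open>- n\<close> keeps the counted sets bounded.\<close>

definition nth_point :: "nat \<Rightarrow> real set \<Rightarrow> real" where
  "nth_point i \<xi> = real_of_ereal
     (INF q\<in>\<rat>. if \<exists>n::nat. Suc i \<le> card (\<xi> \<inter> {- real n..q}) then ereal q else \<infinity>)"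

lemma nth_point_measurable [measurable]: "nth_point i \<in> borel_measurable config_algebra"
proof -
  have [measurable]: "(\<lambda>\<xi>. card (\<xi> \<inter> {- real n..q})) \<in> config_algebra \<rightarrow>\<^sub>M count_space UNIV" for n q
    by (rule measurable_card_Int) auto
  show ?thesis unfolding nth_point_def
    by (intro borel_measurable_real_of_ereal borel_measurable_INF) (auto simp: countable_rat)
qed

lemma nth_point_eqI:
  assumes "\<And>q. (\<exists>n::nat. Suc i \<le> card (\<xi> \<inter> {- real n..q})) \<longleftrightarrow> a \<le> q"
  shows "nth_point i \<xi> = a"
proof -
  have "(INF q\<in>\<rat>. if a \<le> q then ereal q else \<infinity>) = ereal a"
  proof (rule INF_eqI)
    fix y assume y: "\<And>q. q \<in> \<rat> \<Longrightarrow> y \<le> (if a \<le> q then ereal q else \<infinity>)"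
    show "y \<le> ereal a"
    proof (rule ccontr)
      assume "\<not> y \<le> ereal a"
      then have "ereal a < y" by simp
      then obtain r where r: "ereal a < ereal r" "ereal r < y"
        using ereal_dense2 by blast
      then obtain q where "q \<in> \<rat>" "a < q" "q < r" using Rats_dense_in_real[of a r] by auto
      then have "y \<le> ereal q" using y[of q] by simp
      then show False using r(2) \<open>q < r\<close> by (meson ereal_less_eq(3) leD less_imp_le order_trans)
    qed
  qed auto
  then show ?thesis unfolding nth_point_def assms by simp
qed

section \<open>Configurations enumerated by separated sequences\<close>

definition spaced :: "real \<Rightarrow> (nat \<Rightarrow> real) \<Rightarrow> bool" where
  "spaced d x \<longleftrightarrow> 0 < d \<and> (\<forall>n. x n + d \<le> x (Suc n))"

lemma spaced_le:
  assumes "spaced d x"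
  shows "x 0 + real n * d \<le> x n"
proof (induction n)
  case (Suc n)
  moreover have "x n + d \<le> x (Suc n)" using assms unfolding spaced_def by blast
  ultimately show ?case by (simp add: algebra_simps)
qed simp

lemma spaced_strict_mono:
  assumes "spaced d x"
  shows "strict_mono x"
proof (rule strict_monoI_Suc)
  fix n
  have "0 < d" "x n + d \<le> x (Suc n)" using assms unfolding spaced_def by blast+
  then show "x n < x (Suc n)" by linarith
qed

lemma spaced_finite:
  assumes "spaced d x"
  shows "finite (range x \<inter> {..b})" "finite {n. x n \<le> b}"
proof -
  have "0 < d" using assms by (simp add: spaced_def)
  obtain N where N: "b - x 0 < real N * d" using reals_Archimedean3[OF \<open>0 < d\<close>] by blast
  have "n < N" if "x n \<le> b" for n
  proof (rule ccontr)
    assume "\<not> n < N"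
    then have "real N * d \<le> real n * d" using \<open>0 < d\<close> by simp
    then show False using spaced_le[OF assms, of n] that N by simp
  qed
  then have sub: "{n. x n \<le> b} \<subseteq> {..<N}" by auto
  then show fin: "finite {n. x n \<le> b}" using finite_subset by blast
  have "range x \<inter> {..b} = x ` {n. x n \<le> b}" by auto
  then show "finite (range x \<inter> {..b})" using fin by simp
qed

lemma spaced_configuration:
  assumes "spaced d x"
  shows "range x \<in> configurations"
  unfolding configurations_def
proof safe
  fix A :: "real set" assume "bounded A"
  then obtain b where "\<forall>x\<in>A. \<bar>x\<bar> \<le> b" unfolding bounded_real by blast
  then have "A \<subseteq> {..b}" by force
  then have "range x \<inter> A \<subseteq> range x \<inter> {..b}" by blast
  then show "finite (range x \<inter> A)" using spaced_finite(1)[OF assms] finite_subset by blast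
qed

lemma nth_point_range:
  assumes "spaced d x"
  shows "nth_point i (range x) = x i"
proof (rule nth_point_eqI)
  fix q
  have mono: "strict_mono x" by (rule spaced_strict_mono[OF assms])
  then have inj: "inj x" by (simp add: strict_mono_imp_inj_on)
  show "(\<exists>n::nat. Suc i \<le> card (range x \<inter> {- real n..q})) \<longleftrightarrow> x i \<le> q"
  proof
    assume "\<exists>n::nat. Suc i \<le> card (range x \<inter> {- real n..q})"
    then obtain n :: nat where n: "Suc i \<le> card (range x \<inter> {- real n..q})" by blast
    show "x i \<le> q"
    proof (rule ccontr)
      assume "\<not> x i \<le> q"
      then have "x j \<le> q \<Longrightarrow> j < i" for j
        using strict_mono_less[OF mono, of j i] by linarith
      then have "range x \<inter> {- real n..q} \<subseteq> x ` {..<i}" by auto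
      then have "card (range x \<inter> {- real n..q}) \<le> card (x ` {..<i})" by (intro card_mono) auto
      also have "\<dots> \<le> i" using card_image_le[of "{..<i}" x] by simp
      finally show False using n by simp
    qed
  next
    assume le: "x i \<le> q"
    obtain n :: nat where n: "- x 0 \<le> real n" using real_arch_simple by blast
    have "- real n \<le> x j" for j
      using n strict_mono_less_eq[OF mono, of 0 j] by simp
    moreover have "x j \<le> q" if "j \<le> i" for j
      using that le strict_mono_less_eq[OF mono, of j i] by simp
    ultimately have sub: "x ` {..i} \<subseteq> range x \<inter> {- real n..q}" by auto
    have "range x \<inter> {- real n..q} \<subseteq> range x \<inter> {..q}" by auto
    then have "finite (range x \<inter> {- real n..q})" using spaced_finite(1)[OF assms] finite_subset by blast
    then have "card (x ` {..i}) \<le> card (range x \<inter> {- real n..q})" using sub by (intro card_mono)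
    then show "\<exists>n::nat. Suc i \<le> card (range x \<inter> {- real n..q})"
      using card_image[OF inj_on_subset[OF inj, of "{..i}"]] by auto
  qed
qed

text \<open>For configurations of which only a leftmost point is known, such as those at finite
  times.\<close>

lemma nth_point_0_minimum:
  assumes "\<xi> \<in> configurations" "m \<in> \<xi>" "\<And>x. x \<in> \<xi> \<Longrightarrow> m \<le> x"
  shows "nth_point 0 \<xi> = m"
proof (rule nth_point_eqI)
  fix q
  have fin: "finite (\<xi> \<inter> {- real n..q})" for n
    using assms(1) unfolding configurations_def by simp
  show "(\<exists>n::nat. Suc 0 \<le> card (\<xi> \<inter> {- real n..q})) \<longleftrightarrow> m \<le> q"
  proof
    assume "\<exists>n::nat. Suc 0 \<le> card (\<xi> \<inter> {- real n..q})"
    then obtain n :: nat where n: "Suc 0 \<le> card (\<xi> \<inter> {- real n..q})" by blast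
    have "\<xi> \<inter> {- real n..q} \<noteq> {}"
    proof
      assume empty: "\<xi> \<inter> {- real n..q} = {}"
      show False using n unfolding empty by simp
    qed
    then obtain x where "x \<in> \<xi>" "x \<le> q" by auto
    then show "m \<le> q" using assms(3)[of x] by simp
  next
    assume "m \<le> q"
    obtain n :: nat where "- m \<le> real n" using real_arch_simple by blast
    then have "m \<in> \<xi> \<inter> {- real n..q}" using \<open>m \<le> q\<close> assms(2) by auto
    then have "card (\<xi> \<inter> {- real n..q}) \<noteq> 0" using fin by auto
    then show "\<exists>n::nat. Suc 0 \<le> card (\<xi> \<inter> {- real n..q})" by (metis Suc_leI neq0_conv)
  qed
qed

text \<open>A measurable condition which forces a configuration to be \<open>range (\<lambda>n. nth_point n \<xi>)\<close>.\<close>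

definition enumerated :: "real \<Rightarrow> real set \<Rightarrow> bool" where
  "enumerated d \<xi> \<longleftrightarrow> (\<forall>n. nth_point n \<xi> + d \<le> nth_point (Suc n) \<xi>) \<and>
     (\<forall>a b :: rat. card (\<xi> \<inter> {of_rat a..of_rat b}) = 0 \<longleftrightarrow> (\<forall>k. nth_point k \<xi> \<notin> {of_rat a..of_rat b}))"

lemma enumerated_measurable [measurable]: "Measurable.pred config_algebra (enumerated d)"
proof -
  have [measurable]: "(\<lambda>\<xi>. card (\<xi> \<inter> {a..b})) \<in> config_algebra \<rightarrow>\<^sub>M count_space UNIV" for a b :: real
    by (rule measurable_card_Int) auto
  have [measurable]: "Measurable.pred config_algebra (\<lambda>\<xi>. nth_point k \<xi> \<notin> {a..b})" for a b k
    by measurable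
  show ?thesis unfolding enumerated_def by measurable
qed

lemma configuration_closed:
  assumes "\<xi> \<in> configurations" "x \<notin> \<xi>"
  obtains e where "0 < e" "\<And>y. y \<in> \<xi> \<Longrightarrow> e \<le> dist x y"
proof -
  have fin: "finite (\<xi> \<inter> cball x 1)" using assms(1) unfolding configurations_def by auto
  then obtain e where e: "0 < e" "\<And>y. y \<in> \<xi> \<inter> cball x 1 \<Longrightarrow> y \<noteq> x \<Longrightarrow> e \<le> dist x y"
    using finite_set_avoid[OF fin, of x] by metis
  show ?thesis
  proof (rule that[of "min e 1"])
    fix y assume y: "y \<in> \<xi>"
    show "min e 1 \<le> dist x y"
    proof (cases "dist x y \<le> 1")
      case True
      have "y \<noteq> x" using y assms(2) by blast
      then have "e \<le> dist x y" using e(2)[of y] y True by simp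
      then show ?thesis by simp
    qed simp
  qed (use e in auto)
qed

text \<open>A point outside a locally finite set has a rational interval around it that misses the
  set, so countably many counts determine a configuration.\<close>

lemma configurations_subsetI:
  assumes "\<xi> \<in> configurations" "\<eta> \<in> configurations"
    and "\<And>a b :: rat. \<eta> \<inter> {of_rat a..of_rat b} = {} \<Longrightarrow> \<xi> \<inter> {of_rat a..of_rat b} = {}"
  shows "\<xi> \<subseteq> \<eta>"
proof
  fix x assume "x \<in> \<xi>"
  show "x \<in> \<eta>"
  proof (rule ccontr)
    assume "x \<notin> \<eta>"
    then obtain e where e: "0 < e" "\<And>y. y \<in> \<eta> \<Longrightarrow> e \<le> dist x y"
      using configuration_closed[OF assms(2)] by blast
    obtain a where a: "x - e < real_of_rat a" "real_of_rat a < x"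
      using of_rat_dense[of "x - e" x] e by auto
    obtain b where b: "x < real_of_rat b" "real_of_rat b < x + e"
      using of_rat_dense[of x "x + e"] e by auto
    have "y \<notin> {of_rat a..of_rat b}" if "y \<in> \<eta>" for y
      using e(2)[OF that] a b by (auto simp: dist_real_def)
    then have "\<eta> \<inter> {of_rat a..of_rat b} = {}" by blast
    then have "\<xi> \<inter> {of_rat a..of_rat b} = {}" by (rule assms(3))
    moreover have "x \<in> \<xi> \<inter> {of_rat a..of_rat b}" using a b \<open>x \<in> \<xi>\<close> by simp
    ultimately show False by blast
  qed
qed

lemma enumerated_eq_range:
  assumes "0 < d" "\<xi> \<in> configurations" "enumerated d \<xi>"
  shows "\<xi> = range (\<lambda>n. nth_point n \<xi>)"
proof -
  have conf: "range (\<lambda>n. nth_point n \<xi>) \<in> configurations"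
    using assms(1,3) by (intro spaced_configuration[of d]) (auto simp: enumerated_def spaced_def)
  have iff: "\<xi> \<inter> {of_rat a..of_rat b} = {} \<longleftrightarrow> range (\<lambda>n. nth_point n \<xi>) \<inter> {of_rat a..of_rat b} = {}"
    for a b :: rat
  proof -
    have "finite (\<xi> \<inter> {of_rat a..of_rat b})" using assms(2) unfolding configurations_def by simp
    then have "\<xi> \<inter> {of_rat a..of_rat b} = {} \<longleftrightarrow> card (\<xi> \<inter> {of_rat a..of_rat b}) = 0" by simp
    also have "\<dots> \<longleftrightarrow> (\<forall>k. nth_point k \<xi> \<notin> {of_rat a..of_rat b})"
      using assms(3) unfolding enumerated_def by blast
    finally show ?thesis by blast
  qed
  show ?thesis
  proof
    show "\<xi> \<subseteq> range (\<lambda>n. nth_point n \<xi>)"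
      by (rule configurations_subsetI[OF assms(2) conf]) (simp only: iff)
    show "range (\<lambda>n. nth_point n \<xi>) \<subseteq> \<xi>"
      by (rule configurations_subsetI[OF conf assms(2)]) (simp only: iff)
  qed
qed

lemma spaced_enumerated:
  assumes "spaced d x"
  shows "enumerated d (range x)"
  unfolding enumerated_def nth_point_range[OF assms]
proof (intro conjI ballI allI)
  show "x n + d \<le> x (Suc n)" for n using assms unfolding spaced_def by blast
  fix a b :: rat
  let ?I = "{real_of_rat a..of_rat b}"
  have "range x \<inter> ?I \<subseteq> range x \<inter> {..of_rat b}" by auto
  then have "finite (range x \<inter> ?I)" using spaced_finite(1)[OF assms] finite_subset by blast
  then have "card (range x \<inter> ?I) = 0 \<longleftrightarrow> range x \<inter> ?I = {}" by simp
  then show "card (range x \<inter> ?I) = 0 \<longleftrightarrow> (\<forall>k. x k \<notin> ?I)" by blast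
qed

section \<open>Renewal point processes\<close>

lemma (in prob_space) distr_pair_snd:
  assumes "sigma_finite_measure N"
  shows "distr (M \<Otimes>\<^sub>M N) N snd = N"
proof (rule measure_eqI)
  interpret N: sigma_finite_measure N by fact
  fix A assume "A \<in> sets (distr (M \<Otimes>\<^sub>M N) N snd)"
  then have A: "A \<in> sets N" by simp
  then have "snd -` A \<inter> space (M \<Otimes>\<^sub>M N) = space M \<times> A"
    using sets.sets_into_space[OF A] by (auto simp: space_pair_measure)
  then show "emeasure (distr (M \<Otimes>\<^sub>M N) N snd) A = emeasure N A"
    using A N.emeasure_pair_measure_Times[of "space M" M A] emeasure_space_1
    by (simp add: emeasure_distr)
qed simp

text \<open>The maximum changes nothing on separated configurations; it only forces values in the
  space of the gap law, so that the map is measurable into it everywhere.\<close>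

definition nth_gap :: "real \<Rightarrow> nat \<Rightarrow> real set \<Rightarrow> real" where
  "nth_gap d k \<xi> = max d (nth_point (Suc k) \<xi> - nth_point k \<xi>)"

lemma nth_gap_measurable [measurable]:
  "nth_gap d k \<in> config_algebra \<rightarrow>\<^sub>M restrict_space borel {d..}"
proof (rule measurable_restrict_space2)
  have "(\<lambda>\<xi>. max d (nth_point (Suc k) \<xi> - nth_point k \<xi>)) \<in> borel_measurable config_algebra"
    by measurable
  then show "nth_gap d k \<in> borel_measurable config_algebra"
    unfolding nth_gap_def[abs_def] .
qed (auto simp: nth_gap_def)

locale renewal =
  fixes d :: real and \<nu> \<mu> :: "real measure"
  assumes d_pos: "0 < d"
    and nu: "\<nu> \<in> space (prob_algebra borel)"
    and mu: "\<mu> \<in> space (prob_algebra (restrict_space borel {d..}))"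
begin

lemma sets_nu [measurable_cong, simp]: "sets \<nu> = sets borel"
  and sets_mu [measurable_cong, simp]: "sets \<mu> = sets (restrict_space borel {d..})"
  and prob_nu: "prob_space \<nu>" and prob_mu: "prob_space \<mu>"
  using nu mu by (auto simp: space_prob_algebra)

lemma space_nu [simp]: "space \<nu> = UNIV" and space_mu [simp]: "space \<mu> = {d..}"
  using sets_eq_imp_space_eq[OF sets_nu] sets_eq_imp_space_eq[OF sets_mu] by (auto simp: space_restrict_space)

sublocale nu: prob_space \<nu> by (rule prob_nu)

sublocale mu: prob_space \<mu> by (rule prob_mu)

sublocale gaps: sequence_space \<mu> by unfold_locales

abbreviation skeleton :: "(real \<times> (nat \<Rightarrow> real)) measure" where
  "skeleton \<equiv> \<nu> \<Otimes>\<^sub>M (\<Pi>\<^sub>M k\<in>(UNIV::nat set). \<mu>)"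

definition point :: "real \<times> (nat \<Rightarrow> real) \<Rightarrow> nat \<Rightarrow> real" where
  "point p n = fst p + (\<Sum>k<n. snd p k)"

lemma point_spaced: "p \<in> space skeleton \<Longrightarrow> spaced d (point p)"
  using d_pos by (auto simp: spaced_def point_def space_pair_measure space_PiM PiE_iff)

lemma point_measurable [measurable]: "(\<lambda>p. point p n) \<in> borel_measurable skeleton"
proof -
  have [measurable]: "(\<lambda>x. x) \<in> borel_measurable \<mu>"
    using measurable_restrict_space1[of "\<lambda>x. x" borel borel "{d..}"] by (simp cong: measurable_cong_sets)
  have [measurable]: "(\<lambda>p. snd p k) \<in> borel_measurable skeleton" for k
    using measurable_compose[OF _ \<open>(\<lambda>x. x) \<in> borel_measurable \<mu>\<close>, of "\<lambda>p. snd p k" skeleton] by measurable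
  have [measurable]: "fst \<in> borel_measurable skeleton"
    using measurable_fst[of \<nu>] by (simp cong: measurable_cong_sets)
  show ?thesis unfolding point_def by measurable
qed

lemma range_point_measurable: "(\<lambda>p. range (point p)) \<in> skeleton \<rightarrow>\<^sub>M config_algebra"
  unfolding config_algebra_def
proof (rule measurable_measure_of)
  show "(\<lambda>p. range (point p)) \<in> space skeleton \<rightarrow> configurations"
    using spaced_configuration[OF point_spaced] by auto
  fix Y assume "Y \<in> {(\<lambda>\<xi>. card (\<xi> \<inter> A)) -` B \<inter> configurations | A B. A \<in> sets borel \<and> bounded A}"
  then obtain A B where Y: "Y = (\<lambda>\<xi>. card (\<xi> \<inter> A)) -` B \<inter> configurations" and [measurable]: "A \<in> sets borel"
    by blast
  \<comment> \<open>The enumeration is injective, so points in \<open>A\<close> may be counted by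
    their indices, each a measurable coordinate.\<close>
  have card: "card (range (point p) \<inter> A) = card {n. point p n \<in> A}" if "p \<in> space skeleton" for p
  proof -
    have "inj (point p)"
      using spaced_strict_mono[OF point_spaced[OF that]] by (simp add: strict_mono_imp_inj_on)
    moreover have "range (point p) \<inter> A = point p ` {n. point p n \<in> A}" by auto
    ultimately show ?thesis by (metis card_image inj_on_subset subset_UNIV)
  qed
  have "(\<lambda>p. range (point p)) -` Y \<inter> space skeleton = {p \<in> space skeleton. card {n. point p n \<in> A} \<in> B}"
    using spaced_configuration[OF point_spaced] by (auto simp: Y card)
  also have "\<dots> \<in> sets skeleton"
  proof -
    have "(\<lambda>p. card {n. point p n \<in> A}) \<in> skeleton \<rightarrow>\<^sub>M count_space UNIV"
      by measurable
    from measurable_sets[OF this, of B] show ?thesis by (simp add: vimage_def Int_def conj_commute)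
  qed
  finally show "(\<lambda>p. range (point p)) -` Y \<inter> space skeleton \<in> sets skeleton" .
qed auto

lemma Ren_eq: "Ren \<nu> \<mu> = distr skeleton config_algebra (\<lambda>p. range (point p))"
  unfolding Ren_def by (rule distr_cong) (auto simp: point_def)

lemma prob_skeleton: "prob_space skeleton"
proof -
  interpret pair_prob_space \<nu> "\<Pi>\<^sub>M k\<in>(UNIV::nat set). \<mu>" ..
  show ?thesis by unfold_locales
qed

lemma prob_Ren: "prob_space (Ren \<nu> \<mu>)"
  unfolding Ren_eq by (intro prob_space.prob_space_distr prob_skeleton range_point_measurable)

lemma nth_point_point: "p \<in> space skeleton \<Longrightarrow> nth_point n (range (point p)) = point p n"
  by (rule nth_point_range[OF point_spaced])

lemma nth_gap_point:
  assumes "p \<in> space skeleton"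
  shows "nth_gap d n (range (point p)) = snd p n"
  using assms unfolding nth_gap_def nth_point_point[OF assms]
  by (auto simp: point_def space_pair_measure space_PiM PiE_iff)

lemma AE_enumerated: "AE \<xi> in Ren \<nu> \<mu>. enumerated d \<xi>"
  unfolding Ren_eq
  by (subst AE_distr_iff) (auto simp: range_point_measurable intro!: AE_I2 spaced_enumerated[OF point_spaced])

text \<open>Together with the next lemma this recovers both parameters from a renewal law, which
  makes them unique.\<close>

lemma distr_Ren_nth_point_0: "distr (Ren \<nu> \<mu>) borel (nth_point 0) = \<nu>"
proof -
  have "distr (Ren \<nu> \<mu>) borel (nth_point 0) = distr skeleton borel (\<lambda>p. nth_point 0 (range (point p)))"
    unfolding Ren_eq by (subst distr_distr) (auto simp: range_point_measurable comp_def)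
  also have "\<dots> = distr skeleton \<nu> fst"
    by (rule distr_cong) (auto simp: nth_point_point, simp add: point_def)
  also have "\<dots> = \<nu>" by (rule gaps.P.distr_pair_fst)
  finally show ?thesis .
qed

lemma distr_Ren_nth_gap_0: "distr (Ren \<nu> \<mu>) (restrict_space borel {d..}) (nth_gap d 0) = \<mu>"
proof -
  interpret pair_prob_space \<nu> "\<Pi>\<^sub>M k\<in>(UNIV::nat set). \<mu>" ..
  have "distr (Ren \<nu> \<mu>) (restrict_space borel {d..}) (nth_gap d 0) =
      distr skeleton (restrict_space borel {d..}) (\<lambda>p. nth_gap d 0 (range (point p)))"
    unfolding Ren_eq by (subst distr_distr) (auto simp: range_point_measurable comp_def)
  also have "\<dots> = distr skeleton \<mu> (\<lambda>p. snd p 0)"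
    by (rule distr_cong) (auto simp: nth_gap_point)
  also have "\<dots> = distr (distr skeleton (\<Pi>\<^sub>M k\<in>(UNIV::nat set). \<mu>) snd) \<mu> (\<lambda>g. g 0)"
    by (subst distr_distr) (auto simp: comp_def)
  also have "distr skeleton (\<Pi>\<^sub>M k\<in>(UNIV::nat set). \<mu>) snd = (\<Pi>\<^sub>M k\<in>(UNIV::nat set). \<mu>)"
    by (rule nu.distr_pair_snd) unfold_locales
  also have "distr (\<Pi>\<^sub>M k\<in>(UNIV::nat set). \<mu>) \<mu> (\<lambda>g. g 0) = \<mu>" by (rule gaps.PiM_component) simp
  finally show ?thesis .
qed

end

section \<open>The marked sites of the initial configuration\<close>

lemma (in sequence_space) nn_integral_prod_PiM:
  assumes "finite J" and f [measurable]: "\<And>j. f j \<in> borel_measurable M"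
  shows "(\<integral>\<^sup>+\<omega>. (\<Prod>j\<in>J. f j (\<omega> j)) \<partial>S) = (\<Prod>j\<in>J. (\<integral>\<^sup>+x. f j x \<partial>M))"
proof -
  have "(\<integral>\<^sup>+\<omega>. (\<Prod>j\<in>J. f j (\<omega> j)) \<partial>S) = (\<integral>\<^sup>+\<omega>. (\<Prod>j\<in>J. f j (restrict \<omega> J j)) \<partial>S)"
    by (intro nn_integral_cong prod.cong) auto
  also have "\<dots> = (\<integral>\<^sup>+\<omega>. (\<Prod>j\<in>J. f j (\<omega> j)) \<partial>distr S (PiM J (\<lambda>_. M)) (\<lambda>\<omega>. restrict \<omega> J))"
    by (rule nn_integral_distr[symmetric]) measurable
  also have "distr S (PiM J (\<lambda>_. M)) (\<lambda>\<omega>. restrict \<omega> J) = PiM J (\<lambda>_. M)"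
    using \<open>finite J\<close> by (rule distr_PiM_restrict_finite) simp
  finally show ?thesis
    using product_nn_integral_prod[OF \<open>finite J\<close>, of f] f by simp
qed

text \<open>It suffices to test cylinders; with the first sequence fixed, the sections of a cylinder
  have a product measure, and the integral of this product factorises again.\<close>

lemma distr_zip_PiM:
  assumes "prob_space A" "prob_space B"
  shows "distr ((\<Pi>\<^sub>M k\<in>(UNIV::nat set). A) \<Otimes>\<^sub>M (\<Pi>\<^sub>M k\<in>(UNIV::nat set). B)) (\<Pi>\<^sub>M k\<in>(UNIV::nat set). A \<Otimes>\<^sub>M B)
    (\<lambda>(a, b) k. (a k, b k)) = (\<Pi>\<^sub>M k\<in>(UNIV::nat set). A \<Otimes>\<^sub>M B)"
    (is "distr (?SA \<Otimes>\<^sub>M ?SB) ?SAB ?zip = _")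
proof -
  interpret A: prob_space A by fact
  interpret B: prob_space B by fact
  interpret AB: pair_prob_space A B ..
  interpret SA: sequence_space A by unfold_locales
  interpret SB: sequence_space B by unfold_locales
  interpret SAB: sequence_space "A \<Otimes>\<^sub>M B" by unfold_locales
  have zip [measurable]: "?zip \<in> ?SA \<Otimes>\<^sub>M ?SB \<rightarrow>\<^sub>M ?SAB"
    unfolding split_beta' by (rule measurable_abs_UNIV) measurable
  show ?thesis
  proof (rule SAB.PiM_eq)
    fix J and F :: "nat \<Rightarrow> ('a \<times> 'b) set"
    assume J: "finite J" and F: "\<And>j. j \<in> J \<Longrightarrow> F j \<in> sets (A \<Otimes>\<^sub>M B)"
    let ?X = "prod_emb UNIV (\<lambda>_. A \<Otimes>\<^sub>M B) J (\<Pi>\<^sub>E j\<in>J. F j)"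
    have X: "?X \<in> sets ?SAB" using J F by (intro sets_PiM_I) auto
    define F' where "F' j = (if j \<in> J then F j else {})" for j
    have F' [measurable]: "F' j \<in> sets (A \<Otimes>\<^sub>M B)" for j using F by (auto simp: F'_def)
    have "emeasure (distr (?SA \<Otimes>\<^sub>M ?SB) ?SAB ?zip) ?X = emeasure (?SA \<Otimes>\<^sub>M ?SB) (?zip -` ?X \<inter> space (?SA \<Otimes>\<^sub>M ?SB))"
      using X by (simp add: emeasure_distr)
    also have "\<dots> = (\<integral>\<^sup>+a. emeasure ?SB (Pair a -` (?zip -` ?X \<inter> space (?SA \<Otimes>\<^sub>M ?SB))) \<partial>?SA)"
      using X by (intro SB.P.emeasure_pair_measure_alt) simp
    also have "\<dots> = (\<integral>\<^sup>+a. (\<Prod>j\<in>J. emeasure B (Pair (a j) -` F' j)) \<partial>?SA)"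
    proof (rule nn_integral_cong)
      fix a assume a: "a \<in> space ?SA"
      have "Pair a -` (?zip -` ?X \<inter> space (?SA \<Otimes>\<^sub>M ?SB)) = {b \<in> space ?SB. \<forall>j\<in>J. b j \<in> Pair (a j) -` F' j}"
        using a by (auto simp: prod_emb_def space_pair_measure space_PiM PiE_iff F'_def)
      then show "emeasure ?SB (Pair a -` (?zip -` ?X \<inter> space (?SA \<Otimes>\<^sub>M ?SB))) = (\<Prod>j\<in>J. emeasure B (Pair (a j) -` F' j))"
        using SB.emeasure_PiM_Collect[OF subset_UNIV J sets_Pair1[OF F'], of a] by simp
    qed
    also have "\<dots> = (\<Prod>j\<in>J. (\<integral>\<^sup>+x. emeasure B (Pair x -` F' j) \<partial>A))"
      using J by (intro SA.nn_integral_prod_PiM) (auto intro!: B.measurable_emeasure_Pair)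
    also have "\<dots> = (\<Prod>j\<in>J. emeasure (A \<Otimes>\<^sub>M B) (F j))"
      by (intro prod.cong) (simp_all add: B.emeasure_pair_measure_alt F F'_def)
    finally show "emeasure (distr (?SA \<Otimes>\<^sub>M ?SB) ?SAB ?zip) ?X = (\<Prod>j\<in>J. emeasure (A \<Otimes>\<^sub>M B) (F j))" .
  qed simp
qed

definition mark_measure :: "(real \<times> real) measure" where
  "mark_measure = density lborel (\<lambda>x. ennreal (exponential_density 1 x)) \<Otimes>\<^sub>M uniform_measure lborel {0..1}"

lemma prob_uniform: "prob_space (uniform_measure lborel {0..1::real})"
  by (rule prob_space_uniform_measure) auto

lemma prob_mark_measure: "prob_space mark_measure"
proof -
  interpret E: prob_space "density lborel (\<lambda>x. ennreal (exponential_density 1 x))"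
    using prob_space_exponential_density[of 1] by simp
  interpret U: prob_space "uniform_measure lborel {0..1::real}" by (rule prob_uniform)
  interpret pair_prob_space "density lborel (\<lambda>x. ennreal (exponential_density 1 x))" "uniform_measure lborel {0..1::real}" ..
  show ?thesis unfolding mark_measure_def by unfold_locales
qed

lemma mark_law_eq: "mark_law = (\<Pi>\<^sub>M k\<in>(UNIV::int set). mark_measure)"
  by (simp add: mark_law_def mark_measure_def)

lemma sets_mark_measure [measurable_cong]: "sets mark_measure = sets (borel \<Otimes>\<^sub>M borel)"
  unfolding mark_measure_def by (rule sets_pair_measure_cong) auto

lemma prob_mark_law: "prob_space mark_law"
  unfolding mark_law_eq by (rule prob_space_PiM) (rule prob_mark_measure)

lemma distr_mark_law_shift:
  "distr mark_law (\<Pi>\<^sub>M k\<in>(UNIV::nat set). mark_measure) (\<lambda>z k. z (i + int k)) = (\<Pi>\<^sub>M k\<in>(UNIV::nat set). mark_measure)"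
  using distr_PiM_reindex[of UNIV "\<lambda>_::int. mark_measure" "\<lambda>k. i + int k" UNIV] prob_mark_measure
  by (simp add: mark_law_eq inj_on_def restrict_UNIV)

text \<open>The index which \<open>point_index\<close> gives to the leftmost point: the largest of
  the nonpositive points has index 0, and without such points the numbering starts at 1.\<close>

definition first_index :: "real set \<Rightarrow> int" where
  "first_index \<xi> = 1 - int (card {n. nth_point n \<xi> \<le> 0})"

lemma first_index_measurable [measurable]: "first_index \<in> config_algebra \<rightarrow>\<^sub>M count_space UNIV"
  unfolding first_index_def by measurable

lemma point_index_range:
  assumes "spaced d x"
  shows "point_index (range x) (x k) = first_index (range x) + int k"
proof -
  have mono: "strict_mono x" by (rule spaced_strict_mono[OF assms])
  then have inj: "inj x" by (simp add: strict_mono_imp_inj_on)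
  have le: "x i \<le> x j \<longleftrightarrow> i \<le> j" "x i < x j \<longleftrightarrow> i < j" for i j
    using mono by (simp_all add: strict_mono_less_eq strict_mono_less)
  let ?N = "{n. x n \<le> 0}"
  have fin: "finite ?N" by (rule spaced_finite(2)[OF assms])
  have card_image_x: "card (x ` B) = card B" for B
    by (rule card_image) (rule inj_on_subset[OF inj subset_UNIV])
  show ?thesis
  proof (cases "0 < x k")
    case True
    then have sub: "?N \<subseteq> {..k}" using le by (auto simp: not_le intro: less_imp_le dest: order.strict_trans1[of _ 0])
    have "range x \<inter> {0<..x k} = x ` ({..k} - ?N)" using le by (auto simp: not_le)
    then have "card (range x \<inter> {0<..x k}) = Suc k - card ?N"
      using card_image_x[of "{..k} - ?N"] card_Diff_subset[OF fin sub] by simp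
    moreover have "card ?N \<le> Suc k" using card_mono[OF _ sub] by simp
    ultimately show ?thesis
      using True by (simp add: point_index_def first_index_def nth_point_range[OF assms])
  next
    case False
    then have sub: "{..k} \<subseteq> ?N" using le by (auto simp: not_less intro: order.trans)
    have "range x \<inter> {x k<..0} = x ` (?N - {..k})" using le by (auto simp: not_le)
    then have "card (range x \<inter> {x k<..0}) = card ?N - Suc k"
      using card_image_x[of "?N - {..k}"] card_Diff_subset[OF _ sub] by simp
    moreover have "Suc k \<le> card ?N" using card_mono[OF fin sub] by simp
    ultimately show ?thesis
      using False by (simp add: point_index_def first_index_def nth_point_range[OF assms])
  qed
qed

context renewal
begin

abbreviation site_law :: "(real \<times> (real \<times> real)) measure" where
  "site_law \<equiv> \<mu> \<Otimes>\<^sub>M mark_measure"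

abbreviation sites_law :: "(nat \<Rightarrow> real \<times> (real \<times> real)) measure" where
  "sites_law \<equiv> \<Pi>\<^sub>M k\<in>(UNIV::nat set). site_law"

definition site :: "real set \<Rightarrow> (int \<Rightarrow> real \<times> real) \<Rightarrow> nat \<Rightarrow> real \<times> (real \<times> real)" where
  "site \<xi> z k = (nth_gap d k \<xi>, z (first_index \<xi> + int k))"

lemma site_measurable:
  "(\<lambda>p. (nth_point 0 (fst p), site (fst p) (snd p))) \<in> config_algebra \<Otimes>\<^sub>M mark_law \<rightarrow>\<^sub>M \<nu> \<Otimes>\<^sub>M sites_law"
proof -
  have "(\<lambda>p. site (fst p) (snd p) k) \<in> config_algebra \<Otimes>\<^sub>M mark_law \<rightarrow>\<^sub>M site_law" for k
    unfolding site_def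
  proof (rule measurable_Pair)
    show "(\<lambda>p. nth_gap d k (fst p)) \<in> config_algebra \<Otimes>\<^sub>M mark_law \<rightarrow>\<^sub>M \<mu>"
      by measurable
    show "(\<lambda>p. snd p (first_index (fst p) + int k)) \<in> config_algebra \<Otimes>\<^sub>M mark_law \<rightarrow>\<^sub>M mark_measure"
    \<comment> \<open>The mark is read at a random index, which takes countably many values.\<close>
    proof (rule measurable_compose_countable[where f = "\<lambda>i p. snd p (i + int k)" and g = "\<lambda>p. first_index (fst p)"])
      show "(\<lambda>p. snd p (i + int k)) \<in> config_algebra \<Otimes>\<^sub>M mark_law \<rightarrow>\<^sub>M mark_measure" for i
        unfolding mark_law_eq by measurable
    qed measurable
  qed
  then have "(\<lambda>p. site (fst p) (snd p)) \<in> config_algebra \<Otimes>\<^sub>M mark_law \<rightarrow>\<^sub>M sites_law"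
    by (intro measurable_abs_UNIV)
  then show ?thesis by measurable
qed

text \<open>The index of the first mark depends on the configuration. Given the configuration,
  however, it is a fixed shift of an i.i.d. sequence, which leaves the law of the marks unchanged;
  they can then be zipped with the independent gaps.\<close>

lemma distr_site:
  "distr (Ren \<nu> \<mu> \<Otimes>\<^sub>M mark_law) (\<nu> \<Otimes>\<^sub>M sites_law) (\<lambda>p. (nth_point 0 (fst p), site (fst p) (snd p))) =
    \<nu> \<Otimes>\<^sub>M sites_law" (is "distr ?R ?V ?f = _")
proof (rule measure_eqI)
  let ?SA = "\<Pi>\<^sub>M k\<in>(UNIV::nat set). \<mu>" and ?SB = "\<Pi>\<^sub>M k\<in>(UNIV::nat set). mark_measure"
  interpret mm: prob_space mark_measure by (rule prob_mark_measure)
  interpret ml: prob_space mark_law by (rule prob_mark_law)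
  interpret SB: sequence_space mark_measure by unfold_locales
  interpret site: pair_prob_space \<mu> mark_measure ..
  interpret sites: sequence_space site_law by unfold_locales
  interpret Ren: prob_space "Ren \<nu> \<mu>" by (rule prob_Ren)
  note [measurable] = range_point_measurable
  have f [measurable]: "?f \<in> ?R \<rightarrow>\<^sub>M ?V"
    using site_measurable by (simp add: Ren_def cong: measurable_cong_sets sets_pair_measure_cong)
  have zip [measurable]: "(\<lambda>(a, b) k. (a k, b k)) \<in> ?SA \<Otimes>\<^sub>M ?SB \<rightarrow>\<^sub>M sites_law"
    unfolding split_beta' by (rule measurable_abs_UNIV) measurable
  fix W assume "W \<in> sets (distr ?R ?V ?f)"
  then have W [measurable]: "W \<in> sets ?V" by simp
  define h where "h x a b = (indicator W (x, \<lambda>k. (a k, b k)) :: ennreal)" for x a b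
  have h: "(\<lambda>q. h (fst q) (fst (snd q)) (snd (snd q))) \<in> borel_measurable (\<nu> \<Otimes>\<^sub>M (?SA \<Otimes>\<^sub>M ?SB))"
  proof -
    have "(\<lambda>q. (fst q, (\<lambda>(a, b) k. (a k, b k)) (snd q))) \<in> \<nu> \<Otimes>\<^sub>M (?SA \<Otimes>\<^sub>M ?SB) \<rightarrow>\<^sub>M ?V" by measurable
    from measurable_compose[OF this borel_measurable_indicator[OF W]]
    show ?thesis by (simp add: h_def split_beta')
  qed
  have h' [measurable]: "(\<lambda>q. h x (fst q) (snd q)) \<in> borel_measurable (?SA \<Otimes>\<^sub>M ?SB)" for x
    using measurable_compose[OF measurable_Pair1' h, of x] by simp
  have h'' [measurable]: "a \<in> space ?SA \<Longrightarrow> h x a \<in> borel_measurable ?SB" for x a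
    using measurable_compose[OF measurable_Pair1' h', of a] by simp
  have "emeasure (distr ?R ?V ?f) W = (\<integral>\<^sup>+p. indicator W (?f p) \<partial>?R)"
    using nn_integral_distr[OF f, of "indicator W"] W by simp
  also have "\<dots> = (\<integral>\<^sup>+\<xi>. (\<integral>\<^sup>+z. indicator W (nth_point 0 \<xi>, site \<xi> z) \<partial>mark_law) \<partial>Ren \<nu> \<mu>)"
    by (subst ml.nn_integral_fst[symmetric]) auto
  also have "\<dots> = (\<integral>\<^sup>+p. (\<integral>\<^sup>+z. indicator W (nth_point 0 (range (point p)), site (range (point p)) z) \<partial>mark_law) \<partial>skeleton)"
  proof -
    have "(\<lambda>\<xi>. \<integral>\<^sup>+z. indicator W (nth_point 0 \<xi>, site \<xi> z) \<partial>mark_law) \<in> borel_measurable (Ren \<nu> \<mu>)"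
      using ml.borel_measurable_nn_integral_fst[OF measurable_compose[OF f borel_measurable_indicator[OF W]]] by simp
    then show ?thesis unfolding Ren_eq by (subst nn_integral_distr) auto
  qed
  also have "\<dots> = (\<integral>\<^sup>+p. (\<integral>\<^sup>+b. h (fst p) (snd p) b \<partial>?SB) \<partial>skeleton)"
  proof (rule nn_integral_cong)
    fix p assume p: "p \<in> space skeleton"
    let ?i = "first_index (range (point p))"
    have "snd p \<in> space ?SA" using p by (auto simp: space_pair_measure)
    have "(\<integral>\<^sup>+z. indicator W (nth_point 0 (range (point p)), site (range (point p)) z) \<partial>mark_law) =
        (\<integral>\<^sup>+z. h (fst p) (snd p) (\<lambda>k. z (?i + int k)) \<partial>mark_law)"
      by (rule nn_integral_cong) (simp add: h_def site_def[abs_def] nth_point_point[OF p] nth_gap_point[OF p], simp add: point_def)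
    also have "\<dots> = (\<integral>\<^sup>+b. h (fst p) (snd p) b \<partial>distr mark_law ?SB (\<lambda>z k. z (?i + int k)))"
    proof (rule nn_integral_distr[symmetric])
      show "(\<lambda>z k. z (?i + int k)) \<in> mark_law \<rightarrow>\<^sub>M ?SB"
        unfolding mark_law_eq by (rule measurable_abs_UNIV) measurable
    qed (use h'' \<open>snd p \<in> space ?SA\<close> in simp)
    finally show "(\<integral>\<^sup>+z. indicator W (nth_point 0 (range (point p)), site (range (point p)) z) \<partial>mark_law) =
        (\<integral>\<^sup>+b. h (fst p) (snd p) b \<partial>?SB)"
      unfolding distr_mark_law_shift .
  qed
  also have "\<dots> = (\<integral>\<^sup>+x. (\<integral>\<^sup>+a. (\<integral>\<^sup>+b. h x a b \<partial>?SB) \<partial>?SA) \<partial>\<nu>)"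
  proof (subst gaps.P.nn_integral_fst[symmetric])
    have "(\<lambda>q. h (fst (fst q)) (snd (fst q)) (snd q)) \<in> borel_measurable (skeleton \<Otimes>\<^sub>M ?SB)"
      using measurable_compose[of "\<lambda>q. (fst (fst q), snd (fst q), snd q)" "skeleton \<Otimes>\<^sub>M ?SB" _ _ borel, OF _ h] by simp
    from SB.P.borel_measurable_nn_integral_fst[OF this]
    show "(\<lambda>p. \<integral>\<^sup>+b. h (fst p) (snd p) b \<partial>?SB) \<in> borel_measurable skeleton" by simp
  qed simp
  also have "\<dots> = (\<integral>\<^sup>+x. (\<integral>\<^sup>+\<omega>. indicator W (x, \<omega>) \<partial>sites_law) \<partial>\<nu>)"
  proof (rule nn_integral_cong)
    fix x
    have "(\<integral>\<^sup>+a. (\<integral>\<^sup>+b. h x a b \<partial>?SB) \<partial>?SA) = (\<integral>\<^sup>+q. h x (fst q) (snd q) \<partial>(?SA \<Otimes>\<^sub>M ?SB))"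
      using SB.P.nn_integral_fst[OF h', of x] by simp
    also have "\<dots> = (\<integral>\<^sup>+\<omega>. indicator W (x, \<omega>) \<partial>distr (?SA \<Otimes>\<^sub>M ?SB) sites_law (\<lambda>(a, b) k. (a k, b k)))"
      by (subst nn_integral_distr) (auto simp: h_def split_beta')
    also have "distr (?SA \<Otimes>\<^sub>M ?SB) sites_law (\<lambda>(a, b) k. (a k, b k)) = sites_law"
      by (rule distr_zip_PiM[OF prob_mu prob_mark_measure])
    finally show "(\<integral>\<^sup>+a. (\<integral>\<^sup>+b. h x a b \<partial>?SB) \<partial>?SA) = (\<integral>\<^sup>+\<omega>. indicator W (x, \<omega>) \<partial>sites_law)" .
  qed
  also have "\<dots> = emeasure ?V W"
    using W by (simp add: sites.P.nn_integral_fst)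
  finally show "emeasure (distr ?R ?V ?f) W = emeasure ?V W" .
qed simp

end

section \<open>Sites of the coalescence process\<close>

lemma AE_mark_measureI:
  assumes "{m \<in> space mark_measure. Q m} \<in> sets mark_measure"
    and "AE e in density lborel (\<lambda>x. ennreal (exponential_density 1 x)). AE u in uniform_measure lborel {0..1}. Q (e, u)"
  shows "AE m in mark_measure. Q m"
proof -
  interpret E: prob_space "density lborel (\<lambda>x. ennreal (exponential_density 1 x))"
    using prob_space_exponential_density[of 1] by simp
  interpret U: prob_space "uniform_measure lborel {0..1::real}" by (rule prob_uniform)
  interpret EU: pair_prob_space "density lborel (\<lambda>x. ennreal (exponential_density 1 x))" "uniform_measure lborel {0..1::real}" ..
  show ?thesis using assms unfolding mark_measure_def by (rule EU.AE_pair_measure)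
qed

locale coalescence = renewal d \<nu> \<mu> for d :: real and \<nu> \<mu> :: "real measure" +
  fixes dmax :: real and lamL lamR :: "ereal \<Rightarrow> real"
  assumes rates: "ocp_rates d dmax lamL lamR"
begin

definition ring :: "real \<times> real \<times> real \<Rightarrow> ereal" where
  "ring p = (let rate = lamL (ereal (fst p)) + lamR (ereal (fst p)) in
     if 0 < rate then ereal (fst (snd p) / rate) else \<infinity>)"

definition coin :: "real \<times> real \<times> real \<Rightarrow> bool" where
  "coin p \<longleftrightarrow> snd (snd p) < lamR (ereal (fst p)) / (lamL (ereal (fst p)) + lamR (ereal (fst p)))"

lemma rate_pos_iff: "d \<le> g \<Longrightarrow> 0 < lamL (ereal g) + lamR (ereal g) \<longleftrightarrow> g < dmax"
  using rates unfolding ocp_rates_def by simp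

lemma rate_infinity: "\<not> 0 < lamL \<infinity> + lamR \<infinity>"
  using rates unfolding ocp_rates_def by auto

lemma rate_measurable [measurable]:
  "(\<lambda>g. lamL (ereal g)) \<in> borel_measurable \<mu>" "(\<lambda>g. lamR (ereal g)) \<in> borel_measurable \<mu>"
proof -
  have "lamL \<in> borel_measurable (restrict_space borel {ereal d..})" "lamR \<in> borel_measurable (restrict_space borel {ereal d..})"
    using rates unfolding ocp_rates_def by auto
  moreover have "ereal \<in> restrict_space borel {d..} \<rightarrow>\<^sub>M restrict_space borel {ereal d..}"
    by (rule measurable_restrict_space3) auto
  ultimately show "(\<lambda>g. lamL (ereal g)) \<in> borel_measurable \<mu>" "(\<lambda>g. lamR (ereal g)) \<in> borel_measurable \<mu>"
    by (auto intro: measurable_compose cong: measurable_cong_sets)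
qed

lemma gap_measurable [measurable]: "(\<lambda>g. g) \<in> borel_measurable \<mu>"
  using measurable_restrict_space1[of "\<lambda>x. x" borel borel "{d..}"] by (simp cong: measurable_cong_sets)

lemma mark_components_measurable [measurable]:
  "fst \<in> borel_measurable site_law" "(\<lambda>p. fst (snd p)) \<in> borel_measurable site_law"
  "(\<lambda>p. snd (snd p)) \<in> borel_measurable site_law"
proof -
  show "fst \<in> borel_measurable site_law"
    using measurable_compose[OF measurable_fst gap_measurable] by simp
  have "snd \<in> site_law \<rightarrow>\<^sub>M borel \<Otimes>\<^sub>M borel" by measurable
  then show "(\<lambda>p. fst (snd p)) \<in> borel_measurable site_law" "(\<lambda>p. snd (snd p)) \<in> borel_measurable site_law"
    by measurable
qed

lemma site_rate_measurable [measurable]: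
  "(\<lambda>p. lamL (ereal (fst p))) \<in> borel_measurable site_law" "(\<lambda>p. lamR (ereal (fst p))) \<in> borel_measurable site_law"
  using measurable_compose[OF measurable_fst rate_measurable(1)] measurable_compose[OF measurable_fst rate_measurable(2)]
  by auto

lemma ring_measurable [measurable]: "ring \<in> borel_measurable site_law"
  unfolding ring_def[abs_def] Let_def by measurable

lemma coin_measurable [measurable]: "Measurable.pred site_law coin"
  unfolding coin_def[abs_def] by measurable

sublocale mark: prob_space mark_measure by (rule prob_mark_measure)

sublocale site: pair_prob_space \<mu> mark_measure by unfold_locales

text \<open>For a fixed length of positive rate, a prescribed finite ring time pins the exponential
  mark to a single value.\<close>

lemma AE_ring_neq: "a < \<infinity> \<Longrightarrow> AE p in site_law. ring p \<noteq> a"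
proof (rule site.AE_pair_measure)
  assume "a < \<infinity>"
  show "{p \<in> space site_law. ring p \<noteq> a} \<in> sets site_law" by measurable
  show "AE g in \<mu>. AE m in mark_measure. ring (g, m) \<noteq> a"
  proof (rule AE_I2)
    fix g
    define r where "r = lamL (ereal g) + lamR (ereal g)"
    have "AE e in lborel. e \<noteq> real_of_ereal a * r" by (rule AE_lborel_singleton)
    then have "AE e in density lborel (\<lambda>x. ennreal (exponential_density 1 x)). e \<noteq> real_of_ereal a * r"
      by (subst AE_density) auto
    then have "AE e in density lborel (\<lambda>x. ennreal (exponential_density 1 x)).
        AE u in uniform_measure lborel {0..1}. fst (e, u) \<noteq> real_of_ereal a * r"
      by eventually_elim simp
    then have "AE m in mark_measure. fst m \<noteq> real_of_ereal a * r"
    proof (rule AE_mark_measureI[rotated])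
      have [measurable]: "fst \<in> borel_measurable mark_measure" by measurable
      show "{m \<in> space mark_measure. fst m \<noteq> real_of_ereal a * r} \<in> sets mark_measure" by measurable
    qed
    then show "AE m in mark_measure. ring (g, m) \<noteq> a"
    proof eventually_elim
      case (elim m)
      show ?case
      proof
        assume a: "ring (g, m) = a"
        then have "0 < r" using \<open>a < \<infinity>\<close> by (auto simp: ring_def r_def Let_def split: if_splits)
        then have "a = ereal (fst m / r)" using a by (simp add: ring_def r_def)
        then show False using elim \<open>0 < r\<close> by simp
      qed
    qed
  qed
qed

lemma AE_mark_nonneg: "AE p in site_law. 0 \<le> fst (snd p) \<and> 0 \<le> snd (snd p)"
proof (rule site.AE_pair_measure)
  show "{p \<in> space site_law. 0 \<le> fst (snd p) \<and> 0 \<le> snd (snd p)} \<in> sets site_law" by measurable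
  have "AE e in density lborel (\<lambda>x. ennreal (exponential_density 1 x)). 0 \<le> e"
    by (subst AE_density) (auto simp: exponential_density_def)
  moreover have "AE u in uniform_measure lborel {0..1::real}. 0 \<le> u"
    by (rule AE_uniform_measureI) auto
  ultimately have "AE e in density lborel (\<lambda>x. ennreal (exponential_density 1 x)).
      AE u in uniform_measure lborel {0..1}. 0 \<le> fst (e, u) \<and> 0 \<le> snd (e, u :: real)"
    by (auto elim!: eventually_mono)
  then have "AE m in mark_measure. 0 \<le> fst m \<and> 0 \<le> snd m"
    by (intro AE_mark_measureI) measurable
  then show "AE g in \<mu>. AE m in mark_measure. 0 \<le> fst (snd (g, m)) \<and> 0 \<le> snd (snd (g, m))"
    by simp
qed

sublocale sites: iid_chain site_law ring coin
  by unfold_locales (auto intro: AE_ring_neq)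

section \<open>Laplace transforms as masses of sites\<close>

definition damp :: "complex \<Rightarrow> real \<times> real \<times> real \<Rightarrow> complex" where
  "damp s p = exp (- s * complex_of_real (fst p))"

lemma weight_damp:
  assumes "0 \<le> Re s"
  shows "sites.weight (damp s)"
  unfolding sites.weight_def
proof
  show "damp s \<in> borel_measurable site_law" unfolding damp_def[abs_def] by measurable
  show "\<forall>p\<in>space site_law. norm (damp s p) \<le> 1"
    using assms d_pos by (auto simp: damp_def space_pair_measure)
qed

lemma integral_gap:
  fixes f :: "real \<Rightarrow> complex"
  assumes [measurable]: "f \<in> borel_measurable \<mu>"
  shows "(\<integral>p. f (fst p) \<partial>site_law) = (\<integral>g. f g \<partial>\<mu>)"
  using integral_distr[of fst site_law \<mu> f] mark.distr_pair_fst[of \<mu>] by simp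

lemma integral_damp: "(\<integral>p. damp s p \<partial>site_law) = laplace_on {d..} \<mu> s"
  unfolding damp_def laplace_on_def set_lebesgue_integral_def
  by (subst integral_gap) (auto intro!: LINT_cong)

lemma ring_finite_iff:
  assumes "p \<in> space site_law"
  shows "ring p < \<infinity> \<longleftrightarrow> fst p < dmax"
proof -
  have "d \<le> fst p" using assms by (auto simp: space_pair_measure)
  then show ?thesis using rate_pos_iff[of "fst p"] by (simp add: ring_def Let_def)
qed

lemma laplace_below_dmax:
  "laplace_on {d..<dmax} \<mu> s = (\<integral>g. (if g < dmax then exp (- s * complex_of_real g) else 0) \<partial>\<mu>)"
  unfolding laplace_on_def set_lebesgue_integral_def
  by (rule LINT_cong) (auto simp: indicator_def)

lemma mass_damp: "sites.mass (damp s) \<infinity> = laplace_on {d..<dmax} \<mu> s"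
proof -
  have "sites.mass (damp s) \<infinity> = (\<integral>p. (if fst p < dmax then exp (- s * complex_of_real (fst p)) else 0) \<partial>site_law)"
    unfolding sites.mass_def
    by (rule LINT_cong[OF refl]) (simp only: ring_finite_iff damp_def)
  also have "\<dots> = (\<integral>g. (if g < dmax then exp (- s * complex_of_real g) else 0) \<partial>\<mu>)"
    by (rule integral_gap) measurable
  finally show ?thesis unfolding laplace_below_dmax .
qed

text \<open>A constant ratio of the rates makes the coin threshold equal to 1 / (1 + \<gamma>) for
  every length that can ring. The coin is then independent of the length and factors out.\<close>

lemma left_mass_damp:
  assumes "0 \<le> Re s" "0 \<le> \<gamma>" and ratio: "\<And>g. d \<le> g \<Longrightarrow> lamL (ereal g) = \<gamma> * lamR (ereal g)"
  shows "sites.left_mass (damp s) = laplace_on {d..<dmax} \<mu> s / complex_of_real (1 + \<gamma>)"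
proof -
  let ?q = "1 / (1 + \<gamma>)"
  interpret E: prob_space "density lborel (\<lambda>x. ennreal (exponential_density 1 x))"
    using prob_space_exponential_density[of 1] by simp
  interpret U: prob_space "uniform_measure lborel {0..1::real}" by (rule prob_uniform)
  have coin: "coin p \<longleftrightarrow> snd (snd p) < ?q" if "p \<in> space site_law" "fst p < dmax" for p
  proof -
    have g: "d \<le> fst p" using that by (auto simp: space_pair_measure)
    have pos: "0 < (1 + \<gamma>) * lamR (ereal (fst p))"
      using rate_pos_iff[OF g] that(2) ratio[OF g] by (simp add: algebra_simps)
    then have "lamR (ereal (fst p)) / ((1 + \<gamma>) * lamR (ereal (fst p))) = ?q" by auto
    then have "lamR (ereal (fst p)) / (lamL (ereal (fst p)) + lamR (ereal (fst p))) = ?q"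
      unfolding ratio[OF g] by (simp add: algebra_simps)
    then show ?thesis by (simp add: coin_def)
  qed
  have q: "0 < ?q" "?q \<le> 1" using \<open>0 \<le> \<gamma>\<close> by auto
  have "(\<integral>m. (if snd m < ?q then 1 else 0 :: real) \<partial>mark_measure) = (\<integral>u. (if u < ?q then 1 else 0) \<partial>uniform_measure lborel {0..1::real})"
  proof -
    have "(\<integral>m. (if snd m < ?q then 1 else 0 :: real) \<partial>mark_measure) =
        (\<integral>u. (if u < ?q then 1 else 0) \<partial>distr mark_measure (uniform_measure lborel {0..1}) snd)"
      unfolding mark_measure_def by (subst integral_distr) auto
    also have "distr mark_measure (uniform_measure lborel {0..1}) snd = uniform_measure lborel {0..1}"
      unfolding mark_measure_def
      by (rule E.distr_pair_snd[OF U.sigma_finite_measure_axioms])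
    finally show ?thesis .
  qed
  also have "\<dots> = measure (uniform_measure lborel {0..1::real}) {..<?q}"
  proof -
    have "(\<lambda>u. if u < ?q then 1 else 0 :: real) = indicator {..<?q}" by (auto simp: indicator_def)
    then show ?thesis by simp
  qed
  also have "\<dots> = measure lborel {0..<?q}"
  proof -
    have "{0..1} \<inter> {..<r} = {0..<r}" if "r \<le> 1" for r :: real using that by auto
    from this[OF q(2)] show ?thesis by (simp add: measure_uniform_measure)
  qed
  also have "\<dots> = ?q" using q by simp
  finally have real: "(\<integral>m. (if snd m < ?q then 1 else 0 :: real) \<partial>mark_measure) = ?q" .
  have "(\<integral>m. (if snd m < ?q then 1 else 0 :: complex) \<partial>mark_measure) =
      (\<integral>m. complex_of_real (if snd m < ?q then 1 else 0) \<partial>mark_measure)"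
    by (rule LINT_cong) auto
  then have mark: "(\<integral>m. (if snd m < ?q then 1 else 0 :: complex) \<partial>mark_measure) = complex_of_real ?q"
    unfolding integral_complex_of_real real .
  let ?f = "\<lambda>g m. (if g < dmax then exp (- s * complex_of_real g) else 0) * (if snd m < ?q then 1 else 0 :: complex)"
  have meas: "(\<lambda>p. ?f (fst p) (snd p)) \<in> borel_measurable site_law" by measurable
  have "sites.left_mass (damp s) = (\<integral>p. ?f (fst p) (snd p) \<partial>site_law)"
    unfolding sites.mass_def
  proof (rule LINT_cong[OF refl])
    fix p assume p: "p \<in> space site_law"
    show "(if ring p < \<infinity> then if coin p then damp s p else 0 else 0) = ?f (fst p) (snd p)"
      using coin[OF p] unfolding ring_finite_iff[OF p] damp_def by (cases "fst p < dmax") simp_all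
  qed
  also have "\<dots> = (\<integral>g. (\<integral>m. ?f g m \<partial>mark_measure) \<partial>\<mu>)"
  proof -
    have "integrable site_law (\<lambda>p. ?f (fst p) (snd p))"
      using assms(1) d_pos meas
      by (intro site.P.integrable_const_bound[where B = 1]) (auto simp: space_pair_measure)
    from site.integral_fst'[OF this] show ?thesis unfolding fst_conv snd_conv by (rule sym)
  qed
  also have "\<dots> = (\<integral>g. (if g < dmax then exp (- s * complex_of_real g) else 0) * complex_of_real ?q \<partial>\<mu>)"
    by (simp only: integral_mult_right_zero mark)
  finally show ?thesis unfolding laplace_below_dmax by (simp only: integral_mult_left_zero) simp
qed

end

section \<open>Paths of the coalescence process\<close>

text \<open>No domain reaches to plus infinity, since an increasing sequence has no last
  point.\<close>

lemma domains_range: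
  assumes "strict_mono x"
  shows "domains (range x) = insert (-\<infinity>, ereal (x 0)) (range (\<lambda>k. (ereal (x k), ereal (x (Suc k)))))"
proof -
  have le: "x i \<le> x j \<longleftrightarrow> i \<le> j" "x i < x j \<longleftrightarrow> i < j" for i j
    using assms by (simp_all add: strict_mono_less_eq strict_mono_less)
  show ?thesis
  proof (intro set_eqI iffI)
    fix \<Delta> assume "\<Delta> \<in> domains (range x)"
    obtain a b where \<Delta>: "\<Delta> = (a, b)" by (cases \<Delta>)
    have ab: "a \<in> ereal ` range x \<union> {-\<infinity>, \<infinity>}" "b \<in> ereal ` range x \<union> {-\<infinity>, \<infinity>}" "a < b"
      and no: "\<And>c. c \<in> ereal ` range x \<union> {-\<infinity>, \<infinity>} \<Longrightarrow> \<not> (a < c \<and> c < b)"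
      using \<open>\<Delta> \<in> domains (range x)\<close> unfolding \<Delta> domains_def Let_def mem_Collect_eq case_prod_conv by blast+
    have no': "\<not> (a < ereal (x k) \<and> ereal (x k) < b)" for k by (rule no) auto
    consider (minf) "a = -\<infinity>" | (fin) i where "a = ereal (x i)" using ab by auto
    then show "\<Delta> \<in> insert (-\<infinity>, ereal (x 0)) (range (\<lambda>k. (ereal (x k), ereal (x (Suc k)))))"
    proof cases
      case minf
      have "b \<noteq> \<infinity>" using no'[of 0] minf by auto
      then obtain j where j: "b = ereal (x j)" using ab minf by auto
      then have "j = 0" using no'[of 0] minf le(2)[of 0 j] by auto
      then show ?thesis using \<Delta> minf j by simp
    next
      case (fin i)
      have "b \<noteq> \<infinity>" using no'[of "Suc i"] fin le(2)[of i "Suc i"] by auto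
      then obtain j where j: "b = ereal (x j)" using ab fin by auto
      then have "i < j" using ab(3) fin le by simp
      moreover have "\<not> Suc i < j" using no'[of "Suc i"] fin j le by simp
      ultimately have "j = Suc i" by simp
      then show ?thesis using \<Delta> fin j by simp
    qed
  next
    fix \<Delta> assume "\<Delta> \<in> insert (-\<infinity>, ereal (x 0)) (range (\<lambda>k. (ereal (x k), ereal (x (Suc k)))))"
    then show "\<Delta> \<in> domains (range x)"
      unfolding domains_def Let_def by (auto simp: le)
  qed
qed

lemma gap_in_domains_iff:
  assumes "strict_mono x" "Y \<subseteq> range x"
  shows "(ereal (x k), ereal (x (Suc k))) \<in> domains Y \<longleftrightarrow> x k \<in> Y \<and> x (Suc k) \<in> Y"
proof -
  have le: "x i < x j \<longleftrightarrow> i < j" for i j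
    using assms by (simp add: strict_mono_less)
  have "\<not> (x k < y \<and> y < x (Suc k))" if "y \<in> Y" for y
    using assms(2) that le by auto
  then show ?thesis unfolding domains_def Let_def by (auto simp: le)
qed

context coalescence
begin

text \<open>The path driven by the marks \<open>z\<close>, observed along the enumeration \<open>x\<close> of its initial points.
  Site \<open>k\<close> rings successfully if its domain is still there immediately before its ring time.\<close>

context
  fixes x :: "nat \<Rightarrow> real" and z :: "int \<Rightarrow> real \<times> real" and Y :: "real \<Rightarrow> real set"
    and \<omega> :: "nat \<Rightarrow> real \<times> real \<times> real"
  assumes x: "spaced d x" and Y0: "Y 0 = range x" and \<omega>: "\<omega> = site (range x) z"
    and path: "coalescence_path lamL lamR z Y"
begin

definition success :: "nat \<Rightarrow> bool" where
  "success k \<longleftrightarrow> ring (\<omega> k) < \<infinity> \<and> (\<forall>u\<ge>0. ereal u < ring (\<omega> k) \<longrightarrow> x k \<in> Y u \<and> x (Suc k) \<in> Y u)"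

lemma mono_x: "strict_mono x"
  by (rule spaced_strict_mono[OF x])

lemma inj_x: "x i = x j \<longleftrightarrow> i = j"
  using mono_x by (simp add: strict_mono_eq)

lemma path_subset: "0 \<le> t \<Longrightarrow> Y t \<subseteq> range x"
  using path unfolding coalescence_path_def Y0[symmetric] by blast

lemma site_eq: "\<omega> k = (x (Suc k) - x k, z (point_index (range x) (x k)))"
proof -
  have "x k + d \<le> x (Suc k)" using x unfolding spaced_def by blast
  then show ?thesis
    unfolding \<omega> site_def nth_gap_def nth_point_range[OF x] point_index_range[OF x] by simp
qed

lemma path_iff:
  assumes "0 \<le> t"
  shows "x n \<in> Y t \<longleftrightarrow> \<not> (success n \<and> coin (\<omega> n) \<and> ring (\<omega> n) \<le> ereal t) \<and>
    \<not> (0 < n \<and> success (n - 1) \<and> \<not> coin (\<omega> (n - 1)) \<and> ring (\<omega> (n - 1)) \<le> ereal t)"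
proof -
  define D where "D \<Delta> \<longleftrightarrow> ring_time lamL lamR (Y 0) z \<Delta> \<le> ereal t \<and>
        (\<forall>u\<ge>0. ereal u < ring_time lamL lamR (Y 0) z \<Delta> \<longrightarrow> \<Delta> \<in> domains (Y u)) \<and>
        deleted_endpoint lamL lamR (Y 0) z \<Delta> = ereal (x n)" for \<Delta>
  have "Y t = {y \<in> Y 0. \<not> (\<exists>\<Delta>\<in>domains (Y 0).
        ring_time lamL lamR (Y 0) z \<Delta> \<le> ereal t \<and>
        (\<forall>u\<ge>0. ereal u < ring_time lamL lamR (Y 0) z \<Delta> \<longrightarrow> \<Delta> \<in> domains (Y u)) \<and>
        deleted_endpoint lamL lamR (Y 0) z \<Delta> = ereal y)}"
    using path \<open>0 \<le> t\<close> unfolding coalescence_path_def by blast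
  then have "x n \<in> Y t \<longleftrightarrow> \<not> (\<exists>\<Delta>\<in>domains (range x). D \<Delta>)"
    unfolding D_def Y0 by blast
  also have "(\<exists>\<Delta>\<in>domains (range x). D \<Delta>) \<longleftrightarrow>
      D (-\<infinity>, ereal (x 0)) \<or> (\<exists>k. D (ereal (x k), ereal (x (Suc k))))"
    unfolding domains_range[OF mono_x] by blast
  \<comment> \<open>The unbounded domain has infinite length, hence rate zero, and never
    rings.\<close>
  also have "D (-\<infinity>, ereal (x 0)) \<longleftrightarrow> False"
    using rate_infinity by (simp add: D_def ring_time_def dlength_def Let_def)
  finally have survives: "x n \<in> Y t \<longleftrightarrow> \<not> (\<exists>k. D (ereal (x k), ereal (x (Suc k))))" by simp
  have "D (ereal (x k), ereal (x (Suc k))) \<longleftrightarrow>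
      success k \<and> ring (\<omega> k) \<le> ereal t \<and> (coin (\<omega> k) \<and> n = k \<or> \<not> coin (\<omega> k) \<and> n = Suc k)" for k
  proof -
    let ?\<Delta> = "(ereal (x k), ereal (x (Suc k)))"
    have mark: "mark_of (Y 0) z ?\<Delta> = snd (\<omega> k)" by (simp add: mark_of_def Y0 site_eq)
    have len: "dlength ?\<Delta> = ereal (fst (\<omega> k))" by (simp add: dlength_def site_eq)
    have time: "ring_time lamL lamR (Y 0) z ?\<Delta> = ring (\<omega> k)"
      unfolding ring_time_def mark len ring_def ..
    have del: "deleted_endpoint lamL lamR (Y 0) z ?\<Delta> = ereal (x n) \<longleftrightarrow>
        coin (\<omega> k) \<and> n = k \<or> \<not> coin (\<omega> k) \<and> n = Suc k"
      unfolding deleted_endpoint_def mark len coin_def by (auto simp: inj_x)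
    have "(\<forall>u\<ge>0. ereal u < ring (\<omega> k) \<longrightarrow> ?\<Delta> \<in> domains (Y u)) \<longleftrightarrow>
        (\<forall>u\<ge>0. ereal u < ring (\<omega> k) \<longrightarrow> x k \<in> Y u \<and> x (Suc k) \<in> Y u)"
      using gap_in_domains_iff[OF mono_x path_subset] by blast
    moreover have "ring (\<omega> k) \<le> ereal t \<Longrightarrow> ring (\<omega> k) < \<infinity>" by auto
    ultimately show ?thesis unfolding D_def time del success_def by blast
  qed
  then show ?thesis unfolding survives by (cases n) auto
qed

text \<open>Replaces a condition on all earlier times by a relation between neighbouring sites, the
  form required by \<open>survives_iff_alive\<close>. Nonnegative ring times guarantee that an
  earlier ring of a neighbour is a time at which the path is observed.\<close>

lemma success_iff:
  assumes nonneg: "\<And>k. 0 \<le> ring (\<omega> k)"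
  shows "success k \<longleftrightarrow> ring (\<omega> k) < \<infinity> \<and>
      \<not> (0 < k \<and> (success (k - 1) \<and> \<not> coin (\<omega> (k - 1))) \<and> ring (\<omega> (k - 1)) < ring (\<omega> k)) \<and>
      \<not> ((success (Suc k) \<and> coin (\<omega> (Suc k))) \<and> ring (\<omega> (Suc k)) < ring (\<omega> k))"
    (is "_ \<longleftrightarrow> _ \<and> \<not> ?L \<and> \<not> ?R")
proof
  assume k: "success k"
  have at_ring: "\<exists>u\<ge>0. ring (\<omega> j) = ereal u" if "ring (\<omega> j) < ring (\<omega> k)" for j
    using that nonneg[of j] by (cases "ring (\<omega> j)") auto
  have "\<not> ?L"
  proof
    assume L: ?L
    then obtain u where u: "0 \<le> u" "ring (\<omega> (k - 1)) = ereal u" using at_ring by blast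
    then have "x k \<in> Y u" using k L unfolding success_def[of k] by auto
    then show False using path_iff[OF u(1), of k] L u(2) by simp
  qed
  moreover have "\<not> ?R"
  proof
    assume R: ?R
    then obtain u where u: "0 \<le> u" "ring (\<omega> (Suc k)) = ereal u" using at_ring by blast
    then have "x (Suc k) \<in> Y u" using k R unfolding success_def[of k] by auto
    then show False using path_iff[OF u(1), of "Suc k"] R u(2) by simp
  qed
  ultimately show "ring (\<omega> k) < \<infinity> \<and> \<not> ?L \<and> \<not> ?R" using k unfolding success_def[of k] by blast
next
  assume R: "ring (\<omega> k) < \<infinity> \<and> \<not> ?L \<and> \<not> ?R"
  have "x k \<in> Y u \<and> x (Suc k) \<in> Y u" if u: "0 \<le> u" "ereal u < ring (\<omega> k)" for u
  proof -
    have *: "ring (\<omega> j) \<le> ereal u \<Longrightarrow> ring (\<omega> j) < ring (\<omega> k)" for j using u(2) by simp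
    have "\<not> ring (\<omega> k) \<le> ereal u" using u(2) by simp
    then show ?thesis
      using path_iff[OF u(1), of k] path_iff[OF u(1), of "Suc k"] R *[of "k - 1"] *[of "Suc k"]
      unfolding diff_Suc_1 by blast
  qed
  then show "success k" using R unfolding success_def by blast
qed

lemma survivors_eq:
  assumes nonneg: "\<And>k. 0 \<le> ring (\<omega> k)" and "sites.nodesc \<omega>"
  shows "(\<Inter>u\<in>{0..}. Y u) = x ` {k. sites.alive k \<omega>}"
proof -
  have iff: "x n \<in> (\<Inter>u\<in>{0..}. Y u) \<longleftrightarrow> sites.alive n \<omega>" for n
  proof -
    have fin: "\<exists>t\<ge>0. ring (\<omega> j) \<le> ereal t" if "success j" for j
      using that nonneg[of j] unfolding success_def[of j] by (cases "ring (\<omega> j)") auto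
    have "x n \<in> (\<Inter>u\<in>{0..}. Y u) \<longleftrightarrow> (\<forall>u\<ge>0. x n \<in> Y u)" by auto
    also have "\<dots> \<longleftrightarrow> \<not> (success n \<and> coin (\<omega> n)) \<and> \<not> (0 < n \<and> (success (n - 1) \<and> \<not> coin (\<omega> (n - 1))))"
      using path_iff[of _ n] fin by blast
    also have "\<dots> \<longleftrightarrow> sites.alive n \<omega>"
    proof (rule sites.survives_iff_alive)
      show "(success k \<and> coin (\<omega> k)) = (coin (\<omega> k) \<and> sites.undisturbed
          (\<lambda>k. success k \<and> coin (\<omega> k)) (\<lambda>k. success k \<and> \<not> coin (\<omega> k)) \<omega> k)" for k
        using success_iff[OF nonneg, of k] by blast
      show "(success k \<and> \<not> coin (\<omega> k)) = (\<not> coin (\<omega> k) \<and> sites.undisturbed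
          (\<lambda>k. success k \<and> coin (\<omega> k)) (\<lambda>k. success k \<and> \<not> coin (\<omega> k)) \<omega> k)" for k
        using success_iff[OF nonneg, of k] by blast
    qed fact
    finally show ?thesis .
  qed
  have "(\<Inter>u\<in>{0..}. Y u) \<subseteq> range x" using path_subset[of 0] by auto
  then show ?thesis using iff by blast
qed

lemma leftmost_survives:
  assumes "\<not> coin (\<omega> 0)" "0 \<le> t"
  shows "x 0 \<in> Y t"
  using path_iff[OF assms(2), of 0] assms(1) by simp

end

end

lemma strict_mono_image_first_two:
  fixes x y :: "nat \<Rightarrow> real"
  assumes x: "strict_mono x" and y: "strict_mono y" and eq: "range y = x ` A"
    and k: "k \<in> A" "\<And>j. j \<in> A \<Longrightarrow> k \<le> j"
    and l: "l \<in> A" "k < l" "\<And>j. j \<in> A \<Longrightarrow> k < j \<Longrightarrow> l \<le> j"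
  shows "y 0 = x k" "y 1 = x l"
proof -
  have le: "x i \<le> x j \<longleftrightarrow> i \<le> j" "y i \<le> y j \<longleftrightarrow> i \<le> j" for i j
    using x y by (simp_all add: strict_mono_less_eq)
  have mem: "\<exists>j\<in>A. y n = x j" for n using eq by blast
  obtain n where n: "x k = y n" using k(1) eq by blast
  obtain m where m: "x l = y m" using l(1) eq by blast
  obtain i where i: "i \<in> A" "y 0 = x i" using mem by blast
  have "y 0 \<le> x k" unfolding n le by simp
  then have "i = k" using i k(2)[of i] le(1)[of i k] by simp
  then show "y 0 = x k" using i by simp
  have "m \<noteq> 0"
  proof
    assume "m = 0"
    then have "x l \<le> x k" using m \<open>y 0 = x k\<close> by simp
    then show False using l(2) le(1)[of l k] by simp
  qed
  then have "y 1 \<le> x l" unfolding m le by simp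
  obtain j where j: "j \<in> A" "y 1 = x j" using mem by blast
  have "k < j" using k(2)[OF j(1)] \<open>y 0 = x k\<close> j(2) le(2)[of 1 0] by (cases "j = k") auto
  then have "j = l" using l(3)[OF j(1)] \<open>y 1 \<le> x l\<close> j(2) le(1)[of j l] by simp
  then show "y 1 = x l" using j by simp
qed

section \<open>Measurability of membership\<close>

text \<open>Membership expressed by counts in shrinking windows with rational centres. Such windows
  come arbitrarily close to \<open>y\<close>, and a point outside a locally finite set keeps a
  positive distance from it.\<close>

lemma mem_configuration_iff:
  assumes "\<eta> \<in> configurations"
  shows "y \<in> \<eta> \<longleftrightarrow> (\<forall>n::nat. \<exists>q::rat. \<bar>of_rat q - y\<bar> < 1 / Suc n \<and>
    card (\<eta> \<inter> {of_rat q - 1 / Suc n..of_rat q + 1 / Suc n}) \<noteq> 0)" (is "_ \<longleftrightarrow> (\<forall>n. ?near n)")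
proof
  assume "y \<in> \<eta>"
  show "\<forall>n. ?near n"
  proof
    fix n :: nat
    obtain q where q: "y - 1 / Suc n < real_of_rat q" "real_of_rat q < y"
      using of_rat_dense[of "y - 1 / Suc n" y] by auto
    let ?A = "\<eta> \<inter> {of_rat q - 1 / Suc n..of_rat q + 1 / Suc n}"
    have "finite ?A"
      using assms unfolding configurations_def by simp
    moreover have "y \<in> ?A"
      using q \<open>y \<in> \<eta>\<close> by auto
    ultimately have "card ?A \<noteq> 0" by (metis card_0_eq empty_iff)
    moreover have "\<bar>of_rat q - y\<bar> < 1 / Suc n" using q by linarith
    ultimately show "?near n" by blast
  qed
next
  assume near: "\<forall>n. ?near n"
  show "y \<in> \<eta>"
  proof (rule ccontr)
    assume "y \<notin> \<eta>"
    then obtain e where e: "0 < e" "\<And>x. x \<in> \<eta> \<Longrightarrow> e \<le> dist y x"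
      using configuration_closed[OF assms] by blast
    obtain n where n: "1 / Suc n < e / 2"
      using nat_approx_posE[of "e / 2"] e(1) by auto
    obtain q :: rat where q: "\<bar>of_rat q - y\<bar> < 1 / Suc n"
      "card (\<eta> \<inter> {of_rat q - 1 / Suc n..of_rat q + 1 / Suc n}) \<noteq> 0" using near by blast
    then have "\<eta> \<inter> {of_rat q - 1 / Suc n..of_rat q + 1 / Suc n} \<noteq> {}" by force
    then obtain x where x: "x \<in> \<eta>" "of_rat q - 1 / Suc n \<le> x" "x \<le> of_rat q + 1 / Suc n" by auto
    have "\<bar>y - x\<bar> < e" using q(1) x(2,3) n by linarith
    then show False using e(2)[OF x(1)] by (simp add: dist_real_def)
  qed
qed

lemma mem_configuration_measurable [measurable (raw)]:
  assumes [measurable]: "f \<in> borel_measurable N" and g: "g \<in> N \<rightarrow>\<^sub>M config_algebra"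
  shows "Measurable.pred N (\<lambda>x. f x \<in> g x)"
proof -
  have [measurable]: "(\<lambda>x. card (g x \<inter> {a..b})) \<in> N \<rightarrow>\<^sub>M count_space UNIV" for a b
    by (rule measurable_compose[OF g measurable_card_Int]) auto
  have "Measurable.pred N (\<lambda>x. \<forall>n::nat. \<exists>q::rat. \<bar>of_rat q - f x\<bar> < 1 / Suc n \<and>
    card (g x \<inter> {of_rat q - 1 / Suc n..of_rat q + 1 / Suc n}) \<noteq> 0)"
    by measurable
  moreover have "f x \<in> g x \<longleftrightarrow> (\<forall>n::nat. \<exists>q::rat. \<bar>of_rat q - f x\<bar> < 1 / Suc n \<and>
    card (g x \<inter> {of_rat q - 1 / Suc n..of_rat q + 1 / Suc n}) \<noteq> 0)" if "x \<in> space N" for x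
    using measurable_space[OF g that] by (intro mem_configuration_iff) (simp add: space_config_algebra)
  ultimately show ?thesis
    by (simp only: measurable_cong[of N "\<lambda>x. f x \<in> g x"])
qed

text \<open>Absence of points below a bound is tested on bounded windows, the only sets whose counts
  generate the \<sigma>-algebra.\<close>

lemma has_minimum_iff:
  assumes "\<xi> \<in> configurations"
  shows "(\<exists>m\<in>\<xi>. \<forall>x\<in>\<xi>. m \<le> x) \<longleftrightarrow> (\<exists>N::nat. card (\<xi> \<inter> {- real N..real N}) \<noteq> 0 \<and>
    (\<forall>n::nat. card (\<xi> \<inter> {- real n..<- real N}) = 0))" (is "_ \<longleftrightarrow> ?rhs")
proof
  have fin: "finite (\<xi> \<inter> A)" if "bounded A" for A using assms that unfolding configurations_def by blast
  assume "\<exists>m\<in>\<xi>. \<forall>x\<in>\<xi>. m \<le> x"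
  then obtain m where m: "m \<in> \<xi>" "\<And>x. x \<in> \<xi> \<Longrightarrow> m \<le> x" by blast
  obtain N :: nat where N: "\<bar>m\<bar> \<le> real N" using real_arch_simple by blast
  then have "m \<in> \<xi> \<inter> {- real N..real N}" using m(1) by auto
  then have "card (\<xi> \<inter> {- real N..real N}) \<noteq> 0" using fin[of "{- real N..real N}"] by (metis bounded_closed_interval card_0_eq empty_iff)
  moreover have "\<xi> \<inter> {- real n..<- real N} = {}" for n using m(2) N by force
  ultimately show ?rhs by (intro exI[of _ N]) auto
next
  have fin: "finite (\<xi> \<inter> A)" if "bounded A" for A using assms that unfolding configurations_def by blast
  assume ?rhs
  then obtain N :: nat where N: "card (\<xi> \<inter> {- real N..real N}) \<noteq> 0"
    "\<And>n::nat. card (\<xi> \<inter> {- real n..<- real N}) = 0" by blast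
  let ?F = "\<xi> \<inter> {- real N..real N}"
  have F: "finite ?F" "?F \<noteq> {}" using fin[of "{- real N..real N}"] N(1) by (auto intro: bounded_closed_interval)
  have "Min ?F \<le> x" if "x \<in> \<xi>" for x
  proof (cases "x \<le> real N")
    case True
    have "- real N \<le> x"
    proof (rule ccontr)
      assume less: "\<not> - real N \<le> x"
      obtain n :: nat where "- x \<le> real n" using real_arch_simple by blast
      then have "x \<in> \<xi> \<inter> {- real n..<- real N}" using that less by auto
      moreover have "finite (\<xi> \<inter> {- real n..<- real N})"
        by (rule fin) (meson bounded_subset bounded_closed_interval atLeastLessThan_subseteq_atLeastAtMost_iff order_refl)
      ultimately show False using N(2)[of n] by (metis card_0_eq empty_iff)
    qed
    then show ?thesis using True that F by (intro Min_le) auto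
  next
    case False
    have "Min ?F \<in> ?F" using F by (rule Min_in)
    then show ?thesis using False by simp
  qed
  moreover have "Min ?F \<in> \<xi>" using Min_in[OF F] by blast
  ultimately show "\<exists>m\<in>\<xi>. \<forall>x\<in>\<xi>. m \<le> x" by blast
qed

text \<open>A configuration without a leftmost point has the unspecified value
  \<open>THE x. False\<close> as its \<open>LEAST\<close> element.\<close>

lemma Least_configuration:
  assumes "\<xi> \<in> configurations"
  shows "(LEAST x. x \<in> \<xi>) = (if \<exists>m\<in>\<xi>. \<forall>x\<in>\<xi>. m \<le> x then nth_point 0 \<xi> else (THE x. False))"
proof (cases "\<exists>m\<in>\<xi>. \<forall>x\<in>\<xi>. m \<le> x")
  case True
  then obtain m where m: "m \<in> \<xi>" "\<And>x. x \<in> \<xi> \<Longrightarrow> m \<le> x" by blast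
  then have "(LEAST x. x \<in> \<xi>) = m" by (intro Least_equality) auto
  then show ?thesis using True nth_point_0_minimum[OF assms m] by simp
next
  case False
  then have "\<not> (x \<in> \<xi> \<and> (\<forall>y. y \<in> \<xi> \<longrightarrow> x \<le> y))" for x by blast
  then have "(\<lambda>x. x \<in> \<xi> \<and> (\<forall>y. y \<in> \<xi> \<longrightarrow> x \<le> y)) = (\<lambda>x. False)"
    by (intro ext) blast
  then show ?thesis unfolding Least_def if_not_P[OF False] by (rule arg_cong)
qed

text \<open>The space \<open>M\<close> need not be complete, so the event in the survival
  probability must be measurable also on the null set of configurations without a leftmost
  point.\<close>

lemma Least_configuration_measurable:
  assumes g: "g \<in> N \<rightarrow>\<^sub>M config_algebra"
  shows "(\<lambda>x. LEAST y. y \<in> g x) \<in> borel_measurable N"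
proof -
  have conf: "g x \<in> configurations" if "x \<in> space N" for x
    using measurable_space[OF g that] by (simp add: space_config_algebra)
  have [measurable]: "(\<lambda>x. card (g x \<inter> {a..b})) \<in> N \<rightarrow>\<^sub>M count_space UNIV"
    "(\<lambda>x. card (g x \<inter> {a..<b})) \<in> N \<rightarrow>\<^sub>M count_space UNIV" for a b
    by (rule measurable_compose[OF g measurable_card_Int]; auto intro: bounded_subset[of "{a..b}"])+
  have [measurable]: "(\<lambda>x. nth_point 0 (g x)) \<in> borel_measurable N"
    by (rule measurable_compose[OF g nth_point_measurable])
  have "(\<lambda>x. if \<exists>N::nat. card (g x \<inter> {- real N..real N}) \<noteq> 0 \<and>
      (\<forall>n::nat. card (g x \<inter> {- real n..<- real N}) = 0) then nth_point 0 (g x) else (THE x. False)) \<in> borel_measurable N"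
    by measurable
  then show ?thesis
    by (rule measurable_cong[THEN iffD1, rotated])
      (simp only: Least_configuration[OF conf] has_minimum_iff[OF conf])
qed

section \<open>The process on a probability space\<close>

locale coalescence_process = coalescence d \<nu> \<mu> dmax lamL lamR
  for d :: real and \<nu> \<mu> :: "real measure" and dmax :: real and lamL lamR :: "ereal \<Rightarrow> real" +
  fixes M :: "'w measure" and X :: "real \<Rightarrow> 'w \<Rightarrow> real set" and Z :: "'w \<Rightarrow> int \<Rightarrow> real \<times> real"
  assumes prob_M: "prob_space M"
    and config_at_measurable [measurable]: "\<And>t. config_at X t \<in> M \<rightarrow>\<^sub>M config_algebra"
    and Z_measurable [measurable]: "Z \<in> M \<rightarrow>\<^sub>M mark_law"
    and joint_law: "distr M (config_algebra \<Otimes>\<^sub>M mark_law) (\<lambda>\<omega>. (X 0 \<omega>, Z \<omega>)) = Ren \<nu> \<mu> \<Otimes>\<^sub>M mark_law"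
    and AE_path: "AE \<omega> in M. coalescence_path lamL lamR (Z \<omega>) (\<lambda>t. X t \<omega>)"
begin

sublocale M: prob_space M by (rule prob_M)

lemma config_at_0: "config_at X 0 = X 0"
  by (auto simp: config_at_def)

lemma X0_measurable [measurable]: "X 0 \<in> M \<rightarrow>\<^sub>M config_algebra"
  using config_at_measurable[of 0] by (simp add: config_at_0)

lemma config_at_configurations: "\<omega> \<in> space M \<Longrightarrow> config_at X t \<omega> \<in> configurations"
  using measurable_space[OF config_at_measurable] by (simp add: space_config_algebra)

lemma distr_X0: "distr M config_algebra (X 0) = Ren \<nu> \<mu>"
proof -
  interpret ml: prob_space mark_law by (rule prob_mark_law)
  have "distr M config_algebra (X 0) = distr (distr M (config_algebra \<Otimes>\<^sub>M mark_law) (\<lambda>\<omega>. (X 0 \<omega>, Z \<omega>))) config_algebra fst"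
    by (subst distr_distr) (auto simp: comp_def)
  also have "\<dots> = distr (Ren \<nu> \<mu> \<Otimes>\<^sub>M mark_law) (Ren \<nu> \<mu>) fst"
    unfolding joint_law by (rule distr_cong) (auto simp: Ren_def)
  finally show ?thesis unfolding ml.distr_pair_fst .
qed

abbreviation pt :: "'w \<Rightarrow> nat \<Rightarrow> real" where
  "pt \<omega> n \<equiv> nth_point n (X 0 \<omega>)"

abbreviation sq :: "'w \<Rightarrow> nat \<Rightarrow> real \<times> real \<times> real" where
  "sq \<omega> \<equiv> site (X 0 \<omega>) (Z \<omega>)"

text \<open>Only the law of \<open>X 0\<close> is given. The enumeration is therefore transferred
  through the measurable predicate \<open>enumerated\<close>.\<close>

lemma AE_X0: "AE \<omega> in M. spaced d (pt \<omega>) \<and> X 0 \<omega> = range (pt \<omega>)"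
proof -
  have "AE \<omega> in M. enumerated d (X 0 \<omega>)"
    by (rule AE_distrD[OF X0_measurable]) (unfold distr_X0, rule AE_enumerated)
  then show ?thesis
    using AE_space
  proof eventually_elim
    case (elim \<omega>)
    have "X 0 \<omega> \<in> configurations" using config_at_configurations[OF elim(2), of 0] by (simp add: config_at_0)
    then show ?case
      using elim(1) enumerated_eq_range[OF d_pos] d_pos by (simp add: spaced_def enumerated_def)
  qed
qed

lemma sites_measurable: "(\<lambda>\<omega>. (pt \<omega> 0, sq \<omega>)) \<in> M \<rightarrow>\<^sub>M \<nu> \<Otimes>\<^sub>M sites_law"
  using measurable_compose[OF measurable_Pair[OF X0_measurable Z_measurable] site_measurable] by simp

lemma distr_sites: "distr M (\<nu> \<Otimes>\<^sub>M sites_law) (\<lambda>\<omega>. (pt \<omega> 0, sq \<omega>)) = \<nu> \<Otimes>\<^sub>M sites_law"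
proof -
  have "distr M (\<nu> \<Otimes>\<^sub>M sites_law) (\<lambda>\<omega>. (pt \<omega> 0, sq \<omega>)) =
      distr (distr M (config_algebra \<Otimes>\<^sub>M mark_law) (\<lambda>\<omega>. (X 0 \<omega>, Z \<omega>))) (\<nu> \<Otimes>\<^sub>M sites_law)
        (\<lambda>p. (nth_point 0 (fst p), site (fst p) (snd p)))"
    by (subst distr_distr) (auto simp: comp_def site_measurable)
  then show ?thesis unfolding joint_law distr_site .
qed

lemma sq_measurable [measurable]: "sq \<in> M \<rightarrow>\<^sub>M sites_law"
  using measurable_compose[OF sites_measurable measurable_snd] by simp

lemma distr_sq: "distr M sites_law sq = sites_law"
proof -
  have "distr M sites_law sq = distr (distr M (\<nu> \<Otimes>\<^sub>M sites_law) (\<lambda>\<omega>. (pt \<omega> 0, sq \<omega>))) sites_law snd"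
    by (subst distr_distr) (auto simp: comp_def sites_measurable)
  also have "\<dots> = sites_law"
    unfolding distr_sites by (rule nu.distr_pair_snd) unfold_locales
  finally show ?thesis .
qed

lemma AE_sq: "AE s in sites_law. Q s \<Longrightarrow> AE \<omega> in M. Q (sq \<omega>)"
  by (rule AE_distrD[OF sq_measurable]) (unfold distr_sq)

lemma AE_sq_marks: "AE \<omega> in M. \<forall>k. 0 \<le> fst (snd (sq \<omega> k)) \<and> 0 \<le> snd (snd (sq \<omega> k))"
proof (rule AE_sq)
  show "AE s in sites_law. \<forall>k. 0 \<le> fst (snd (s k)) \<and> 0 \<le> snd (snd (s k))"
    unfolding AE_all_countable using sites.AE_component[OF UNIV_I AE_mark_nonneg] by blast
qed

lemma ring_nonneg: "0 \<le> fst (snd p) \<Longrightarrow> 0 \<le> ring p"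
  by (simp add: ring_def Let_def)

lemma AE_survivors: "AE \<omega> in M. config_at X \<infinity> \<omega> = pt \<omega> ` {k. sites.alive k (sq \<omega>)}"
  using AE_X0 AE_path AE_sq_marks AE_sq[OF sites.AE_nodesc]
proof eventually_elim
  case (elim \<omega>)
  have "config_at X \<infinity> \<omega> = (\<Inter>u\<in>{0..}. X u \<omega>)" by (simp add: config_at_def)
  also have "\<dots> = pt \<omega> ` {k. sites.alive k (sq \<omega>)}"
  proof (rule survivors_eq)
    show "spaced d (pt \<omega>)" "X 0 \<omega> = range (pt \<omega>)" using elim(1) by auto
    then show "sq \<omega> = site (range (pt \<omega>)) (Z \<omega>)" by simp
    show "coalescence_path lamL lamR (Z \<omega>) (\<lambda>u. X u \<omega>)" by (rule elim(2))
    show "0 \<le> ring (sq \<omega> k)" for k using elim(3) ring_nonneg by blast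
    show "sites.nodesc (sq \<omega>)" by (rule elim(4))
  qed
  finally show ?case .
qed

lemma pt_sum:
  assumes "spaced d (pt \<omega>)"
  shows "pt \<omega> (k + m) = pt \<omega> k + (\<Sum>j<m. fst (sq \<omega> (k + j)))"
proof (induction m)
  case (Suc m)
  have "pt \<omega> (k + m) + d \<le> pt \<omega> (Suc (k + m))" using assms unfolding spaced_def by blast
  then show ?case using Suc by (simp add: site_def nth_gap_def)
qed simp

text \<open>Damping each length separately turns distances, which are sums of initial gaps, into the
  multiplicative weights of the chain.\<close>

lemma pw_damp: "sites.pw (damp s) m \<omega> = exp (- s * complex_of_real (\<Sum>j<m. fst (\<omega> j)))"
  by (simp add: sites.pw_def damp_def exp_sum[symmetric] sum_distrib_left)

lemma damp_0: "damp 0 = (\<lambda>x. 1)"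
  by (auto simp: damp_def)

lemma nth_point_0_config_at:
  assumes "\<And>k. lamR (ereal k) = 0 \<or> k < d"
  shows "AE \<omega> in M. nth_point 0 (config_at X t \<omega>) = pt \<omega> 0"
  using AE_X0 AE_path AE_sq_marks AE_space
proof eventually_elim
  case (elim \<omega>)
  have sp: "spaced d (pt \<omega>)" and X0: "X 0 \<omega> = range (pt \<omega>)" using elim(1) by auto
  have sq: "sq \<omega> = site (range (pt \<omega>)) (Z \<omega>)" using X0 by simp
  have "d \<le> fst (sq \<omega> 0)" by (simp add: site_def nth_gap_def)
  then have "lamR (ereal (fst (sq \<omega> 0))) = 0" using assms[of "fst (sq \<omega> 0)"] by linarith
  \<comment> \<open>With \<open>lamR\<close> equal to zero the coin threshold is 0, and the uniform
    mark is almost surely nonnegative: a left endpoint is never chosen.\<close>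
  then have coin: "\<not> coin (sq \<omega> 0)" using elim(3) by (simp add: coin_def not_less)
  have mem: "pt \<omega> 0 \<in> X u \<omega>" if "0 \<le> u" for u
    using leftmost_survives[OF sp X0 sq elim(2) coin that] .
  have sub: "X u \<omega> \<subseteq> range (pt \<omega>)" if "0 \<le> u" for u
    using path_subset[OF sp X0 sq elim(2) that] .
  show ?case
  proof (rule nth_point_0_minimum)
    show "config_at X t \<omega> \<in> configurations" by (rule config_at_configurations[OF elim(4)])
    show "pt \<omega> 0 \<in> config_at X t \<omega>" using mem by (auto simp: config_at_def)
    have "config_at X t \<omega> \<subseteq> range (pt \<omega>)"
      using sub[of 0] sub[of "enn2real t"] by (auto simp: config_at_def)
    moreover have "pt \<omega> 0 \<le> pt \<omega> n" for n
      using strict_mono_less_eq[OF spaced_strict_mono[OF sp], of 0 n] by simp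
    ultimately show "pt \<omega> 0 \<le> y" if "y \<in> config_at X t \<omega>" for y
      using that by blast
  qed
qed

lemma distr_nth_point_0: "distr M borel (\<lambda>\<omega>. pt \<omega> 0) = \<nu>"
proof -
  have "distr M borel (\<lambda>\<omega>. pt \<omega> 0) = distr (distr M config_algebra (X 0)) borel (nth_point 0)"
    by (subst distr_distr) (auto simp: comp_def)
  then show ?thesis unfolding distr_X0 distr_Ren_nth_point_0 .
qed

end

section \<open>The limiting configuration\<close>

locale coalescence_limit = coalescence_process d \<nu> \<mu> dmax lamL lamR M X Z + lim: renewal d \<nu>' \<mu>'
  for d :: real and \<nu> \<mu> :: "real measure" and dmax :: real and lamL lamR :: "ereal \<Rightarrow> real"
    and M :: "'w measure" and X :: "real \<Rightarrow> 'w \<Rightarrow> real set" and Z :: "'w \<Rightarrow> int \<Rightarrow> real \<times> real"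
    and \<nu>' \<mu>' :: "real measure" +
  assumes limit_law: "distr M config_algebra (config_at X \<infinity>) = Ren \<nu>' \<mu>'"
begin

abbreviation Xinf :: "'w \<Rightarrow> real set" where
  "Xinf \<equiv> config_at X \<infinity>"

lemma AE_Xinf: "AE \<omega> in M. spaced d (\<lambda>n. nth_point n (Xinf \<omega>)) \<and> Xinf \<omega> = range (\<lambda>n. nth_point n (Xinf \<omega>))"
proof -
  have "AE \<omega> in M. enumerated d (Xinf \<omega>)"
    by (rule AE_distrD[OF config_at_measurable]) (unfold limit_law, rule lim.AE_enumerated)
  then show ?thesis
    using AE_space
  proof eventually_elim
    case (elim \<omega>)
    show ?case
      using elim(1) enumerated_eq_range[OF d_pos config_at_configurations[OF elim(2)]] d_pos
      by (simp add: spaced_def enumerated_def)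
  qed
qed

text \<open>Taken from the hypothesis that the limit is a renewal process: such a configuration is
  infinite, and its points correspond to the surviving indices.\<close>

lemma AE_infinitely_many_alive: "AE s in sites_law. \<forall>n. \<exists>k\<ge>n. sites.alive k s"
proof -
  have "AE \<omega> in M. \<forall>n. \<exists>k\<ge>n. sites.alive k (sq \<omega>)"
    using AE_Xinf AE_survivors
  proof eventually_elim
    case (elim \<omega>)
    have "inj (\<lambda>n. nth_point n (Xinf \<omega>))"
      using spaced_strict_mono elim(1) by (blast intro: strict_mono_imp_inj_on)
    then have "infinite (range (\<lambda>n. nth_point n (Xinf \<omega>)))" by (simp add: finite_image_iff)
    then have "infinite (Xinf \<omega>)" using elim(1) by metis
    then have "infinite {k. sites.alive k (sq \<omega>)}" unfolding elim(2) by blast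
    then show ?case unfolding infinite_nat_iff_unbounded_le by blast
  qed
  then have "AE s in distr M sites_law sq. \<forall>n. \<exists>k\<ge>n. sites.alive k s"
    by (subst AE_distr_iff) auto
  then show ?thesis unfolding distr_sq .
qed

lemma AE_first_two:
  "AE \<omega> in M. nth_point 0 (Xinf \<omega>) = pt \<omega> 0 + (\<Sum>j<sites.first_alive (sq \<omega>). fst (sq \<omega> j)) \<and>
    nth_gap d 0 (Xinf \<omega>) = (\<Sum>j<sites.gap_length (sq \<omega>). fst (shift (sites.first_alive (sq \<omega>)) (sq \<omega>) j))"
  using AE_Xinf AE_survivors AE_X0 AE_sq[OF AE_infinitely_many_alive]
proof eventually_elim
  case (elim \<omega>)
  let ?k = "sites.first_alive (sq \<omega>)" and ?m = "sites.gap_length (sq \<omega>)"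
  have sp: "spaced d (pt \<omega>)" and sp': "spaced d (\<lambda>n. nth_point n (Xinf \<omega>))" using elim by auto
  have k: "sites.alive ?k (sq \<omega>) \<and> (\<forall>j<?k. \<not> sites.alive j (sq \<omega>))"
    using sites.first_alive_eq_iff[of "sq \<omega>" ?k] elim(4) by blast
  have m: "0 < ?m \<and> sites.alive (?k + ?m) (sq \<omega>) \<and> (\<forall>j. ?k < j \<longrightarrow> j < ?k + ?m \<longrightarrow> \<not> sites.alive j (sq \<omega>))"
    using sites.gap_length_eq_iff[OF elim(4), of ?m] by blast
  have eq: "range (\<lambda>n. nth_point n (Xinf \<omega>)) = pt \<omega> ` {k. sites.alive k (sq \<omega>)}"
    using elim(1,2) by metis
  have least: "?k \<le> j" if "j \<in> {k. sites.alive k (sq \<omega>)}" for j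
    using k that by (metis linorder_not_less mem_Collect_eq)
  have next_least: "?k + ?m \<le> j" if "j \<in> {k. sites.alive k (sq \<omega>)}" "?k < j" for j
    using m that by (metis linorder_not_less mem_Collect_eq)
  have "nth_point 0 (Xinf \<omega>) = pt \<omega> ?k" "nth_point 1 (Xinf \<omega>) = pt \<omega> (?k + ?m)"
    using strict_mono_image_first_two[OF spaced_strict_mono[OF sp] spaced_strict_mono[OF sp'] eq, of ?k "?k + ?m"]
      k m least next_least by auto
  moreover have "nth_gap d 0 (Xinf \<omega>) = nth_point 1 (Xinf \<omega>) - nth_point 0 (Xinf \<omega>)"
    using sp' unfolding spaced_def nth_gap_def by (metis One_nat_def add.commute le_diff_eq max_absorb2)
  ultimately show ?case
    using pt_sum[OF sp, of 0 ?k] pt_sum[OF sp, of ?k ?m] by (simp add: shift_apply)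
qed

lemma limit_nu_eq: "\<nu>' = distr M borel (\<lambda>\<omega>. nth_point 0 (Xinf \<omega>))"
proof -
  have "distr M borel (\<lambda>\<omega>. nth_point 0 (Xinf \<omega>)) = distr (distr M config_algebra Xinf) borel (nth_point 0)"
    by (subst distr_distr) (auto simp: comp_def)
  then show ?thesis unfolding limit_law lim.distr_Ren_nth_point_0 by (rule sym)
qed

lemma limit_mu_eq: "\<mu>' = distr M (restrict_space borel {d..}) (\<lambda>\<omega>. nth_gap d 0 (Xinf \<omega>))"
proof -
  have "distr M (restrict_space borel {d..}) (\<lambda>\<omega>. nth_gap d 0 (Xinf \<omega>)) =
      distr (distr M config_algebra Xinf) (restrict_space borel {d..}) (nth_gap d 0)"
    by (subst distr_distr) (auto simp: comp_def)
  then show ?thesis unfolding limit_law lim.distr_Ren_nth_gap_0 by (rule sym)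
qed

lemma laplace_gap:
  assumes "0 \<le> Re s"
  shows "1 - laplace_on {d..} \<mu>' s = (1 - laplace_on {d..} \<mu> s) * exp (laplace_on {d..<dmax} \<mu> s)"
proof -
  note w = weight_damp[OF assms]
  note [measurable] = sites.pw_measurable[OF w]
  let ?f = "\<lambda>s'. sites.pw (damp s) (sites.gap_length s') (shift (sites.first_alive s') s')"
  have [measurable]: "(\<lambda>s'. sites.pw (damp s) (sites.gap_length s') (shift k s')) \<in> borel_measurable sites_law" for k
    by (rule measurable_compose_countable'[where I = UNIV and g = sites.gap_length and
      f = "\<lambda>m s'. sites.pw (damp s) m (shift k s')"]) auto
  have f [measurable]: "?f \<in> borel_measurable sites_law"
    by (rule measurable_compose_countable'[where I = UNIV and g = sites.first_alive and
      f = "\<lambda>k s'. sites.pw (damp s) (sites.gap_length s') (shift k s')"]) auto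
  have gap: "(\<lambda>\<omega>. nth_gap d 0 (Xinf \<omega>)) \<in> M \<rightarrow>\<^sub>M restrict_space borel {d..}"
    by (rule measurable_compose[OF config_at_measurable nth_gap_measurable])
  have "(\<lambda>g. exp (- s * complex_of_real g)) \<in> borel_measurable (restrict_space borel {d..})"
    by (rule measurable_restrict_space1) measurable
  note e = this
  have "laplace_on {d..} \<mu>' s = (\<integral>g. exp (- s * complex_of_real g) \<partial>\<mu>')"
    unfolding laplace_on_def set_lebesgue_integral_def by (rule LINT_cong) auto
  also have "\<dots> = (\<integral>\<omega>. exp (- s * complex_of_real (nth_gap d 0 (Xinf \<omega>))) \<partial>M)"
    by (subst limit_mu_eq, rule integral_distr[OF gap e])
  also have "\<dots> = (\<integral>\<omega>. ?f (sq \<omega>) \<partial>M)"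
  proof (rule integral_cong_AE)
    show "AE \<omega> in M. exp (- s * complex_of_real (nth_gap d 0 (Xinf \<omega>))) = ?f (sq \<omega>)"
      using AE_first_two by eventually_elim (simp only: pw_damp)
    show "(\<lambda>\<omega>. exp (- s * complex_of_real (nth_gap d 0 (Xinf \<omega>)))) \<in> borel_measurable M"
      by (rule measurable_compose[OF gap e])
  qed measurable
  also have "\<dots> = (\<integral>s'. ?f s' \<partial>distr M sites_law sq)"
    by (rule integral_distr[symmetric]) measurable
  also have "\<dots> = 1 - (1 - (\<integral>p. damp s p \<partial>site_law)) * exp (sites.mass (damp s) \<infinity>)"
    unfolding distr_sq by (rule sites.integral_pw_gap[OF AE_infinitely_many_alive w])
  finally show ?thesis unfolding integral_damp mass_damp by simp
qed

lemma first_pw_measurable [measurable]: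
  "0 \<le> Re s \<Longrightarrow> (\<lambda>s'. sites.pw (damp s) (sites.first_alive s') s') \<in> borel_measurable sites_law"
  by (rule measurable_compose_countable'[where I = UNIV and g = sites.first_alive and f = "sites.pw (damp s)"])
    (auto intro: sites.pw_measurable weight_damp)

lemma nth_point_Xinf_measurable [measurable]: "(\<lambda>\<omega>. nth_point 0 (Xinf \<omega>)) \<in> borel_measurable M"
  by (rule measurable_compose[OF config_at_measurable nth_point_measurable])

context
  fixes \<gamma> :: real
  assumes \<gamma>: "0 \<le> \<gamma>" and ratio: "\<And>g. d \<le> g \<Longrightarrow> lamL (ereal g) = \<gamma> * lamR (ereal g)"
begin

abbreviation shift_factor :: "complex \<Rightarrow> complex" where
  "shift_factor s \<equiv> exp ((laplace_on {d..<dmax} \<mu> s - laplace_on {d..<dmax} \<mu> 0) / complex_of_real (1 + \<gamma>))"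

lemma left_mass_one: "sites.left_mass (\<lambda>x. 1) = laplace_on {d..<dmax} \<mu> 0 / complex_of_real (1 + \<gamma>)"
  using left_mass_damp[OF _ \<gamma> ratio, of 0] unfolding damp_0 by simp

lemma integral_first_pw:
  assumes "0 \<le> Re s"
  shows "(\<integral>s'. sites.pw (damp s) (sites.first_alive s') s' \<partial>sites_law) = shift_factor s"
  using sites.integral_pw_first_alive_exp[OF AE_infinitely_many_alive weight_damp[OF assms]]
    left_mass_damp[OF assms \<gamma> ratio] left_mass_one
  by (simp add: diff_divide_distrib)

text \<open>The leftmost survivor is the initial leftmost point plus an independent displacement.
  For imaginary arguments all factors have modulus at most one, so Fubini applies for every
  \<nu>.\<close>

lemma laplace_first_imaginary:
  assumes "Re s = 0"
  shows "laplace_on UNIV \<nu>' s = laplace_on UNIV \<nu> s * shift_factor s"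
proof -
  let ?e = "\<lambda>x. exp (- s * complex_of_real x)"
  let ?f = "\<lambda>s'. sites.pw (damp s) (sites.first_alive s') s'"
  have Re: "0 \<le> Re s" using assms by simp
  note [measurable] = first_pw_measurable[OF Re]
  interpret V: pair_prob_space \<nu> sites_law by unfold_locales
  have e [measurable]: "?e \<in> borel_measurable borel" by measurable
  have e' [measurable]: "?e \<in> borel_measurable \<nu>" using e by (simp cong: measurable_cong_sets)
  have "laplace_on UNIV \<nu>' s = (\<integral>x. ?e x \<partial>\<nu>')"
    unfolding laplace_on_def set_lebesgue_integral_def by simp
  also have "\<dots> = (\<integral>\<omega>. ?e (nth_point 0 (Xinf \<omega>)) \<partial>M)"
    by (subst limit_nu_eq, rule integral_distr) measurable
  also have "\<dots> = (\<integral>\<omega>. ?e (pt \<omega> 0) * ?f (sq \<omega>) \<partial>M)"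
  proof (rule integral_cong_AE)
    show "AE \<omega> in M. ?e (nth_point 0 (Xinf \<omega>)) = ?e (pt \<omega> 0) * ?f (sq \<omega>)"
      using AE_first_two
    proof eventually_elim
      case (elim \<omega>)
      then show ?case unfolding pw_damp exp_add[symmetric] by (simp add: algebra_simps)
    qed
  qed measurable
  also have "\<dots> = (\<integral>p. ?e (fst p) * ?f (snd p) \<partial>distr M (\<nu> \<Otimes>\<^sub>M sites_law) (\<lambda>\<omega>. (pt \<omega> 0, sq \<omega>)))"
    by (subst integral_distr[OF sites_measurable]) auto
  also have "\<dots> = (\<integral>x. (\<integral>s'. ?e x * ?f s' \<partial>sites_law) \<partial>\<nu>)"
  proof -
    have "integrable (\<nu> \<Otimes>\<^sub>M sites_law) (\<lambda>p. ?e (fst p) * ?f (snd p))"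
    proof (rule V.P.integrable_const_bound[where B = 1])
      show "AE p in \<nu> \<Otimes>\<^sub>M sites_law. norm (?e (fst p) * ?f (snd p)) \<le> 1"
        using assms sites.pw_bound[OF weight_damp[OF Re]]
        by (intro AE_I2) (auto simp: norm_mult space_pair_measure)
    qed measurable
    from V.integral_fst'[OF this] show ?thesis unfolding distr_sites fst_conv snd_conv by (rule sym)
  qed
  also have "\<dots> = (\<integral>x. ?e x \<partial>\<nu>) * shift_factor s"
    by (simp only: integral_mult_right_zero integral_mult_left_zero integral_first_pw[OF Re])
  also have "(\<integral>x. ?e x \<partial>\<nu>) = laplace_on UNIV \<nu> s"
    unfolding laplace_on_def set_lebesgue_integral_def by simp
  finally show ?thesis .
qed

text \<open>On the real half-line \<nu> may have an infinite transform. Tonelli for nonnegative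
  integrands covers this case; only the displacement factor, bounded by one, is computed as an
  ordinary integral.\<close>

lemma laplace_first_real:
  assumes "0 \<le> s"
  shows "laplace_ext \<nu>' s = laplace_ext \<nu> s *
    ennreal (exp (Re (laplace_on {d..<dmax} \<mu> (complex_of_real s) - laplace_on {d..<dmax} \<mu> 0) / (1 + \<gamma>)))"
    (is "_ = _ * ennreal (exp ?h)")
proof -
  let ?e = "\<lambda>x. ennreal (exp (- s * x))"
  let ?f = "\<lambda>s'. sites.pw (damp (complex_of_real s)) (sites.first_alive s') s'"
  define R where "R s' = Re (?f s')" for s'
  have Re: "0 \<le> Re (complex_of_real s)" using assms by simp
  note [measurable] = first_pw_measurable[OF Re]
  have R_eq: "R s' = exp (- s * (\<Sum>j<sites.first_alive s'. fst (s' j)))" for s'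
  proof -
    have "?f s' = complex_of_real (exp (- s * (\<Sum>j<sites.first_alive s'. fst (s' j))))"
      unfolding pw_damp exp_of_real[symmetric] by simp
    then show ?thesis unfolding R_def by (simp only: Re_complex_of_real)
  qed
  have [measurable]: "R \<in> borel_measurable sites_law" unfolding R_def by measurable
  have int: "integrable sites_law ?f"
    by (rule sites.P.integrable_const_bound[where B = 1])
      (use sites.pw_bound[OF weight_damp[OF Re]] in auto)
  have e [measurable]: "?e \<in> borel_measurable borel" by measurable
  have e' [measurable]: "?e \<in> borel_measurable \<nu>" using e by (simp cong: measurable_cong_sets)
  have real: "laplace_on {d..<dmax} \<mu> (complex_of_real t) = complex_of_real (Re (laplace_on {d..<dmax} \<mu> (complex_of_real t)))" for t
  proof -
    have "laplace_on {d..<dmax} \<mu> (complex_of_real t) = (\<integral>g. complex_of_real (if g < dmax then exp (- t * g) else 0) \<partial>\<mu>)"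
      unfolding laplace_below_dmax by (rule LINT_cong) (auto simp: exp_of_real[symmetric])
    then show ?thesis unfolding integral_complex_of_real by (simp only: Re_complex_of_real)
  qed
  have "integrable sites_law R"
    unfolding R_def using int by (rule integrable_Re)
  then have "(\<integral>\<^sup>+s'. ennreal (R s') \<partial>sites_law) = ennreal (\<integral>s'. R s' \<partial>sites_law)"
  proof (rule nn_integral_eq_integral)
    show "AE s' in sites_law. 0 \<le> R s'" by (simp add: R_eq)
  qed
  also have "(\<integral>s'. R s' \<partial>sites_law) = Re (shift_factor (complex_of_real s))"
    unfolding R_def using int integral_first_pw[OF Re] by (simp add: integral_Re)
  also have "shift_factor (complex_of_real s) = complex_of_real (exp ?h)"
  proof -
    have "(laplace_on {d..<dmax} \<mu> (complex_of_real s) - laplace_on {d..<dmax} \<mu> 0) / complex_of_real (1 + \<gamma>) =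
      complex_of_real (?h)"
      using real[of s] real[of 0] by (metis minus_complex.sel(1) of_real_0 of_real_diff of_real_divide)
    then show ?thesis by (metis exp_of_real)
  qed
  finally have R_int: "(\<integral>\<^sup>+s'. ennreal (R s') \<partial>sites_law) = ennreal (exp ?h)"
    by (simp only: Re_complex_of_real)
  have "laplace_ext \<nu>' s = (\<integral>\<^sup>+\<omega>. ?e (nth_point 0 (Xinf \<omega>)) \<partial>M)"
    unfolding laplace_ext_def by (subst limit_nu_eq, rule nn_integral_distr) measurable
  also have "\<dots> = (\<integral>\<^sup>+\<omega>. ?e (pt \<omega> 0) * ennreal (R (sq \<omega>)) \<partial>M)"
  proof (rule nn_integral_cong_AE)
    show "AE \<omega> in M. ?e (nth_point 0 (Xinf \<omega>)) = ?e (pt \<omega> 0) * ennreal (R (sq \<omega>))"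
      using AE_first_two
    proof eventually_elim
      case (elim \<omega>)
      then show ?case
        unfolding R_eq by (simp add: ennreal_mult[symmetric] exp_add[symmetric] algebra_simps)
    qed
  qed
  also have "\<dots> = (\<integral>\<^sup>+p. ?e (fst p) * ennreal (R (snd p)) \<partial>distr M (\<nu> \<Otimes>\<^sub>M sites_law) (\<lambda>\<omega>. (pt \<omega> 0, sq \<omega>)))"
    by (subst nn_integral_distr[OF sites_measurable]) auto
  also have "\<dots> = (\<integral>\<^sup>+x. (\<integral>\<^sup>+s'. ?e x * ennreal (R s') \<partial>sites_law) \<partial>\<nu>)"
    unfolding distr_sites by (subst sites.P.nn_integral_fst[symmetric]) auto
  also have "\<dots> = (\<integral>\<^sup>+x. ?e x * (\<integral>\<^sup>+s'. ennreal (R s') \<partial>sites_law) \<partial>\<nu>)"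
    by (intro nn_integral_cong nn_integral_cmult) measurable
  also have "\<dots> = (\<integral>\<^sup>+x. ?e x \<partial>\<nu>) * (\<integral>\<^sup>+s'. ennreal (R s') \<partial>sites_law)"
    by (rule nn_integral_multc) measurable
  finally show ?thesis unfolding R_int laplace_ext_def .
qed

lemma survival_probability:
  "measure M {\<omega> \<in> space M. (LEAST x. x \<in> X 0 \<omega>) \<in> Xinf \<omega>} = exp (- Re (laplace_on {d..<dmax} \<mu> 0) / (1 + \<gamma>))"
proof -
  have least: "Measurable.pred M (\<lambda>\<omega>. (LEAST x. x \<in> X 0 \<omega>) \<in> Xinf \<omega>)"
    by (rule mem_configuration_measurable) (auto intro: Least_configuration_measurable)
  have "AE \<omega> in M. (LEAST x. x \<in> X 0 \<omega>) \<in> Xinf \<omega> \<longleftrightarrow> sites.alive 0 (sq \<omega>)"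
    using AE_X0 AE_survivors
  proof eventually_elim
    case (elim \<omega>)
    have mono: "strict_mono (pt \<omega>)" using elim(1) spaced_strict_mono by blast
    have "(LEAST x. x \<in> X 0 \<omega>) = pt \<omega> 0"
    proof (rule Least_equality)
      show "pt \<omega> 0 \<in> X 0 \<omega>" using elim(1) by (metis rangeI)
      fix y assume "y \<in> X 0 \<omega>"
      then obtain n where "y = pt \<omega> n" using elim(1) by (metis rangeE)
      then show "pt \<omega> 0 \<le> y" using strict_mono_less_eq[OF mono, of 0 n] by simp
    qed
    moreover have "pt \<omega> 0 \<in> pt \<omega> ` {k. sites.alive k (sq \<omega>)} \<longleftrightarrow> sites.alive 0 (sq \<omega>)"
      using strict_mono_eq[OF mono] by auto
    ultimately show ?case unfolding elim(2) by simp
  qed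
  then have "measure M {\<omega> \<in> space M. (LEAST x. x \<in> X 0 \<omega>) \<in> Xinf \<omega>} = measure M {\<omega> \<in> space M. sites.alive 0 (sq \<omega>)}"
  proof (intro measure_eq_AE)
    show "{\<omega> \<in> space M. (LEAST x. x \<in> X 0 \<omega>) \<in> Xinf \<omega>} \<in> sets M"
      using least by (simp add: pred_def)
    show "{\<omega> \<in> space M. sites.alive 0 (sq \<omega>)} \<in> sets M" by measurable
  qed auto
  also have "\<dots> = measure (distr M sites_law sq) {s \<in> space sites_law. sites.alive 0 s}"
  proof -
    have "{s \<in> space sites_law. sites.alive 0 s} \<in> sets sites_law" by measurable
    then have "measure (distr M sites_law sq) {s \<in> space sites_law. sites.alive 0 s} =
        measure M (sq -` {s \<in> space sites_law. sites.alive 0 s} \<inter> space M)"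
      by (rule measure_distr[OF sq_measurable])
    also have "sq -` {s \<in> space sites_law. sites.alive 0 s} \<inter> space M = {\<omega> \<in> space M. sites.alive 0 (sq \<omega>)}"
      using measurable_space[OF sq_measurable] by auto
    finally show ?thesis ..
  qed
  also have "\<dots> = exp (- Re (laplace_on {d..<dmax} \<mu> 0 / complex_of_real (1 + \<gamma>)))"
    unfolding distr_sq sites.measure_alive_0[OF AE_infinitely_many_alive] left_mass_one ..
  also have "Re (laplace_on {d..<dmax} \<mu> 0 / complex_of_real (1 + \<gamma>)) = Re (laplace_on {d..<dmax} \<mu> 0) / (1 + \<gamma>)"
    by (rule Re_divide_of_real)
  finally show ?thesis by simp
qed

end

end

lemma Re_laplace_args: "s \<in> laplace_args \<Longrightarrow> 0 \<le> Re s"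
  by (auto simp: laplace_args_def)

theorem theorem2p14:
  fixes dmin dmax :: real and lamL lamR :: "ereal \<Rightarrow> real"
    and \<nu> \<mu> :: "real measure" and \<nu>t \<mu>t :: "ennreal \<Rightarrow> real measure"
    and M :: "'w measure" and X :: "real \<Rightarrow> 'w \<Rightarrow> real set"
  assumes rates: "ocp_rates dmin dmax lamL lamR"
    and nu: "\<nu> \<in> space (prob_algebra borel)"
    and mu: "\<mu> \<in> space (prob_algebra (restrict_space borel {dmin..}))"
    and process: "ocp dmin lamL lamR (Ren \<nu> \<mu>) M X"
    and nu_t: "\<And>t. \<nu>t t \<in> space (prob_algebra borel)"
    and mu_t: "\<And>t. \<mu>t t \<in> space (prob_algebra (restrict_space borel {dmin..}))"
    and law_t: "\<And>t. distr M config_algebra (config_at X t) = Ren (\<nu>t t) (\<mu>t t)"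
  shows
    "let G = (\<lambda>t s. laplace_on {dmin..} (\<mu>t t) s);
         H = (\<lambda>t s. laplace_on {dmin..<dmax} (\<mu>t t) s) in
     (\<forall>s\<in>laplace_args. 1 - G \<infinity> s = (1 - G 0 s) * exp (H 0 s)) \<and>
     ((\<forall>d\<ge>ereal dmin. lamR d = 0) \<longrightarrow>
        (\<forall>t. \<nu>t t = \<nu>t 0 \<and>
          (\<forall>s\<ge>0. laplace_ext (\<nu>t t) s = laplace_ext (\<nu>t 0) s) \<and>
          (\<forall>y. laplace_on UNIV (\<nu>t t) (\<i> * complex_of_real y)
               = laplace_on UNIV (\<nu>t 0) (\<i> * complex_of_real y)))) \<and>
     (\<forall>\<gamma>\<ge>0. (\<forall>d\<ge>ereal dmin. lamL d = \<gamma> * lamR d) \<longrightarrow>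
        (\<forall>s\<ge>0. laplace_ext (\<nu>t \<infinity>) s = laplace_ext (\<nu>t 0) s *
            ennreal (exp (Re (H 0 (complex_of_real s) - H 0 0) / (1 + \<gamma>)))) \<and>
        (\<forall>y. let s = \<i> * complex_of_real y in
            laplace_on UNIV (\<nu>t \<infinity>) s = laplace_on UNIV (\<nu>t 0) s *
              exp ((H 0 s - H 0 0) / complex_of_real (1 + \<gamma>))) \<and>
        measure M {\<omega> \<in> space M. (LEAST x. x \<in> X 0 \<omega>) \<in> config_at X \<infinity> \<omega>}
          = exp (- Re (H 0 0) / (1 + \<gamma>)))"
proof -
  have "0 < dmin" using rates by (simp add: ocp_rates_def)
  have renewal: "renewal dmin (\<nu>t t) (\<mu>t t)" for t
    using \<open>0 < dmin\<close> nu_t mu_t by unfold_locales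
  obtain Z where Z: "Z \<in> M \<rightarrow>\<^sub>M mark_law"
    "distr M (config_algebra \<Otimes>\<^sub>M mark_law) (\<lambda>\<omega>. (X 0 \<omega>, Z \<omega>)) = Ren \<nu> \<mu> \<Otimes>\<^sub>M mark_law"
    "AE \<omega> in M. coalescence_path lamL lamR (Z \<omega>) (\<lambda>t. X t \<omega>)"
    using process unfolding ocp_def by blast
  have process': "prob_space M" "\<And>t. config_at X t \<in> M \<rightarrow>\<^sub>M config_algebra"
    using process unfolding ocp_def by blast+
  interpret coalescence_process dmin \<nu> \<mu> dmax lamL lamR M X Z
    by (intro coalescence_process.intro coalescence.intro renewal.intro coalescence_axioms.intro
      coalescence_process_axioms.intro \<open>0 < dmin\<close> nu mu rates process' Z)
  interpret coalescence_limit dmin \<nu> \<mu> dmax lamL lamR M X Z "\<nu>t \<infinity>" "\<mu>t \<infinity>"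
    by (intro coalescence_limit.intro coalescence_process_axioms renewal coalescence_limit_axioms.intro law_t)
  \<comment> \<open>The parameters at time 0 are only given through the law of \<open>X 0\<close>;
    uniqueness identifies them with \<nu> and \<mu>.\<close>
  have Ren_0: "Ren (\<nu>t 0) (\<mu>t 0) = Ren \<nu> \<mu>"
    using law_t[of 0] distr_X0 by (simp add: config_at_0)
  have nu_0: "\<nu>t 0 = \<nu>"
    using renewal.distr_Ren_nth_point_0[OF renewal, of 0] distr_Ren_nth_point_0 unfolding Ren_0 by simp
  have mu_0: "\<mu>t 0 = \<mu>"
    using renewal.distr_Ren_nth_gap_0[OF renewal, of 0] distr_Ren_nth_gap_0 unfolding Ren_0 by simp
  have nu_const: "\<nu>t t = \<nu>" if lamR: "\<forall>d\<ge>ereal dmin. lamR d = 0" for t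
  proof -
    have "\<nu>t t = distr (distr M config_algebra (config_at X t)) borel (nth_point 0)"
      unfolding law_t renewal.distr_Ren_nth_point_0[OF renewal] ..
    also have "\<dots> = distr M borel (\<lambda>\<omega>. nth_point 0 (config_at X t \<omega>))"
      by (subst distr_distr) (auto simp: comp_def)
    also have "\<dots> = distr M borel (\<lambda>\<omega>. pt \<omega> 0)"
    proof (rule distr_cong_AE)
      show "AE \<omega> in M. nth_point 0 (config_at X t \<omega>) = pt \<omega> 0"
        by (rule nth_point_0_config_at) (use lamR in \<open>auto simp: not_less\<close>)
      show "(\<lambda>\<omega>. nth_point 0 (config_at X t \<omega>)) \<in> borel_measurable M"
        by (rule measurable_compose[OF config_at_measurable nth_point_measurable])
    qed measurable
    finally show ?thesis unfolding distr_nth_point_0 .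
  qed
  have ratio: "lamL (ereal g) = \<gamma> * lamR (ereal g)"
    if "\<forall>d\<ge>ereal dmin. lamL d = \<gamma> * lamR d" "dmin \<le> g" for \<gamma> g
    using that by simp
  show ?thesis
    unfolding Let_def nu_0 mu_0
  proof (intro conjI ballI allI impI)
    fix s assume "s \<in> laplace_args"
    then show "1 - laplace_on {dmin..} (\<mu>t \<infinity>) s = (1 - laplace_on {dmin..} \<mu> s) * exp (laplace_on {dmin..<dmax} \<mu> s)"
      by (intro laplace_gap Re_laplace_args)
  next
    fix t assume "\<forall>d\<ge>ereal dmin. lamR d = 0"
    from nu_const[OF this, of t]
    show "\<nu>t t = \<nu>" "\<And>s. laplace_ext (\<nu>t t) s = laplace_ext \<nu> s"
      "\<And>y. laplace_on UNIV (\<nu>t t) (\<i> * complex_of_real y) = laplace_on UNIV \<nu> (\<i> * complex_of_real y)"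
      by simp_all
  next
    fix \<gamma> s :: real assume "0 \<le> \<gamma>" "\<forall>d\<ge>ereal dmin. lamL d = \<gamma> * lamR d" "0 \<le> s"
    then show "laplace_ext (\<nu>t \<infinity>) s = laplace_ext \<nu> s *
        ennreal (exp (Re (laplace_on {dmin..<dmax} \<mu> (complex_of_real s) - laplace_on {dmin..<dmax} \<mu> 0) / (1 + \<gamma>)))"
      using laplace_first_real[of \<gamma> s] ratio by blast
  next
    fix \<gamma> y :: real assume "0 \<le> \<gamma>" "\<forall>d\<ge>ereal dmin. lamL d = \<gamma> * lamR d"
    then show "laplace_on UNIV (\<nu>t \<infinity>) (\<i> * complex_of_real y) = laplace_on UNIV \<nu> (\<i> * complex_of_real y) *
        exp ((laplace_on {dmin..<dmax} \<mu> (\<i> * complex_of_real y) - laplace_on {dmin..<dmax} \<mu> 0) / complex_of_real (1 + \<gamma>))"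
      using laplace_first_imaginary[of \<gamma> "\<i> * complex_of_real y"] ratio by simp
  next
    fix \<gamma> :: real assume "0 \<le> \<gamma>" "\<forall>d\<ge>ereal dmin. lamL d = \<gamma> * lamR d"
    then show "measure M {\<omega> \<in> space M. (LEAST x. x \<in> X 0 \<omega>) \<in> config_at X \<infinity> \<omega>} =
        exp (- Re (laplace_on {dmin..<dmax} \<mu> 0) / (1 + \<gamma>))"
      using survival_probability[of \<gamma>] ratio by blast
  qed
qed

end
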